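(* Let $U,X$ be Hilbert spaces and let $(G,L,K)$ be an impedance passive boundary node on the spaces $(U,X,U)$. Consider the LQ optimal control problem of minimizing $J(x_0,u)=\int_0^\infty\|u(t)\|_U^2+\|y(t)\|_U^2\,\mathrm{d}t$ subject to $\dot x(t)=Lx(t)$, $Gx(t)=u(t)$, $y(t)=Kx(t)$, $t\ge0$, $x(0)=x_0$. Then the finite cost condition is satisfied and the optimal cost operator $\Pi$ satisfies $\Pi\le I$. Moreover, if $(G,L,K)$ is impedance energy preserving and if the semigroup generated by $L_{|\ker(G+K)}$ is strongly stable, then $\Pi=I$. In addition, the unique optimal control is given by $u^{\mathrm{opt}}(t)=-Kx^{\mathrm{opt}}(t)$, $t\ge0$, where $x^{\mathrm{opt}}$ is subject to $\dot x^{\mathrm{opt}}(t)=Lx^{\mathrm{opt}}(t)$, $(G+K)x^{\mathrm{opt}}(t)=0$ (with $x^{\mathrm{opt}}(0)=x_0$). Furthermore, $\Pi=I$ satisfies the boundary node Riccati equation $$\langle Lx,\Pi x\rangle_X+\langle \Pi x,Lx\rangle_X+\|Gx\|_U^2+\|Kx\|_U^2=\|Nx\|_U^2,\qquad x\in D(L),$$ with $N:D(L)\to U$, $Nx=(G+K)x$.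
   Context: Boundary node: for Hilbert spaces $U,X,Y$, a triple $(G,L,K)$ is a boundary node on $(U,X,Y)$ if $L:D(L)\subset X\to X$ is linear, $G\in\mathcal{L}(D(L),U)$, $K\in\mathcal{L}(D(L),Y)$ ($D(L)$ carrying the graph norm of $L$), and (i) $A:=L_{|\ker(G)}$ with $D(A)=\ker(G)$ generates a strongly continuous semigroup on $X$; (ii) $G$ has a bounded right inverse $G^r\in\mathcal{L}(U,D(L))$, $GG^r=I$. Impedance passive (here $Y=U$): $\mathrm{Re}\,\langle Lx,x\rangle_X\le\mathrm{Re}\,\langle Gx,Kx\rangle_U$ for all $x\in D(L)$; impedance energy preserving: equality for all $x\in D(L)$. Solutions: a classical solution $(x,u,y)$ on $[0,\infty)$ has $x\in C^1([0,\infty);X)$, $x(t)\in D(L)$, $u\in C([0,\infty);U)$, $y\in C([0,\infty);Y)$ and satisfies $\dot x=Lx$, $Gx=u$, $Kx=y$ for all $t\ge0$. A generalized solution is $(x,u,y)$ with $x\in C([0,\infty);X)$, $u\in L^2_{\mathrm{loc}}(0,\infty;U)$, $y\in L^2_{\mathrm{loc}}(0,\infty;Y)$ which is a limit of classical solutions $(x_k,u_k,y_k)$, with $x_k\to x$ uniformly on bounded intervals and $u_k\to u$, $y_k\to y$ in $L^2$ on every $[0,\tau]$. (These are the solutions of the associated system node $S=\begin{bmatrix}L\\ K\end{bmatrix}\begin{bmatrix}I\\ G\end{bmatrix}^{-1}$, $D(S)=\{(x,Gx)^\top:x\in D(L)\}$.) The cost is evaluated along generalized solutions with $x(0)=x_0\in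 X$, and the formulas for $u^{\mathrm{opt}},x^{\mathrm{opt}}$ are understood in this generalized sense. $L_{|\ker(G+K)}$ is the restriction of $L$ to $\{x\in D(L):Gx+Kx=0\}$. A semigroup $\mathbb{T}$ is strongly stable if $\|\mathbb{T}_tx_0\|\to0$ as $t\to\infty$ for every $x_0\in X$. Finite cost condition: for every $x_0\in X$ there is at least one input $u$ with $J(x_0,u)<\infty$. Optimal cost operator: the operator $\Pi=\Pi^*\in\mathcal{L}(X)$ with $\langle x_0,\Pi x_0\rangle_X=\inf_{u\in L^2(0,\infty;U)}J(x_0,u)$ for all $x_0\in X$; $\Pi\le I$ means $\langle x_0,\Pi x_0\rangle_X\le\|x_0\|_X^2$ for all $x_0\in X$. *)

theory Defs
  imports "HOL-Analysis.Analysis"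
begin

section \<open>Complex Hilbert spaces\<close>

text \<open>
  The inner product is linear in its first argument. Positive definiteness, the relation between
  norm and inner product, and the remaining vector space laws are inherited from
  \<^class>\<open>real_inner\<close> through the last axiom and \<open>scaleR_eq_scaleC\<close>.
\<close>

class chilbert_space = real_inner + complete_space +
  fixes scaleC :: "complex \<Rightarrow> 'a \<Rightarrow> 'a"
    and cinner :: "'a \<Rightarrow> 'a \<Rightarrow> complex"
  assumes scaleC_add_right: "scaleC c (x + y) = scaleC c x + scaleC c y"
    and scaleC_add_left: "scaleC (c + d) x = scaleC c x + scaleC d x"
    and scaleC_scaleC: "scaleC c (scaleC d x) = scaleC (c * d) x"
    and scaleR_eq_scaleC: "scaleR r x = scaleC (complex_of_real r) x"
    and cinner_commute: "cinner x y = cnj (cinner y x)"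
    and cinner_add_left: "cinner (x + y) z = cinner x z + cinner y z"
    and cinner_scaleC_left: "cinner (scaleC c x) y = c * cinner x y"
    and inner_eq_Re_cinner: "inner x y = Re (cinner x y)"

instantiation complex :: chilbert_space
begin

definition scaleC_complex :: "complex \<Rightarrow> complex \<Rightarrow> complex"
  where "scaleC_complex c x = c * x"

definition cinner_complex :: "complex \<Rightarrow> complex \<Rightarrow> complex"
  where "cinner_complex x y = x * cnj y"

instance
  by standard
    (auto simp: scaleC_complex_def cinner_complex_def inner_complex_def algebra_simps
      scaleR_conv_of_real)

end

section \<open>Linear operators\<close>

definition csubspace :: "'a::chilbert_space set \<Rightarrow> bool"
  where "csubspace D \<longleftrightarrow>
    0 \<in> D \<and> (\<forall>x\<in>D. \<forall>y\<in>D. x + y \<in> D) \<and> (\<forall>c. \<forall>x\<in>D. scaleC c x \<in> D)"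

definition clinear_on :: "'a::chilbert_space set \<Rightarrow> ('a \<Rightarrow> 'b::chilbert_space) \<Rightarrow> bool"
  where "clinear_on D f \<longleftrightarrow>
    (\<forall>x\<in>D. \<forall>y\<in>D. f (x + y) = f x + f y) \<and> (\<forall>c. \<forall>x\<in>D. f (scaleC c x) = scaleC c (f x))"

definition bounded_clinear :: "('a::chilbert_space \<Rightarrow> 'b::chilbert_space) \<Rightarrow> bool"
  where "bounded_clinear f \<longleftrightarrow> clinear_on UNIV f \<and> (\<exists>C. \<forall>x. norm (f x) \<le> C * norm x)"

text \<open>
  An unbounded operator is given by its domain \<open>D\<close> and a function \<open>L\<close>; the values of \<open>L\<close> outside
  of \<open>D\<close> are irrelevant.
\<close>

definition graph_norm :: "('a::chilbert_space \<Rightarrow> 'a) \<Rightarrow> 'a \<Rightarrow> real"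
  where "graph_norm L x = sqrt ((norm x)\<^sup>2 + (norm (L x))\<^sup>2)"

definition graph_bounded ::
    "'x::chilbert_space set \<Rightarrow> ('x \<Rightarrow> 'x) \<Rightarrow> ('x \<Rightarrow> 'u::chilbert_space) \<Rightarrow> bool"
  where "graph_bounded D L G \<longleftrightarrow>
    clinear_on D G \<and> (\<exists>C. \<forall>x\<in>D. norm (G x) \<le> C * graph_norm L x)"

section \<open>Strongly continuous semigroups\<close>

definition C0_semigroup :: "(real \<Rightarrow> 'x::chilbert_space \<Rightarrow> 'x) \<Rightarrow> bool"
  where "C0_semigroup T \<longleftrightarrow>
    (\<forall>t\<ge>0. bounded_clinear (T t)) \<and>
    (\<forall>x. T 0 x = x) \<and>
    (\<forall>s\<ge>0. \<forall>t\<ge>0. \<forall>x. T (s + t) x = T s (T t x)) \<and>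
    (\<forall>x. ((\<lambda>t. T t x) \<longlongrightarrow> x) (at_right 0))"

definition generates ::
    "'x::chilbert_space set \<Rightarrow> ('x \<Rightarrow> 'x) \<Rightarrow> (real \<Rightarrow> 'x \<Rightarrow> 'x) \<Rightarrow> bool"
  where "generates D A T \<longleftrightarrow>
    C0_semigroup T \<and>
    D = {x. \<exists>z. ((\<lambda>h. (T h x - x) /\<^sub>R h) \<longlongrightarrow> z) (at_right 0)} \<and>
    (\<forall>x\<in>D. ((\<lambda>h. (T h x - x) /\<^sub>R h) \<longlongrightarrow> A x) (at_right 0))"

definition strongly_stable :: "(real \<Rightarrow> 'x::chilbert_space \<Rightarrow> 'x) \<Rightarrow> bool"
  where "strongly_stable T \<longleftrightarrow> (\<forall>x. ((\<lambda>t. norm (T t x)) \<longlongrightarrow> 0) at_top)"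

section \<open>Boundary nodes\<close>

definition boundary_node ::
    "'x::chilbert_space set \<Rightarrow> ('x \<Rightarrow> 'u::chilbert_space) \<Rightarrow> ('x \<Rightarrow> 'x) \<Rightarrow>
      ('x \<Rightarrow> 'y::chilbert_space) \<Rightarrow> bool"
  where "boundary_node D G L K \<longleftrightarrow>
    csubspace D \<and> clinear_on D L \<and> graph_bounded D L G \<and> graph_bounded D L K \<and>
    (\<exists>T. generates {x\<in>D. G x = 0} L T) \<and>
    (\<exists>Gr. clinear_on UNIV Gr \<and> (\<forall>v. Gr v \<in> D) \<and>
          (\<exists>C. \<forall>v. graph_norm L (Gr v) \<le> C * norm v) \<and>
          (\<forall>v. G (Gr v) = v))"

definition impedance_passive ::
    "'x::chilbert_space set \<Rightarrow> ('x \<Rightarrow> 'u::chilbert_space) \<Rightarrow> ('x \<Rightarrow> 'x) \<Rightarrow> ('x \<Rightarrow> 'u) \<Rightarrow> bool"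
  where "impedance_passive D G L K \<longleftrightarrow>
    (\<forall>x\<in>D. Re (cinner (L x) x) \<le> Re (cinner (G x) (K x)))"

definition impedance_energy_preserving ::
    "'x::chilbert_space set \<Rightarrow> ('x \<Rightarrow> 'u::chilbert_space) \<Rightarrow> ('x \<Rightarrow> 'x) \<Rightarrow> ('x \<Rightarrow> 'u) \<Rightarrow> bool"
  where "impedance_energy_preserving D G L K \<longleftrightarrow>
    (\<forall>x\<in>D. Re (cinner (L x) x) = Re (cinner (G x) (K x)))"

section \<open>Square integrable functions on the half line\<close>

text \<open>
  The Hilbert spaces need not be separable, so measurability is Bochner (strong) measurability
  rather than \<open>borel_measurable\<close>. Functions equal almost everywhere are not identified.
\<close>

definition strongly_measurable :: "'a measure \<Rightarrow> ('a \<Rightarrow> 'b::chilbert_space) \<Rightarrow> bool"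
  where "strongly_measurable M f \<longleftrightarrow>
    (\<exists>s. (\<forall>k. simple_function M (s k)) \<and> (AE t in M. (\<lambda>k::nat. s k t) \<longlonglongrightarrow> f t))"

definition L2 :: "(real \<Rightarrow> 'a::chilbert_space) set"
  where "L2 = {f. strongly_measurable (lebesgue_on {0..}) f \<and>
    (\<integral>\<^sup>+t. ennreal ((norm (f t))\<^sup>2) \<partial>lebesgue_on {0..}) < \<infinity>}"

definition L2_loc :: "(real \<Rightarrow> 'a::chilbert_space) set"
  where "L2_loc = {f. strongly_measurable (lebesgue_on {0..}) f \<and>
    (\<forall>\<tau>>0. (\<integral>\<^sup>+t. ennreal ((norm (f t))\<^sup>2) \<partial>lebesgue_on {0..\<tau>}) < \<infinity>)}"

definition L2_loc_lim :: "(nat \<Rightarrow> real \<Rightarrow> 'a::chilbert_space) \<Rightarrow> (real \<Rightarrow> 'a) \<Rightarrow> bool"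
  where "L2_loc_lim fs f \<longleftrightarrow>
    (\<forall>\<tau>>0. (\<lambda>k. \<integral>\<^sup>+t. ennreal ((norm (fs k t - f t))\<^sup>2) \<partial>lebesgue_on {0..\<tau>}) \<longlonglongrightarrow> 0)"

section \<open>Solutions\<close>

definition classical_solution ::
    "'x::chilbert_space set \<Rightarrow> ('x \<Rightarrow> 'u::chilbert_space) \<Rightarrow> ('x \<Rightarrow> 'x) \<Rightarrow>
      ('x \<Rightarrow> 'y::chilbert_space) \<Rightarrow> (real \<Rightarrow> 'x) \<Rightarrow> (real \<Rightarrow> 'u) \<Rightarrow> (real \<Rightarrow> 'y) \<Rightarrow> bool"
  where "classical_solution D G L K x u y \<longleftrightarrow>
    (\<exists>x'. continuous_on {0..} x' \<and>
      (\<forall>t\<ge>0. (x has_vector_derivative x' t) (at t within {0..}) \<and>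
              x t \<in> D \<and> x' t = L (x t) \<and> G (x t) = u t \<and> K (x t) = y t)) \<and>
    continuous_on {0..} u \<and> continuous_on {0..} y"

definition generalized_solution ::
    "'x::chilbert_space set \<Rightarrow> ('x \<Rightarrow> 'u::chilbert_space) \<Rightarrow> ('x \<Rightarrow> 'x) \<Rightarrow>
      ('x \<Rightarrow> 'y::chilbert_space) \<Rightarrow> (real \<Rightarrow> 'x) \<Rightarrow> (real \<Rightarrow> 'u) \<Rightarrow> (real \<Rightarrow> 'y) \<Rightarrow> bool"
  where "generalized_solution D G L K x u y \<longleftrightarrow>
    continuous_on {0..} x \<and> u \<in> L2_loc \<and> y \<in> L2_loc \<and>
    (\<exists>xs us ys. (\<forall>k. classical_solution D G L K (xs k) (us k) (ys k)) \<and>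
      (\<forall>\<tau>>0. uniform_limit {0..\<tau>} xs x sequentially) \<and>
      L2_loc_lim us u \<and> L2_loc_lim ys y)"

section \<open>The LQ optimal control problem\<close>

text \<open>
  For a boundary node, \<open>x\<close> and (up to null sets) \<open>y\<close> are determined by \<open>x0\<close> and \<open>u\<close>, so the infimum only encodes that
  the cost is infinite if there is no generalized solution with initial state \<open>x0\<close> and input \<open>u\<close>;
  the node is not assumed to be well-posed, hence this can happen.
\<close>

definition cost ::
    "'x::chilbert_space set \<Rightarrow> ('x \<Rightarrow> 'u::chilbert_space) \<Rightarrow> ('x \<Rightarrow> 'x) \<Rightarrow>
      ('x \<Rightarrow> 'y::chilbert_space) \<Rightarrow> 'x \<Rightarrow> (real \<Rightarrow> 'u) \<Rightarrow> ennreal"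
  where "cost D G L K x0 u =
    Inf {\<integral>\<^sup>+t. ennreal ((norm (u t))\<^sup>2 + (norm (y t))\<^sup>2) \<partial>lebesgue_on {0..} | x y.
          generalized_solution D G L K x u y \<and> x 0 = x0}"

definition finite_cost_condition ::
    "'x::chilbert_space set \<Rightarrow> ('x \<Rightarrow> 'u::chilbert_space) \<Rightarrow> ('x \<Rightarrow> 'x) \<Rightarrow>
      ('x \<Rightarrow> 'y::chilbert_space) \<Rightarrow> bool"
  where "finite_cost_condition D G L K \<longleftrightarrow> (\<forall>x0. \<exists>u\<in>L2. cost D G L K x0 u < \<infinity>)"

definition optimal_cost ::
    "'x::chilbert_space set \<Rightarrow> ('x \<Rightarrow> 'u::chilbert_space) \<Rightarrow> ('x \<Rightarrow> 'x) \<Rightarrow>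
      ('x \<Rightarrow> 'y::chilbert_space) \<Rightarrow> 'x \<Rightarrow> ennreal"
  where "optimal_cost D G L K x0 = (INF u\<in>L2. cost D G L K x0 u)"

definition is_optimal_cost_operator ::
    "'x::chilbert_space set \<Rightarrow> ('x \<Rightarrow> 'u::chilbert_space) \<Rightarrow> ('x \<Rightarrow> 'x) \<Rightarrow>
      ('x \<Rightarrow> 'y::chilbert_space) \<Rightarrow> ('x \<Rightarrow> 'x) \<Rightarrow> bool"
  where "is_optimal_cost_operator D G L K P \<longleftrightarrow>
    bounded_clinear P \<and> (\<forall>x z. cinner (P x) z = cinner x (P z)) \<and>
    (\<forall>x0. optimal_cost D G L K x0 < \<infinity> \<and>
          cinner x0 (P x0) = complex_of_real (enn2real (optimal_cost D G L K x0)))"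

definition is_optimal_control ::
    "'x::chilbert_space set \<Rightarrow> ('x \<Rightarrow> 'u::chilbert_space) \<Rightarrow> ('x \<Rightarrow> 'x) \<Rightarrow>
      ('x \<Rightarrow> 'y::chilbert_space) \<Rightarrow> 'x \<Rightarrow> (real \<Rightarrow> 'u) \<Rightarrow> bool"
  where "is_optimal_control D G L K x0 u \<longleftrightarrow>
    u \<in> L2 \<and> (\<forall>v\<in>L2. cost D G L K x0 u \<le> cost D G L K x0 v)"

definition boundary_riccati ::
    "'x::chilbert_space set \<Rightarrow> ('x \<Rightarrow> 'u::chilbert_space) \<Rightarrow> ('x \<Rightarrow> 'x) \<Rightarrow>
      ('x \<Rightarrow> 'y::chilbert_space) \<Rightarrow> ('x \<Rightarrow> 'x) \<Rightarrow> ('x \<Rightarrow> 'v::chilbert_space) \<Rightarrow> bool"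
  where "boundary_riccati D G L K P N \<longleftrightarrow>
    (\<forall>x\<in>D. cinner (L x) (P x) + cinner (P x) (L x)
             + complex_of_real ((norm (G x))\<^sup>2) + complex_of_real ((norm (K x))\<^sup>2)
           = complex_of_real ((norm (N x))\<^sup>2))"

end

theory Submission
  imports Defs
begin

text \<open>
  Passivity gives, along solutions on \<open>[0, t]\<close>, the energy inequality
  \<open>\<parallel>x(t)\<parallel>\<^sup>2 + \<integral>\<parallel>u\<parallel>\<^sup>2 + \<integral>\<parallel>y\<parallel>\<^sup>2 \<le> \<parallel>x(0)\<parallel>\<^sup>2 + \<integral>\<parallel>u + y\<parallel>\<^sup>2\<close>, with equality in the energy preserving case.
  The feedback \<open>u = -y\<close> therefore costs at most \<open>\<parallel>x(0)\<parallel>\<^sup>2\<close>. It yields a solution for every initial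
  state because \<open>L\<close> restricted to \<open>ker (G + K)\<close> is m-dissipative: solving \<open>(\<lambda> - L) x = f\<close>, \<open>(G + K) x = 0\<close>
  reduces to inverting \<open>I + P(\<lambda>)\<close>, where passivity makes the transfer function \<open>P(\<lambda>)\<close> accretive.
  The optimal cost is the infimum of a quadratic form over linear fibres, hence itself quadratic and bounded,
  hence represented by an operator. If the closed loop is strongly stable, every solution of finite cost has
  \<open>u + y\<close> square integrable, so its state tends to \<open>0\<close>, and energy preservation turns the cost into
  \<open>\<parallel>x(0)\<parallel>\<^sup>2 + \<integral>\<parallel>u + y\<parallel>\<^sup>2\<close>, which is minimal exactly for \<open>u = -y\<close>.
\<close>

text \<open>The node is not assumed well-posed: a square integrable input need not admit any
  solution, so no estimate may rest on continuous dependence on \<open>u\<close> alone. The sum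
  \<open>u + y\<close> takes over the role of the input. It comes from polarization, 2 Re <u, y> =
  |u + y|^2 - |u|^2 - |y|^2. Applied to the difference of two solutions, the resulting inequality
  controls state, input and output at once. This single estimate yields the convergence of
  approximate closed loop solutions, the comparison of an arbitrary finite cost solution with the
  closed loop semigroup, and the uniqueness of the optimal control. Existence needs smooth orbits
  only from a dense set of initial states. Yosida approximation is therefore carried out just for
  data in the domain of the square of the closed loop operator, and generalized solutions arise as
  limits. The quadratic form is handled without minimizers: near-optimal solutions suffice for
  homogeneity and the parallelogram law.\<close>

instance chilbert_space \<subseteq> banach ..

section \<open>Algebra of complex scalars and the complex inner product\<close>

lemma scaleC_minus1: "scaleC (-1) (x::'a::chilbert_space) = - x"
  using scaleR_eq_scaleC[of "-1" x] by simp

lemma scaleC_one [simp]: "scaleC 1 (x::'a::chilbert_space) = x"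
  using scaleR_eq_scaleC[of 1 x] by simp

lemma scaleC_zero_right [simp]: "scaleC c (0::'a::chilbert_space) = 0"
  using scaleC_add_right[of c "0::'a" 0] by simp

lemma scaleC_zero_left [simp]: "scaleC 0 (x::'a::chilbert_space) = 0"
  using scaleR_eq_scaleC[of 0 x] by simp

lemma scaleC_minus_right: "scaleC c (- x) = - scaleC c (x::'a::chilbert_space)"
  using scaleC_add_right[of c x "- x"] by (simp add: eq_neg_iff_add_eq_0 add.commute)

lemma scaleC_diff_right: "scaleC c (x - y) = scaleC c x - scaleC c (y::'a::chilbert_space)"
  using scaleC_add_right[of c x "- y"] by (simp add: scaleC_minus_right)

lemma cinner_scaleC_right: "cinner x (scaleC c y) = cnj c * cinner x (y::'a::chilbert_space)"
  by (metis cinner_commute cinner_scaleC_left complex_cnj_mult)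

lemma cinner_same: "cinner x x = complex_of_real ((norm (x::'a::chilbert_space))\<^sup>2)"
proof -
  have "Im (cinner x x) = 0"
    using arg_cong[OF cinner_commute[of x x], of Im] by simp
  then show ?thesis
    by (simp add: complex_eq_iff inner_eq_Re_cinner[symmetric] power2_norm_eq_inner)
qed

lemma norm_scaleC: "norm (scaleC c (x::'a::chilbert_space)) = cmod c * norm x"
proof -
  have "complex_of_real ((norm (scaleC c x))\<^sup>2) = complex_of_real ((cmod c * norm x)\<^sup>2)"
    unfolding power_mult_distrib of_real_mult complex_norm_square
      cinner_same[of x, symmetric] cinner_same[of "scaleC c x", symmetric]
    by (simp add: cinner_scaleC_left cinner_scaleC_right)
  then have "(norm (scaleC c x))\<^sup>2 = (cmod c * norm x)\<^sup>2"
    using of_real_eq_iff by blast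
  then show ?thesis by (simp add: power2_eq_iff_nonneg)
qed

lemma bounded_linear_scaleC: "bounded_linear (scaleC c :: 'a::chilbert_space \<Rightarrow> 'a)"
  by (rule bounded_linear_intro[where K = "cmod c"])
    (simp_all add: scaleC_add_right scaleR_eq_scaleC scaleC_scaleC mult.commute norm_scaleC)

text \<open>Rotating one argument recovers the imaginary part from the real inner product. Complex
  self-adjointness thus reduces to real symmetry and commutation with
  \<open>scaleC \<i>\<close>.\<close>

lemma cinner_eq_inner:
  "cinner x (y::'a::chilbert_space) = Complex (inner x y) (inner x (scaleC \<i> y))"
  by (simp add: complex_eq_iff inner_eq_Re_cinner cinner_scaleC_right)

lemma clinear_on_scaleR:
  "clinear_on D f \<Longrightarrow> x \<in> D \<Longrightarrow> f (r *\<^sub>R x) = r *\<^sub>R f x"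
  by (simp add: clinear_on_def scaleR_eq_scaleC)

lemma csubspace_imp_subspace: "csubspace D \<Longrightarrow> subspace D"
  by (simp add: csubspace_def subspace_def scaleR_eq_scaleC)

lemma clinear_on_diff:
  assumes "csubspace D" "clinear_on D f" "x \<in> D" "y \<in> D"
  shows "f (x - y) = f x - f y"
proof -
  have "- y \<in> D" "f (- y) = - f y"
    using assms clinear_on_scaleR[of D f y "-1"] subspace_neg[OF csubspace_imp_subspace] by auto
  then show ?thesis
    using assms by (simp add: clinear_on_def diff_conv_add_uminus del: add_uminus_conv_diff)
qed

lemma bounded_clinear_imp_bounded_linear:
  assumes "bounded_clinear f" shows "bounded_linear f"
proof -
  obtain C where "\<And>x. norm (f x) \<le> C * norm x"
    using assms by (auto simp: bounded_clinear_def)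
  then show ?thesis
    using assms
    by (intro bounded_linear_intro[where K = C])
      (auto simp: bounded_clinear_def clinear_on_def scaleR_eq_scaleC mult.commute)
qed

section \<open>Projection and representation in real Hilbert spaces\<close>

lemma parallelogram_law:
  "(norm (x + y))\<^sup>2 + (norm (x - y))\<^sup>2 = 2 * (norm x)\<^sup>2 + 2 * (norm (y::'a::real_inner))\<^sup>2"
  by (simp add: power2_norm_eq_inner algebra_simps inner_commute)

text \<open>Midpoints of a minimizing sequence stay in \<open>S\<close>, so their norm is at least
  the infimum \<open>d\<close>; the parallelogram law turns this into the Cauchy property.\<close>

lemma min_norm_exists:
  fixes S :: "'a::{real_inner,complete_space} set"
  assumes "closed S" "convex S" "S \<noteq> {}"
  obtains z where "z \<in> S" "\<And>w. w \<in> S \<Longrightarrow> norm z \<le> norm w"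
proof -
  define d where "d = Inf (norm ` S)"
  have bdd: "bdd_below (norm ` S)" by (rule bdd_belowI[of _ 0]) auto
  have d_le: "d \<le> norm w" if "w \<in> S" for w
    unfolding d_def using that bdd by (intro cInf_lower) auto
  have d0: "0 \<le> d"
    unfolding d_def using assms(3) by (intro cInf_greatest) auto
  have "\<exists>w\<in>S. norm w < d + inverse (Suc n)" for n
    using cInf_lessD[of "norm ` S" "d + inverse (Suc n)"] assms(3) by (auto simp: d_def)
  then obtain w where w: "\<And>n. w n \<in> S" "\<And>n. norm (w n) < d + inverse (Suc n)" by metis
  have lim: "(\<lambda>n. d + inverse (real (Suc n))) \<longlonglongrightarrow> d + 0"
    by (intro tendsto_intros LIMSEQ_inverse_real_of_nat)
  have nlim: "(\<lambda>n. norm (w n)) \<longlonglongrightarrow> d"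
    by (rule tendsto_sandwich[OF _ _ tendsto_const lim[unfolded add_0_right]])
      (use d_le w(1) less_imp_le[OF w(2)] in \<open>auto simp del: of_nat_Suc\<close>)
  have par: "(norm (w m - w n))\<^sup>2 \<le> 2 * ((norm (w m))\<^sup>2 - d\<^sup>2) + 2 * ((norm (w n))\<^sup>2 - d\<^sup>2)" for m n
  proof -
    have "(1/2) *\<^sub>R w m + (1/2) *\<^sub>R w n \<in> S"
      using assms(2) w(1) by (simp add: convexD)
    then have "d \<le> norm ((1/2) *\<^sub>R (w m + w n))"
      by (metis d_le scaleR_add_right)
    then have "(2 * d)\<^sup>2 \<le> (norm (w m + w n))\<^sup>2" using d0 by (intro power_mono) auto
    then show ?thesis using parallelogram_law[of "w m" "w n"] by (simp add: power_mult_distrib)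
  qed
  have "Cauchy w"
  proof (rule metric_CauchyI)
    fix e :: real assume "0 < e"
    have "(\<lambda>n. (norm (w n))\<^sup>2 - d\<^sup>2) \<longlonglongrightarrow> d\<^sup>2 - d\<^sup>2"
      by (intro tendsto_intros nlim)
    then have "\<forall>\<^sub>F n in sequentially. (norm (w n))\<^sup>2 - d\<^sup>2 < e\<^sup>2 / 4"
      using \<open>0 < e\<close> by (intro order_tendstoD(2)[of _ 0]) auto
    then obtain N where N: "\<And>n. n \<ge> N \<Longrightarrow> (norm (w n))\<^sup>2 - d\<^sup>2 < e\<^sup>2 / 4"
      by (auto simp: eventually_sequentially)
    have "dist (w m) (w n) < e" if "m \<ge> N" "n \<ge> N" for m n
    proof -
      have "(norm (w m - w n))\<^sup>2 < e\<^sup>2"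
        using par[of m n] N[OF that(1)] N[OF that(2)] by simp
      then show ?thesis
        using \<open>0 < e\<close> by (simp add: dist_norm power2_less_imp_less)
    qed
    then show "\<exists>M. \<forall>m\<ge>M. \<forall>n\<ge>M. dist (w m) (w n) < e" by blast
  qed
  then obtain z where z: "w \<longlonglongrightarrow> z" using Cauchy_convergent_iff convergent_def by blast
  have "z \<in> S" using closed_sequentially[OF assms(1) _ z] w(1) by blast
  moreover have "norm z = d" using LIMSEQ_unique[OF tendsto_norm[OF z] nlim] .
  ultimately show thesis using d_le that by auto
qed

lemma min_norm_orthogonal:
  fixes z :: "'a::real_inner"
  assumes "\<And>r. norm z \<le> norm (z + r *\<^sub>R m)"
  shows "inner z m = 0"
proof (cases "m = 0")
  case False
  \<comment> \<open>This value minimizes the quadratic polynomial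
    \<open>norm (z + r *\<^sub>R m)\<close> squared in \<open>r\<close>.\<close>
  define r where "r = - inner z m / inner m m"
  have "(norm z)\<^sup>2 \<le> (norm (z + r *\<^sub>R m))\<^sup>2" using assms[of r] by (simp add: power_mono)
  also have "\<dots> = (norm z)\<^sup>2 + 2 * r * inner z m + r\<^sup>2 * inner m m"
    unfolding power2_norm_eq_inner by (simp add: algebra_simps inner_commute power2_eq_square)
  also have "\<dots> = (norm z)\<^sup>2 - (inner z m)\<^sup>2 / inner m m"
    using False by (simp add: r_def field_simps power2_eq_square)
  finally have "(inner z m)\<^sup>2 / inner m m \<le> 0" by simp
  moreover have "inner m m > 0" using False by simp
  ultimately show ?thesis by (metis divide_le_0_iff less_irrefl linorder_not_le power2_less_eq_zero_iff zero_le_power2 order_antisym)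
qed simp

lemma subspace_closure:
  fixes D :: "'a::real_normed_vector set"
  assumes "subspace D" shows "subspace (closure D)"
proof -
  have "x + y \<in> closure D" if xy: "x \<in> closure D" "y \<in> closure D" for x y
  proof -
    obtain f g where "\<And>n. f n \<in> D" "f \<longlonglongrightarrow> x" "\<And>n. g n \<in> D" "g \<longlonglongrightarrow> y"
      using xy by (auto simp: closure_sequential)
    then show ?thesis
      unfolding closure_sequential using assms
      by (intro exI[of _ "\<lambda>n. f n + g n"]) (auto intro: tendsto_add subspace_add)
  qed
  moreover have "c *\<^sub>R x \<in> closure D" if x: "x \<in> closure D" for c x
  proof -
    obtain f where "\<And>n. f n \<in> D" "f \<longlonglongrightarrow> x"
      using x by (auto simp: closure_sequential)
    then show ?thesis
      unfolding closure_sequential using assms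
      by (intro exI[of _ "\<lambda>n. c *\<^sub>R f n"]) (auto intro: tendsto_scaleR subspace_scale)
  qed
  ultimately show ?thesis
    using subspace_0[OF assms] closure_subset[of D] by (auto simp: subspace_def)
qed

text \<open>The element of least norm in the coset of a missing point \<open>x\<close> modulo
  \<open>closure D\<close> is orthogonal to \<open>D\<close>, hence zero, which puts
  \<open>x\<close> into \<open>closure D\<close>.\<close>

lemma dense_if_orthogonal_trivial:
  fixes D :: "'a::{real_inner,complete_space} set"
  assumes D: "subspace D" and orth: "\<And>y. (\<And>x. x \<in> D \<Longrightarrow> inner y x = 0) \<Longrightarrow> y = 0"
  shows "closure D = UNIV"
proof (rule ccontr)
  assume "closure D \<noteq> UNIV"
  then obtain x where x: "x \<notin> closure D" by blast
  have sub: "subspace (closure D)" by (rule subspace_closure[OF D])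
  let ?S = "(+) x ` closure D"
  obtain z where z: "z \<in> ?S" "\<And>w. w \<in> ?S \<Longrightarrow> norm z \<le> norm w"
    using min_norm_exists[of ?S] subspace_0[OF sub] subspace_imp_convex[OF sub]
    by (metis closed_closure closed_translation convex_translation empty_iff image_is_empty)
  obtain y where y: "y \<in> closure D" "z = x + y" using z(1) by auto
  have "inner z m = 0" if "m \<in> D" for m
  proof (rule min_norm_orthogonal)
    fix r :: real
    have "y + r *\<^sub>R m \<in> closure D"
      using y that closure_subset[of D] sub by (auto intro!: subspace_add subspace_scale)
    then show "norm z \<le> norm (z + r *\<^sub>R m)"
      by (intro z(2)) (auto simp: y add.assoc)
  qed
  then have "z = 0" by (rule orth)
  then have "x = - y" using y by (simp add: eq_neg_iff_add_eq_0)
  then show False using x y(1) subspace_neg[OF sub] by blast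
qed

text \<open>The point of least norm on the hyperplane where \<open>f\<close> equals 1 is orthogonal
  to the kernel of \<open>f\<close>, so a multiple of it represents \<open>f\<close>.\<close>

lemma riesz_representation:
  fixes f :: "'a::{real_inner,complete_space} \<Rightarrow> real"
  assumes "bounded_linear f"
  obtains z where "\<And>x. f x = inner z x"
proof (cases "\<forall>x. f x = 0")
  case True
  then show thesis using that[of 0] by simp
next
  case False
  interpret bounded_linear f by fact
  from False obtain x where x: "f x \<noteq> 0" by blast
  let ?S = "f -` {1}"
  have "closed ?S"
    by (intro closed_vimage linear_continuous_on assms closed_singleton)
  moreover have "convex ?S"
    by (auto simp: convex_def add scaleR)
  moreover have "(1 / f x) *\<^sub>R x \<in> ?S" using x by (simp add: scaleR)
  ultimately obtain z where z: "z \<in> ?S" "\<And>w. w \<in> ?S \<Longrightarrow> norm z \<le> norm w"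
    using min_norm_exists[of ?S] by blast
  have z0: "z \<noteq> 0" using z(1) zero by auto
  have orth: "inner z m = 0" if "f m = 0" for m
    by (rule min_norm_orthogonal, rule z(2)) (use z(1) that in \<open>simp add: add scaleR\<close>)
  have "f x = inner ((1 / inner z z) *\<^sub>R z) x" for x
  proof -
    have "f (x - f x *\<^sub>R z) = 0" using z(1) by (simp add: diff scaleR)
    from orth[OF this] show ?thesis using z0 by (simp add: inner_diff_right field_simps)
  qed
  then show thesis by (rule that)
qed

text \<open>Cauchy's functional equation. The deviation from linearity is additive and vanishes on
  the integers, so it is periodic and the local bound becomes global; a bounded additive function is
  zero.\<close>

lemma additive_locally_bounded_linear:
  fixes f :: "real \<Rightarrow> real"
  assumes add: "\<And>x y. f (x + y) = f x + f y" and bound: "\<And>x. \<bar>x\<bar> \<le> 1 \<Longrightarrow> \<bar>f x\<bar> \<le> C"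
  shows "f r = r * f 1"
proof -
  define g where "g x = f x - x * f 1" for x
  have gadd: "g (x + y) = g x + g y" for x y by (simp add: g_def add algebra_simps)
  have g1: "g 1 = 0" by (simp add: g_def)
  have g0: "g 0 = 0" using gadd[of 0 0] by simp
  have gneg: "g (- x) = - g x" for x using gadd[of x "- x"] g0 by simp
  have gnat: "g (real n * x) = real n * g x" for n x
    by (induction n) (simp_all add: g0 gadd algebra_simps)
  have gint: "g (real_of_int k) = 0" for k
  proof (cases k)
    case (nonneg n) then show ?thesis using gnat[of n 1] g1 by simp
  next
    case (neg n) then show ?thesis using gnat[of "Suc n" 1] gneg[of "real (Suc n)"] g1 by simp
  qed
  have gb: "\<bar>g x\<bar> \<le> C + \<bar>f 1\<bar>" for x
  proof -
    have "g x = g (frac x)"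
      using gadd[of "real_of_int \<lfloor>x\<rfloor>" "frac x"] gint by (simp add: frac_def)
    moreover have fr: "\<bar>frac x\<bar> \<le> 1" using frac_lt_1[of x] frac_ge_0[of x] by linarith
    moreover have "\<bar>frac x * f 1\<bar> \<le> \<bar>f 1\<bar>"
      using fr by (simp add: abs_mult mult_left_le_one_le)
    ultimately show ?thesis using bound[OF fr] by (simp add: g_def)
  qed
  have "g r = 0"
  proof (rule ccontr)
    assume "g r \<noteq> 0"
    then obtain n :: nat where "real n * \<bar>g r\<bar> > C + \<bar>f 1\<bar>"
      using reals_Archimedean3[of "\<bar>g r\<bar>"] by auto
    then show False using gb[of "real n * r"] by (simp add: gnat abs_mult)
  qed
  then show ?thesis by (simp add: g_def)
qed

text \<open>The Jordan--von Neumann argument for a form dominated by the norm. Domination supplies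
  the local bound behind real homogeneity, and rescaling to unit vectors sharpens the crude bound
  \<open>bnd\<close> to the Cauchy--Schwarz form.\<close>

lemma parallelogram_imp_bilinear:
  fixes V :: "'a::real_inner \<Rightarrow> real"
  assumes par: "\<And>x y. V (x + y) + V (x - y) = 2 * V x + 2 * V y"
    and scale: "\<And>r x. V (r *\<^sub>R x) = r\<^sup>2 * V x"
    and nonneg: "\<And>x. 0 \<le> V x" and bound: "\<And>x. V x \<le> (norm x)\<^sup>2"
  defines "B \<equiv> \<lambda>x y. (V (x + y) - V (x - y)) / 4"
  shows "B x y = B y x" "B x x = V x" "bounded_linear (B x)" "\<bar>B x y\<bar> \<le> norm x * norm y"
proof -
  have V0: "V 0 = 0" using scale[of 0 0] by simp
  have Vneg: "V (- x) = V x" for x using scale[of "-1" x] by simp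
  have Vminus: "V (x - y) = V (y - x)" for x y using Vneg[of "x - y"] by simp
  show sym: "B x y = B y x" for x y unfolding B_def by (simp add: add.commute Vminus)
  show "B x x = V x" using scale[of 2 x] by (simp add: B_def V0 scaleR_2)
  have B0: "B x 0 = 0" for x by (simp add: B_def)
  \<comment> \<open>With \<open>y = p + q\<close> and \<open>z = p - q\<close>, the parallelogram
    law around \<open>x + p\<close> and around \<open>x - p\<close> produces the same
    \<open>V q\<close> terms, which cancel.\<close>
  have half: "B x y + B x z = 2 * B x ((1/2) *\<^sub>R (y + z))" for x y z
  proof -
    define p q where "p = (1/2) *\<^sub>R (y + z)" and "q = (1/2) *\<^sub>R (y - z)"
    have yz: "y = p + q" "z = p - q"
      by (simp_all add: p_def q_def scaleR_add_right[symmetric] scaleR_diff_right[symmetric] scaleR_2[symmetric])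
    show ?thesis
      using par[of "x + p" q] par[of "x - p" q] unfolding p_def[symmetric]
      by (simp add: B_def yz field_simps)
  qed
  have dbl: "B x w = 2 * B x ((1/2) *\<^sub>R w)" for x w using half[of x w 0] B0 by simp
  have add: "B x (y + z) = B x y + B x z" for x y z using half[of x y z] dbl[of x "y + z"] by simp
  have bnd: "\<bar>B x y\<bar> \<le> ((norm x)\<^sup>2 + (norm y)\<^sup>2) / 2" for x y
  proof -
    have "4 * \<bar>B x y\<bar> \<le> V (x + y) + V (x - y)"
      using nonneg[of "x + y"] nonneg[of "x - y"] by (simp add: B_def abs_if field_simps)
    also have "\<dots> \<le> 2 * (norm x)\<^sup>2 + 2 * (norm y)\<^sup>2" using par[of x y] bound[of x] bound[of y] by simp
    finally show ?thesis by simp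
  qed
  have scaleB: "B x (r *\<^sub>R y) = r * B x y" for r x y
  proof -
    have "\<bar>B x (s *\<^sub>R y)\<bar> \<le> ((norm x)\<^sup>2 + (norm y)\<^sup>2) / 2" if "\<bar>s\<bar> \<le> 1" for s
    proof -
      have "(norm (s *\<^sub>R y))\<^sup>2 \<le> (norm y)\<^sup>2"
        using that by (intro power_mono) (auto simp: mult_left_le_one_le)
      then show ?thesis
        by (intro order_trans[OF bnd[of x "s *\<^sub>R y"]] divide_right_mono add_left_mono) auto
    qed
    from additive_locally_bounded_linear[of "\<lambda>s. B x (s *\<^sub>R y)", OF _ this, of r]
    show ?thesis by (simp add: scaleR_add_left add)
  qed
  show cs: "\<bar>B x y\<bar> \<le> norm x * norm y" for x y
  proof (cases "x = 0 \<or> y = 0")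
    case True
    then show ?thesis using B0 sym[of 0] by auto
  next
    case False
    define a b where "a = (1 / norm x) *\<^sub>R x" and "b = (1 / norm y) *\<^sub>R y"
    have "norm a = 1" "norm b = 1" using False by (simp_all add: a_def b_def)
    then have "\<bar>B a b\<bar> \<le> 1" using bnd[of a b] by simp
    moreover have "B x y = norm x * norm y * B a b"
    proof -
      have "B x y = B (norm x *\<^sub>R a) (norm y *\<^sub>R b)" using False by (simp add: a_def b_def)
      also have "\<dots> = norm y * (norm x * B b a)" by (simp only: scaleB sym[of _ b])
      finally show ?thesis by (simp add: sym[of b])
    qed
    ultimately show ?thesis by (simp add: abs_mult mult_left_le)
  qed
  show "bounded_linear (B x)"
    by (rule bounded_linear_intro[where K = "norm x"]) (use cs[of x] in \<open>auto simp: add scaleB mult.commute[of "norm x"]\<close>)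
qed

text \<open>Riesz representation of the polarized real form gives a real linear \<open>P\<close>.
  Since \<open>V\<close> does not change under multiplication by \<open>\<i>\<close>,
  \<open>P\<close> commutes with that rotation and is therefore complex linear and
  self-adjoint.\<close>

lemma quadratic_form_operator:
  fixes V :: "'a::chilbert_space \<Rightarrow> real"
  assumes par: "\<And>x y. V (x + y) + V (x - y) = 2 * V x + 2 * V y"
    and scale: "\<And>c x. V (scaleC c x) = (cmod c)\<^sup>2 * V x"
    and nonneg: "\<And>x. 0 \<le> V x" and bound: "\<And>x. V x \<le> (norm x)\<^sup>2"
  obtains P where "bounded_clinear P" "\<And>x z. cinner (P x) z = cinner x (P z)"
    "\<And>x. cinner x (P x) = complex_of_real (V x)"
proof -
  define B where "B \<equiv> \<lambda>x y. (V (x + y) - V (x - y)) / 4"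
  have scaleR: "V (r *\<^sub>R x) = r\<^sup>2 * V x" for r x by (simp add: scaleR_eq_scaleC scale)
  have B: "B x y = B y x" "B x x = V x" "\<bar>B x y\<bar> \<le> norm x * norm y" for x y
    unfolding B_def by (rule parallelogram_imp_bilinear[of V, OF par scaleR nonneg bound])+
  have bl: "bounded_linear (B x)" for x
    unfolding B_def by (rule parallelogram_imp_bilinear(3)[of V, OF par scaleR nonneg bound])
  have "\<exists>p. \<forall>y. B x y = inner p y" for x
    by (rule riesz_representation[OF bl[of x]]) blast
  then obtain P where P: "\<And>x y. B x y = inner (P x) y" by metis
  have eqI: "p = q" if "\<And>y. inner p y = inner q y" for p q :: 'a
    using that[of "p - q"] by (metis inner_diff_left inner_eq_zero_iff right_minus_eq)
  have iso: "B (scaleC \<i> x) (scaleC \<i> y) = B x y" for x y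
    by (simp add: B_def scaleC_add_right[symmetric] scaleC_diff_right[symmetric] scale)
  have isoi: "inner (scaleC \<i> x) (scaleC \<i> y) = inner x y" for x y :: 'a
    by (simp add: inner_eq_Re_cinner cinner_scaleC_left cinner_scaleC_right mult.assoc[symmetric])
  have ii: "scaleC \<i> (scaleC \<i> y) = - y" for y :: 'a by (simp add: scaleC_scaleC scaleC_minus1)
  have Padd: "P (x + y) = P x + P y" for x y
    by (rule eqI) (simp add: P[symmetric] inner_add_left B(1)[of "x + y"] B(1)[of x] B(1)[of y] linear_add[OF bounded_linear.linear[OF bl]])
  have PR: "P (r *\<^sub>R x) = r *\<^sub>R P x" for r x
    by (rule eqI) (simp add: P[symmetric] B(1)[of "r *\<^sub>R x"] B(1)[of x] linear_cmul[OF bounded_linear.linear[OF bl]])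
  have Pi: "P (scaleC \<i> x) = scaleC \<i> (P x)" for x
  proof (rule eqI)
    fix y
    \<comment> \<open>Writing \<open>y\<close> as minus its double rotation makes the invariance of
      \<open>B\<close> under rotating both arguments applicable.\<close>
    have "B (scaleC \<i> x) y = - B (scaleC \<i> x) (scaleC \<i> (scaleC \<i> y))"
      using linear_neg[OF bounded_linear.linear[OF bl]] by (simp add: ii)
    also have "\<dots> = - inner (P x) (scaleC \<i> y)" by (simp only: iso) (simp only: P)
    also have "\<dots> = inner (scaleC \<i> (P x)) y"
      using isoi[of "P x" "scaleC \<i> y"] by (simp add: ii)
    finally show "inner (P (scaleC \<i> x)) y = inner (scaleC \<i> (P x)) y" by (simp only: P)
  qed
  have PC: "P (scaleC c x) = scaleC c (P x)" for c x
  proof -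
    have c: "scaleC c z = Re c *\<^sub>R z + Im c *\<^sub>R scaleC \<i> z" for z :: 'a
      by (simp add: scaleR_eq_scaleC scaleC_scaleC scaleC_add_left[symmetric] complex_eq_iff mult.commute)
        (metis complex_eq mult.commute)
    show ?thesis by (simp only: c Padd PR Pi)
  qed
  have "norm (P x) \<le> 1 * norm x" for x
  proof -
    have "norm (P x) * norm (P x) \<le> norm x * norm (P x)"
      using B(3)[of x "P x"] by (simp add: P power2_norm_eq_inner[symmetric] power2_eq_square)
    then show ?thesis
      by (metis mult_1 mult_right_le_imp_le norm_ge_zero norm_le_zero_iff linorder_not_le order.trans)
  qed
  then have "bounded_clinear P"
    unfolding bounded_clinear_def clinear_on_def using Padd PC by blast
  moreover have symP: "inner (P x) z = inner x (P z)" for x z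
    using B(1)[of x z] by (simp add: P inner_commute)
  then have sa: "cinner (P x) z = cinner x (P z)" for x z
    by (simp add: cinner_eq_inner PC[symmetric])
  moreover have "cinner x (P x) = complex_of_real (V x)" for x
  proof -
    have "Im (cinner x (P x)) = 0"
      using arg_cong[OF cinner_commute[of x "P x"], of Im] sa[of x x] by simp
    moreover have "Re (cinner x (P x)) = V x"
      using B(2)[of x] by (simp add: P inner_eq_Re_cinner[symmetric] inner_commute)
    ultimately show ?thesis by (simp add: complex_eq_iff)
  qed
  ultimately show thesis by (rule that)
qed

lemma selfadjoint_eqI:
  fixes P Q :: "'a::chilbert_space \<Rightarrow> 'a"
  assumes P: "bounded_clinear P" "\<And>x z. cinner (P x) z = cinner x (P z)"
    and Q: "bounded_clinear Q" "\<And>x z. cinner (Q x) z = cinner x (Q z)"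
    and eq: "\<And>x. cinner x (P x) = cinner x (Q x)"
  shows "P = Q"
proof
  fix x
  define R where "R x = P x - Q x" for x
  interpret R: bounded_linear R
    unfolding R_def by (intro bounded_linear_sub bounded_clinear_imp_bounded_linear P Q)
  have sym: "inner (R y) z = inner y (R z)" for y z
    using arg_cong[OF P(2)[of y z], of Re] arg_cong[OF Q(2)[of y z], of Re] by (simp add: R_def inner_diff_left inner_diff_right inner_eq_Re_cinner[symmetric])
  have zero: "inner y (R y) = 0" for y
    using arg_cong[OF eq[of y], of Re] by (simp add: R_def inner_diff_right inner_eq_Re_cinner[symmetric])
  \<comment> \<open>Evaluating the vanishing quadratic form at \<open>x + R x\<close> isolates the
    square of the norm of \<open>R x\<close>.\<close>
  have "inner (x + R x) (R (x + R x)) = 2 * inner (R x) (R x)"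
    using zero[of x] zero[of "R x"] sym[of x "R x"] sym[of "R x" "R x"]
    by (simp add: R.add inner_add_left inner_add_right)
  then have "R x = 0" using zero[of "x + R x"] by simp
  then show "P x = Q x" by (simp add: R_def)
qed

section \<open>Uniform boundedness\<close>

text \<open>By Baire some sublevel set \<open>F k\<close> contains a ball. Moving the ball to the
  origin doubles the bound \<open>k\<close>, and dividing by the radius gives the constant.\<close>

lemma uniform_boundedness:
  fixes T :: "nat \<Rightarrow> 'a::banach \<Rightarrow> 'b::real_normed_vector"
  assumes lin: "\<And>n. bounded_linear (T n)" and pw: "\<And>x. bounded (range (\<lambda>n. T n x))"
  obtains M where "\<And>n x. norm (T n x) \<le> M * norm x"
proof -
  define F where "F k = {x. \<forall>n. norm (T n x) \<le> real k}" for k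
  have clF: "closed (F k)" for k
  proof -
    have "F k = (\<Inter>n. {x. norm (T n x) \<le> real k})" by (auto simp: F_def)
    moreover have "closed {x. norm (T n x) \<le> real k}" for n
      by (intro closed_Collect_le continuous_intros linear_continuous_on[OF lin, THEN continuous_on_norm])
    ultimately show ?thesis by auto
  qed
  have UF: "(\<Union>k. F k) = UNIV"
  proof safe
    fix x
    obtain b where "\<And>n. norm (T n x) \<le> b" using pw[of x] by (auto simp: bounded_iff)
    moreover obtain k :: nat where "b \<le> real k" using real_arch_simple by blast
    ultimately show "x \<in> (\<Union>k. F k)" by (auto simp: F_def intro: order_trans)
  qed simp
  have "\<exists>k. interior (F k) \<noteq> {}"
  proof (rule ccontr)
    assume "\<not> ?thesis"
    then have "Met_TC.mtopology interior_of \<Union>(range F) = {}"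
      by (intro Met_TC.metric_Baire_category_alt) (auto simp: clF)
    then show False using UF by simp
  qed
  then obtain k x e where e: "e > 0" "cball x e \<subseteq> F k"
    by (metis all_not_in_conv mem_interior_cball)
  have "norm (T n y) \<le> (2 * real k / e) * norm y" for n y
  proof (cases "y = 0")
    case True
    then show ?thesis using linear_0[OF bounded_linear.linear[OF lin]] by simp
  next
    case False
    let ?z = "(e / norm y) *\<^sub>R y"
    have "x + ?z \<in> cball x e" "x \<in> cball x e" using e False by (simp_all add: dist_norm)
    then have 1: "norm (T n (x + ?z)) \<le> real k" "norm (T n x) \<le> real k"
      using subsetD[OF e(2)] by (auto simp: F_def)
    have "T n ?z = T n (x + ?z) - T n x" using linear_add[OF bounded_linear.linear[OF lin]] by simp
    then have "norm (T n ?z) \<le> 2 * real k" using 1 norm_triangle_ineq4[of "T n (x + ?z)" "T n x"] by simp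
    then have "(e / norm y) * norm (T n y) \<le> 2 * real k"
      using linear_cmul[OF bounded_linear.linear[OF lin]] e by simp
    then show ?thesis using e False by (simp add: field_simps)
  qed
  then show thesis by (rule that)
qed

section \<open>Functions on the half line\<close>

lemma at_within_halfline:
  "0 \<le> t \<Longrightarrow> t < \<tau> \<Longrightarrow> at t within {0..} = at t within {0..\<tau>::real}"
  by (rule at_within_nhd[of _ "{..<\<tau>}"]) auto

lemma continuous_on_halfline:
  assumes "\<And>\<tau>::real. \<tau> > 0 \<Longrightarrow> continuous_on {0..\<tau>} f"
  shows "continuous_on {0..} f"
  unfolding continuous_on_eq_continuous_within
proof
  fix t :: real assume "t \<in> {0..}"
  then show "continuous (at t within {0..}) f"
    using assms[of "t + 1"] at_within_halfline[of t "t + 1"]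
    by (auto simp: continuous_on_eq_continuous_within)
qed

text \<open>Links the difference quotient that defines a generator with the derivative in the notion
  of a classical solution.\<close>

lemma has_vector_derivative_quotient:
  "(f has_vector_derivative d) (at t within S) \<longleftrightarrow>
    ((\<lambda>s. (f s - f t) /\<^sub>R (s - t)) \<longlongrightarrow> d) (at t within S)"
proof -
  have *: "norm ((1 / norm (s - t)) *\<^sub>R (f s - (f t + (s - t) *\<^sub>R d))) = norm ((f s - f t) /\<^sub>R (s - t) - d)"
    if "s \<noteq> t" for s
  proof -
    have "f s - (f t + (s - t) *\<^sub>R d) = (s - t) *\<^sub>R ((f s - f t) /\<^sub>R (s - t) - d)"
      using that by (simp add: scaleR_diff_right)
    then show ?thesis using that by (simp only: norm_scaleR) simp
  qed
  have "(f has_vector_derivative d) (at t within S) \<longleftrightarrow>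
    ((\<lambda>s. norm ((1 / norm (s - t)) *\<^sub>R (f s - (f t + (s - t) *\<^sub>R d)))) \<longlongrightarrow> 0) (at t within S)"
    by (simp only: has_vector_derivative_def has_derivative_within bounded_linear_scaleR_left
        tendsto_norm_zero_iff simp_thms)
  also have "\<dots> \<longleftrightarrow> ((\<lambda>s. norm ((f s - f t) /\<^sub>R (s - t) - d)) \<longlongrightarrow> 0) (at t within S)"
    by (rule filterlim_cong[OF refl refl], unfold eventually_at_filter, rule always_eventually) (use * in blast)
  also have "\<dots> \<longleftrightarrow> ((\<lambda>s. (f s - f t) /\<^sub>R (s - t)) \<longlongrightarrow> d) (at t within S)"
    by (simp only: tendsto_norm_zero_iff LIM_zero_iff)
  finally show ?thesis .
qed

lemma has_real_derivative_norm_square: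
  fixes x :: "real \<Rightarrow> 'a::real_inner"
  assumes "(x has_vector_derivative d) (at t within S)"
  shows "((\<lambda>t. (norm (x t))\<^sup>2) has_vector_derivative 2 * inner d (x t)) (at t within S)"
proof -
  have "((\<lambda>t. inner (x t) (x t)) has_derivative (\<lambda>h. inner (x t) (h *\<^sub>R d) + inner (h *\<^sub>R d) (x t))) (at t within S)"
    using assms unfolding has_vector_derivative_def by (intro has_derivative_inner) auto
  then show ?thesis
    unfolding has_vector_derivative_def power2_norm_eq_inner
    by (rule has_derivative_eq_rhs) (simp add: fun_eq_iff inner_commute)
qed

text \<open>Used twice below: with \<open>c = 0\<close> it gives contractivity of the approximating
  flows, with small positive \<open>c\<close> their Cauchy estimate.\<close>

lemma norm_square_growth:
  fixes x :: "real \<Rightarrow> 'a::real_inner"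
  assumes "0 \<le> \<tau>"
    and "\<And>t. t \<in> {0..\<tau>} \<Longrightarrow> (x has_vector_derivative x' t) (at t within {0..\<tau>})"
    and "\<And>t. t \<in> {0..\<tau>} \<Longrightarrow> 2 * inner (x' t) (x t) \<le> c"
  shows "(norm (x \<tau>))\<^sup>2 \<le> (norm (x 0))\<^sup>2 + c * \<tau>"
proof -
  have "((\<lambda>t. 2 * inner (x' t) (x t)) has_integral ((norm (x \<tau>))\<^sup>2 - (norm (x 0))\<^sup>2)) {0..\<tau>}"
    using assms by (intro fundamental_theorem_of_calculus has_real_derivative_norm_square) auto
  from has_integral_le[OF this has_integral_const_real] assms(1,3) show ?thesis
    by (fastforce simp: mult.commute)
qed

section \<open>Strongly continuous semigroups\<close>

locale C0 =
  fixes T :: "real \<Rightarrow> 'x::chilbert_space \<Rightarrow> 'x"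
  assumes C0: "C0_semigroup T"
begin

lemma T_bl: "0 \<le> t \<Longrightarrow> bounded_linear (T t)"
  using C0 by (simp add: C0_semigroup_def bounded_clinear_imp_bounded_linear)

lemma T_zero [simp]: "T 0 x = x"
  using C0 by (simp add: C0_semigroup_def)

lemma T_plus: "0 \<le> s \<Longrightarrow> 0 \<le> t \<Longrightarrow> T (s + t) x = T s (T t x)"
  using C0 by (simp add: C0_semigroup_def)

lemma T_diff: "0 \<le> t \<Longrightarrow> T t (x - y) = T t x - T t y"
  by (simp add: bounded_linear.linear[OF T_bl] linear_diff)

lemma T_scaleR: "0 \<le> t \<Longrightarrow> T t (r *\<^sub>R x) = r *\<^sub>R T t x"
  by (simp add: bounded_linear.linear[OF T_bl] linear_cmul)

lemma T_tendsto: "((\<lambda>t. T t x) \<longlongrightarrow> x) (at 0 within {0..})"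
proof -
  have "at_right (0::real) = at 0 within {0..}"
    by (rule at_within_nhd[of _ UNIV]) auto
  then show ?thesis using C0 by (simp add: C0_semigroup_def)
qed

text \<open>Otherwise there are times tending to 0 at which the operator norms are unbounded,
  although every orbit converges along these times; this contradicts uniform boundedness.\<close>

lemma bounded_near_zero: "\<exists>\<delta>>0. \<exists>M. \<forall>t\<in>{0..\<delta>}. \<forall>x. norm (T t x) \<le> M * norm x"
proof (rule ccontr)
  assume neg: "\<not> ?thesis"
  have "\<exists>t x. t \<in> {0..inverse (real (Suc n))} \<and> norm (T t x) > real n * norm x" for n
  proof -
    have "inverse (real (Suc n)) > 0" by simp
    then show ?thesis using neg by (meson linorder_not_le)
  qed
  then obtain t x where t: "\<And>n. t n \<in> {0..inverse (real (Suc n))}"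
    and x: "\<And>n. norm (T (t n) (x n)) > real n * norm (x n)" by metis
  have tlim: "t \<longlonglongrightarrow> 0"
    by (rule tendsto_sandwich[OF _ _ tendsto_const LIMSEQ_inverse_real_of_nat])
      (use t in \<open>auto simp del: of_nat_Suc\<close>)
  have "(\<lambda>n. T (t n) y) \<longlonglongrightarrow> y" for y
  proof -
    have "continuous (at 0 within {0..}) (\<lambda>t. T t y)"
      using T_tendsto[of y] by (simp add: continuous_within)
    then show ?thesis
      using continuous_within_tendsto_compose'[of 0 "{0..}" "\<lambda>t. T t y" t sequentially] t tlim by auto
  qed
  then have "bounded (range (\<lambda>n. T (t n) y))" for y
    by (rule convergent_imp_bounded)
  then obtain M where M: "\<And>n x. norm (T (t n) x) \<le> M * norm x"
    using uniform_boundedness[of "\<lambda>n. T (t n)"] T_bl t by (metis atLeastAtMost_iff)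
  obtain n :: nat where n: "M \<le> real n" using real_arch_simple by blast
  have "M * norm (x n) \<le> real n * norm (x n)" by (rule mult_right_mono[OF n norm_ge_zero])
  then show False using M[of n "x n"] x[of n] by linarith
qed

lemma bounded_on_interval:
  obtains M where "M \<ge> 0" "\<And>t x. t \<in> {0..\<tau>} \<Longrightarrow> norm (T t x) \<le> M * norm x"
proof -
  obtain \<delta> M0 where d: "\<delta> > 0" and M0: "\<And>t x. t \<in> {0..\<delta>} \<Longrightarrow> norm (T t x) \<le> M0 * norm x"
    using bounded_near_zero by blast
  \<comment> \<open>The maximum with 1 makes the powers of \<open>M\<close> increasing, so that a
    bound for \<open>k\<close> steps also covers shorter times.\<close>
  define M where "M = max 1 M0"
  have M: "norm (T t x) \<le> M * norm x" if "t \<in> {0..\<delta>}" for t x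
    by (rule order_trans[OF M0[OF that]]) (simp add: M_def mult_right_mono)
  have M1: "1 \<le> M" by (simp add: M_def)
  have *: "norm (T t x) \<le> M ^ Suc k * norm x" if "t \<in> {0..real (Suc k) * \<delta>}" for k t x
    using that
  proof (induction k arbitrary: t)
    case 0 then show ?case using M by simp
  next
    case (Suc k)
    show ?case
    proof (cases "t \<le> \<delta>")
      case True
      have "norm (T t x) \<le> M * norm x" using Suc.prems True by (intro M) auto
      also have "\<dots> \<le> M ^ Suc (Suc k) * norm x"
        using M1 self_le_power[of M "Suc (Suc k)"] by (intro mult_right_mono) auto
      finally show ?thesis .
    next
      case False
      have "norm (T t x) = norm (T \<delta> (T (t - \<delta>) x))"
        using False d T_plus[of \<delta> "t - \<delta>" x] by simp
      also have "\<dots> \<le> M * norm (T (t - \<delta>) x)" using d by (intro M) auto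
      also have "\<dots> \<le> M * (M ^ Suc k * norm x)"
        using Suc.prems False M1 by (intro mult_left_mono Suc.IH) (auto simp: algebra_simps)
      finally show ?thesis by (simp add: mult.assoc)
    qed
  qed
  obtain k :: nat where "\<tau> / \<delta> \<le> real k" using real_arch_simple by blast
  then have "\<tau> \<le> real (Suc k) * \<delta>" using d by (simp add: field_simps)
  then show thesis using that[of "M ^ Suc k"] M1 * by (smt (verit) atLeastAtMost_iff zero_le_power)
qed

lemma tendsto_diff_abs: "((\<lambda>s. \<bar>s - t\<bar>) \<longlongrightarrow> 0) (at t within {0..})" for t :: real
  by (rule tendsto_eq_intros | simp)+

text \<open>An increment from either side becomes an operator at the earlier time applied to a
  forward increment at 0. One estimate then serves both one-sided limits.\<close>

lemma T_diff_abs: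
  assumes "0 \<le> s" "0 \<le> t"
  shows "T s x - T t x = sgn (s - t) *\<^sub>R T (min s t) (T \<bar>s - t\<bar> x - x)"
  using T_plus[of s "t - s" x] T_plus[of t "s - t" x] assms
  by (cases s t rule: linorder_cases) (auto simp: T_diff sgn_if min_def)

lemma orbit_continuous: "continuous_on {0..} (\<lambda>t. T t x)"
  unfolding continuous_on
proof
  fix t :: real assume t: "t \<in> {0..}"
  obtain M where M: "M \<ge> 0" "\<And>s x. s \<in> {0..t} \<Longrightarrow> norm (T s x) \<le> M * norm x"
    using bounded_on_interval[of t] by blast
  have "((\<lambda>s. T \<bar>s - t\<bar> x) \<longlongrightarrow> x) (at t within {0..})"
    using continuous_within_tendsto_compose'[of 0 "{0..}" "\<lambda>t. T t x" "\<lambda>s. \<bar>s - t\<bar>" "at t within {0..}"]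
      T_tendsto[of x] tendsto_diff_abs[of t] by (simp add: continuous_within)
  then have "((\<lambda>s. M * norm (T \<bar>s - t\<bar> x - x)) \<longlongrightarrow> M * norm (x - x)) (at t within {0..})"
    by (intro tendsto_intros)
  then have lim: "((\<lambda>s. M * norm (T \<bar>s - t\<bar> x - x)) \<longlongrightarrow> 0) (at t within {0..})" by simp
  have "norm (T s x - T t x) \<le> M * norm (T \<bar>s - t\<bar> x - x)" if "s \<ge> 0" for s
  proof -
    have "norm (T s x - T t x) \<le> norm (T (min s t) (T \<bar>s - t\<bar> x - x))"
      using that t by (simp add: T_diff_abs mult_left_le_one_le sgn_if)
    also have "\<dots> \<le> M * norm (T \<bar>s - t\<bar> x - x)" using that t by (intro M(2)) auto
    finally show ?thesis .
  qed
  then have "((\<lambda>s. T s x - T t x) \<longlongrightarrow> 0) (at t within {0..})"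
    by (intro Lim_null_comparison[OF _ lim]) (auto simp: eventually_at_filter)
  then show "((\<lambda>s. T s x) \<longlongrightarrow> T t x) (at t within {0..})" by (simp add: LIM_zero_iff)
qed

text \<open>The generator only supplies a right derivative at 0. The quotient at \<open>t\<close>
  splits into \<open>T (min s t) (q \<bar>s - t\<bar> - z)\<close>, small by the uniform bound on
  \<open>[0, t]\<close>, and \<open>T (min s t) z\<close>, which converges by continuity of the
  orbit.\<close>

lemma orbit_derivative:
  assumes A: "((\<lambda>h. (T h x - x) /\<^sub>R h) \<longlongrightarrow> z) (at_right 0)" and t: "0 \<le> t"
  shows "((\<lambda>t. T t x) has_vector_derivative T t z) (at t within {0..})"
  unfolding has_vector_derivative_quotient
proof -
  obtain M where M: "M \<ge> 0" "\<And>s x. s \<in> {0..t} \<Longrightarrow> norm (T s x) \<le> M * norm x"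
    using bounded_on_interval[of t] by blast
  define q where "q h = (T h x - x) /\<^sub>R h" for h
  have "filterlim (\<lambda>s. \<bar>s - t\<bar>) (at_right 0) (at t within {0..})"
    unfolding filterlim_at using tendsto_diff_abs[of t] by (auto simp: eventually_at_filter)
  from filterlim_compose[OF A this]
  have "((\<lambda>s. q \<bar>s - t\<bar>) \<longlongrightarrow> z) (at t within {0..})" by (simp add: q_def)
  then have "((\<lambda>s. M * norm (q \<bar>s - t\<bar> - z)) \<longlongrightarrow> M * norm (z - z)) (at t within {0..})"
    by (intro tendsto_intros)
  then have lim: "((\<lambda>s. M * norm (q \<bar>s - t\<bar> - z)) \<longlongrightarrow> 0) (at t within {0..})" by simp
  have "norm (T (min s t) (q \<bar>s - t\<bar> - z)) \<le> M * norm (q \<bar>s - t\<bar> - z)" if "s \<ge> 0" for s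
    using that t by (intro M(2)) auto
  then have 1: "((\<lambda>s. T (min s t) (q \<bar>s - t\<bar> - z)) \<longlongrightarrow> 0) (at t within {0..})"
    by (intro Lim_null_comparison[OF _ lim]) (auto simp: eventually_at_filter)
  have "((\<lambda>s. min s t) \<longlongrightarrow> t) (at t within {0..})"
    by (rule tendsto_eq_intros | simp)+
  then have 2: "((\<lambda>s. T (min s t) z) \<longlongrightarrow> T t z) (at t within {0..})"
    by (intro continuous_on_tendsto_compose[OF orbit_continuous]) (use t in \<open>auto simp: eventually_at_filter\<close>)
  have "((\<lambda>s. T (min s t) (q \<bar>s - t\<bar> - z) + T (min s t) z) \<longlongrightarrow> 0 + T t z) (at t within {0..})"
    by (intro tendsto_intros 1 2)
  moreover have "T (min s t) (q \<bar>s - t\<bar> - z) + T (min s t) z = (T s x - T t x) /\<^sub>R (s - t)"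
    if "s \<ge> 0" "s \<noteq> t" for s
  proof -
    have "(T s x - T t x) /\<^sub>R (s - t) = (sgn (s - t) / (s - t)) *\<^sub>R T (min s t) (T \<bar>s - t\<bar> x - x)"
      using that t by (simp add: T_diff_abs divide_inverse mult.commute)
    also have "sgn (s - t) / (s - t) = inverse \<bar>s - t\<bar>"
      using that inverse_minus_eq[of "s - t"] by (auto simp: sgn_if abs_if divide_inverse)
    finally show ?thesis using that t by (simp add: q_def T_scaleR T_diff)
  qed
  ultimately show "((\<lambda>s. (T s x - T t x) /\<^sub>R (s - t)) \<longlongrightarrow> T t z) (at t within {0..})"
    by (subst (asm) filterlim_cong[OF refl refl]) (auto simp: eventually_at_filter)
qed

lemma orbit_in_domain:
  assumes A: "((\<lambda>h. (T h x - x) /\<^sub>R h) \<longlongrightarrow> z) (at_right 0)" and t: "0 \<le> t"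
  shows "((\<lambda>h. (T h (T t x) - T t x) /\<^sub>R h) \<longlongrightarrow> T t z) (at_right 0)"
proof -
  have "((\<lambda>h. T t ((T h x - x) /\<^sub>R h)) \<longlongrightarrow> T t z) (at_right 0)"
    by (rule bounded_linear.tendsto[OF T_bl[OF t] A])
  moreover have "T t ((T h x - x) /\<^sub>R h) = (T h (T t x) - T t x) /\<^sub>R h" if "h > 0" for h
    using that t T_plus[of h t x] T_plus[of t h x] by (simp add: T_scaleR T_diff add.commute)
  ultimately show ?thesis
    by (subst (asm) filterlim_cong[OF refl refl]) (auto simp: eventually_at_filter)
qed

text \<open>The truncated Laplace transform \<open>w = \<integral>\<^sub>0\<^sup>1 e\<^sup>-\<^sup>\<lambda>\<^sup>s T(s)x ds\<close> solves
  \<open>(\<lambda> - A) w = x - e\<^sup>-\<^sup>\<lambda> T(1) x\<close>; this avoids exponential growth bounds and improper integrals.\<close>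

lemma truncated_resolvent:
  obtains w where "((\<lambda>h. (T h w - w) /\<^sub>R h) \<longlongrightarrow> l *\<^sub>R w - (x - exp (- l) *\<^sub>R T 1 x)) (at_right 0)"
proof -
  define g where "g s = exp (- l * s) *\<^sub>R T s x" for s
  have gc: "continuous_on {a..b} g" if "0 \<le> a" for a b
    unfolding g_def using that
    by (intro continuous_intros continuous_on_subset[OF orbit_continuous]) auto
  define F where "F r = integral {0..r} g" for r
  define w where "w = F 1"
  \<comment> \<open>The interval extends beyond 1 because the shifted endpoint \<open>1 + h\<close>
    is differentiated from the right at \<open>h = 0\<close>.\<close>
  have F': "(F has_vector_derivative g r) (at r within {0..2})" if "r \<in> {0..2}" for r
    unfolding F_def using that by (intro integral_has_vector_derivative gc) auto
  \<comment> \<open>Applying \<open>T h\<close> slides the window of integration from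
    \<open>[0, 1]\<close> to \<open>[h, 1 + h]\<close> up to an exponential factor, so only the
    endpoints and that factor contribute to the derivative at 0.\<close>
  have Tw: "T h w = exp (l * h) *\<^sub>R (F (1 + h) - F h)" if h: "0 \<le> h" for h
  proof -
    have "T h w = integral {0..1} (T h \<circ> g)"
      unfolding w_def F_def
      by (rule integral_linear[OF integrable_continuous_real[OF gc] T_bl[OF h], symmetric]) simp
    also have "\<dots> = integral {0..1} (\<lambda>s. exp (l * h) *\<^sub>R (g \<circ> (+) h) s)"
      using h by (intro integral_cong)
        (auto simp: g_def T_scaleR T_plus[symmetric] exp_add[symmetric] distrib_left)
    also have "\<dots> = exp (l * h) *\<^sub>R integral {0..1} (g \<circ> (+) h)" by (simp add: o_def)
    also have "integral {0..1} (g \<circ> (+) h) = integral {h..1 + h} g"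
      using integral_shift_Icc_real[of 0 1 g h] by simp
    also have "\<dots> = F (1 + h) - F h"
      unfolding F_def using Henstock_Kurzweil_Integration.integral_combine[where a = 0 and b = "1 + h" and c = h and f = g] h
      by (simp add: integrable_continuous_real gc algebra_simps)
    finally show ?thesis .
  qed
  have shift: "((\<lambda>h. F (1 + h)) has_vector_derivative g 1) (at 0 within {0..1})"
  proof -
    have "(F \<circ> (\<lambda>h. 1 + h) has_vector_derivative (1 *\<^sub>R g 1)) (at 0 within {0..1})"
      by (rule vector_diff_chain_within)
        (auto intro!: derivative_eq_intros has_vector_derivative_within_subset[OF F'])
    then show ?thesis by (simp add: o_def)
  qed
  have "((\<lambda>h. exp (l * h) *\<^sub>R (F (1 + h) - F h)) has_vector_derivative
      exp (l * 0) *\<^sub>R (g 1 - g 0) + (l * exp (l * 0)) *\<^sub>R (F (1 + 0) - F 0)) (at 0 within {0..1})"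
    by (intro has_vector_derivative_scaleR has_vector_derivative_diff shift has_vector_derivative_within_subset[OF F'])
      (auto intro!: derivative_eq_intros)
  moreover have "exp (l * 0) *\<^sub>R (g 1 - g 0) + (l * exp (l * 0)) *\<^sub>R (F (1 + 0) - F 0)
      = l *\<^sub>R w - (x - exp (- l) *\<^sub>R T 1 x)"
    by (simp add: g_def w_def F_def algebra_simps)
  ultimately have "((\<lambda>h. T h w) has_vector_derivative l *\<^sub>R w - (x - exp (- l) *\<^sub>R T 1 x)) (at 0 within {0..1})"
    by (metis (no_types, lifting) Tw atLeastAtMost_iff has_vector_derivative_transform zero_le_one order_refl)
  moreover have "at (0::real) within {0..1} = at_right 0"
    by (rule at_within_nhd[of _ "{..<1}"]) auto
  ultimately show thesis using that by (simp add: has_vector_derivative_quotient)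
qed

end

lemma generates_C0: "generates D A T \<Longrightarrow> C0 T"
  by (simp add: generates_def C0_def)

lemma generates_tendsto:
  "generates D A T \<Longrightarrow> x \<in> D \<Longrightarrow> ((\<lambda>h. (T h x - x) /\<^sub>R h) \<longlongrightarrow> A x) (at_right 0)"
  by (simp add: generates_def)

lemma generates_domainI:
  assumes "generates D A T" "((\<lambda>h. (T h x - x) /\<^sub>R h) \<longlongrightarrow> z) (at_right 0)"
  shows "x \<in> D" "A x = z"
proof -
  show "x \<in> D" using assms by (auto simp: generates_def)
  then show "A x = z"
    using tendsto_unique[OF _ generates_tendsto[OF assms(1)] assms(2)] by simp
qed

lemma generates_orbit:
  assumes gen: "generates D A T" and x: "x \<in> D" and t: "0 \<le> t"
  shows "T t x \<in> D" "A (T t x) = T t (A x)"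
    "((\<lambda>t. T t x) has_vector_derivative A (T t x)) (at t within {0..})"
proof -
  interpret C0 T by (rule generates_C0[OF gen])
  note d = generates_tendsto[OF gen x]
  show "T t x \<in> D" "A (T t x) = T t (A x)"
    using generates_domainI[OF gen orbit_in_domain[OF d t]] by auto
  with orbit_derivative[OF d t]
  show "((\<lambda>t. T t x) has_vector_derivative A (T t x)) (at t within {0..})" by simp
qed

text \<open>The truncated Laplace transform solves the resolvent equation with right-hand side
  \<open>x - exp (- l) *\<^sub>R T 1 x\<close>. For large \<open>l\<close> this expression covers
  every \<open>f\<close>, as the fixed point map for \<open>x\<close> contracts.\<close>

lemma generates_surj:
  assumes gen: "generates D A T"
  obtains l0 where "l0 > 0" "\<And>l f. l \<ge> l0 \<Longrightarrow> \<exists>x\<in>D. l *\<^sub>R x - A x = f"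
proof -
  interpret C0 T by (rule generates_C0[OF gen])
  obtain M where M: "M \<ge> 0" "\<And>x. norm (T 1 x) \<le> M * norm x"
    using bounded_on_interval[of 1] by (metis atLeastAtMost_iff order_refl zero_le_one)
  show thesis
  \<comment> \<open>From this threshold on, \<open>exp l\<close> is at least \<open>1 + l\<close>
    and hence at least \<open>2 * M\<close>, which makes the contraction factor at most 1/2.\<close>
  proof (rule that[of "2 * M + 1"])
    show "0 < 2 * M + 1" using M by simp
    fix l f assume l: "2 * M + 1 \<le> l"
    have "exp (- l) * (2 * M) \<le> exp (- l) * exp l"
      using l exp_ge_add_one_self[of l] by (intro mult_left_mono) (linarith, simp)
    then have c: "exp (- l) * M \<le> 1 / 2" by (simp add: exp_minus field_simps)
    have "dist (f + exp (- l) *\<^sub>R T 1 x) (f + exp (- l) *\<^sub>R T 1 y) \<le> 1 / 2 * dist x y" for x y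
    proof -
      have "dist (f + exp (- l) *\<^sub>R T 1 x) (f + exp (- l) *\<^sub>R T 1 y) = exp (- l) * norm (T 1 (x - y))"
        by (simp add: dist_norm T_diff scaleR_diff_right[symmetric])
      also have "\<dots> \<le> exp (- l) * (M * norm (x - y))" by (intro mult_left_mono M) auto
      also have "\<dots> \<le> 1 / 2 * norm (x - y)"
        using mult_right_mono[OF c, of "norm (x - y)"] by (simp add: mult.assoc)
      finally show ?thesis by (simp add: dist_norm)
    qed
    then obtain x where x: "f + exp (- l) *\<^sub>R T 1 x = x"
      using banach_fix_type[of "1 / 2" "\<lambda>x. f + exp (- l) *\<^sub>R T 1 x"] by auto
    obtain w where w: "((\<lambda>h. (T h w - w) /\<^sub>R h) \<longlongrightarrow> l *\<^sub>R w - (x - exp (- l) *\<^sub>R T 1 x)) (at_right 0)"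
      by (rule truncated_resolvent)
    have "x - exp (- l) *\<^sub>R T 1 x = f" using x by (simp add: algebra_simps)
    then show "\<exists>x\<in>D. l *\<^sub>R x - A x = f" 
      using generates_domainI[OF gen w] by (intro bexI[of _ w]) auto
  qed
qed

section \<open>Dissipative operators in real Hilbert spaces\<close>

text \<open>The solution is the exponential series of \<open>t B\<close> applied to
  \<open>x0\<close>, differentiated term by term on a compact interval around
  \<open>t\<close>.\<close>

lemma bounded_linear_ode:
  fixes B :: "'a::banach \<Rightarrow> 'a"
  assumes "bounded_linear B"
  obtains x where "x 0 = x0" "\<And>t. (x has_vector_derivative B (x t)) (at t)"
proof -
  interpret B: bounded_linear B by fact
  obtain K where K: "K > 0" "\<And>x. norm (B x) \<le> norm x * K"
    using B.pos_bounded by blast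
  define c where "c n t = (t ^ n / fact n) *\<^sub>R (B ^^ n) x0" for n and t :: real
  \<comment> \<open>The derivative of a term is \<open>B\<close> applied to the preceding term. The
    first \<open>Suc n\<close> derivatives therefore sum to \<open>B\<close> of the first
    \<open>n\<close> terms, which explains the index shift in the convergence proof.\<close>
  define c' where "c' n t = (case n of 0 \<Rightarrow> 0 | Suc m \<Rightarrow> B (c m t))" for n and t :: real
  have Bn: "norm ((B ^^ n) x0) \<le> K ^ n * norm x0" for n
  proof (induction n)
    case (Suc n)
    have "norm (B ((B ^^ n) x0)) \<le> norm ((B ^^ n) x0) * K" by (rule K)
    also have "\<dots> \<le> (K ^ n * norm x0) * K" using Suc K by (intro mult_right_mono) auto
    finally show ?case by (simp add: mult_ac)
  qed simp
  have cb: "norm (c n t) \<le> norm x0 * ((r * K) ^ n /\<^sub>R fact n)" if "\<bar>t\<bar> \<le> r" for n t r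
  proof -
    have "norm (c n t) \<le> (r ^ n / fact n) * (K ^ n * norm x0)"
      unfolding c_def norm_scaleR using that Bn
      by (intro mult_mono) (auto simp: power_abs divide_right_mono power_mono)
    then show ?thesis by (simp add: power_mult_distrib field_simps)
  qed
  have summ: "summable (\<lambda>n. norm x0 * ((r * K) ^ n /\<^sub>R fact n))" for r :: real
    by (intro summable_mult summable_exp_generic)
  define x where "x t = (\<Sum>n. c n t)" for t
  have c_sums: "(\<lambda>n. c n t) sums x t" for t
    unfolding x_def by (intro summable_sums summable_comparison_test'[OF summ cb[of t "\<bar>t\<bar>"]]) auto
  have deriv: "(x has_derivative (\<lambda>h. h *\<^sub>R B (x t))) (at t)" for t
  proof -
    define S where "S = {- (\<bar>t\<bar> + 1) .. \<bar>t\<bar> + 1}"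
    have tS: "t \<in> interior S" by (auto simp: S_def interior_atLeastAtMost_real)
    then have tS': "t \<in> S" using interior_subset by blast
    have Sb: "\<bar>s\<bar> \<le> \<bar>t\<bar> + 1" if "s \<in> S" for s using that by (auto simp: S_def)
    have ul: "uniform_limit S (\<lambda>n t. \<Sum>i<n. c i t) x sequentially"
      unfolding x_def by (rule Weierstrass_m_test[OF _ summ]) (use cb Sb in blast)
    have "\<exists>g. \<forall>s\<in>S. (\<lambda>n. c n s) sums g s \<and> (g has_derivative (\<lambda>h. h *\<^sub>R B (x s))) (at s within S)"
    proof (rule has_derivative_series[where f' = "\<lambda>n s h. h *\<^sub>R c' n s"])
      show "convex S" by (simp add: S_def)
      show "t \<in> S" "(\<lambda>n. c n t) sums x t" by (fact tS' c_sums)+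
      fix n s
      have d: "((\<lambda>t. t ^ n / fact n) has_vector_derivative real n * s ^ (n - 1) / fact n) (at s within S)"
        unfolding has_real_derivative_iff_has_vector_derivative[symmetric]
        by (auto intro!: derivative_eq_intros)
      have "(real n * s ^ (n - 1) / fact n) *\<^sub>R (B ^^ n) x0 = c' n s"
      proof (cases n)
        case (Suc m)
        have "real (Suc m) * s ^ m / fact (Suc m) = s ^ m / fact m"
          by (simp add: fact_Suc del: of_nat_Suc)
        then show ?thesis by (simp add: Suc c'_def c_def B.scaleR del: of_nat_Suc fact_Suc)
      qed (simp add: c'_def)
      with bounded_linear.has_vector_derivative[OF bounded_linear_scaleR_left[of "(B ^^ n) x0"] d]
      have "((\<lambda>t. (t ^ n / fact n) *\<^sub>R (B ^^ n) x0) has_vector_derivative c' n s) (at s within S)"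
        by (simp only:)
      then show "(c n has_derivative (\<lambda>h. h *\<^sub>R c' n s)) (at s within S)"
        unfolding has_vector_derivative_def c_def .
    next
      fix e :: real assume e: "e > 0"
      have "\<forall>\<^sub>F n in sequentially. \<forall>s\<in>S. dist (\<Sum>i<n. c i s) (x s) < e / K"
        using uniform_limitD[OF ul, of "e / K"] e K by simp
      then have "\<forall>\<^sub>F n in sequentially. \<forall>s\<in>S. \<forall>h. norm ((\<Sum>i<Suc n. h *\<^sub>R c' i s) - h *\<^sub>R B (x s)) \<le> e * norm h"
      proof (eventually_elim, intro ballI allI)
        fix n s h assume n: "\<forall>s\<in>S. dist (\<Sum>i<n. c i s) (x s) < e / K" and s: "s \<in> S"
        have "(\<Sum>i<Suc n. h *\<^sub>R c' i s) - h *\<^sub>R B (x s) = h *\<^sub>R B ((\<Sum>i<n. c i s) - x s)"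
          unfolding sum.lessThan_Suc_shift
          by (simp add: c'_def B.diff B.sum scaleR_sum_right scaleR_diff_right)
        also have "norm \<dots> \<le> \<bar>h\<bar> * (norm ((\<Sum>i<n. c i s) - x s) * K)"
          using K by (simp add: mult_left_mono)
        also have "\<dots> \<le> \<bar>h\<bar> * e"
          using n s K by (intro mult_left_mono) (auto simp: dist_norm field_simps less_imp_le)
        finally show "norm ((\<Sum>i<Suc n. h *\<^sub>R c' i s) - h *\<^sub>R B (x s)) \<le> e * norm h"
          by (simp add: mult.commute)
      qed
      then show "\<forall>\<^sub>F n in sequentially. \<forall>s\<in>S. \<forall>h. norm ((\<Sum>i<n. h *\<^sub>R c' i s) - h *\<^sub>R B (x s)) \<le> e * norm h"
        by (subst (asm) eventually_sequentially_Suc)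
    qed
    then obtain g where g: "\<And>s. s \<in> S \<Longrightarrow> (\<lambda>n. c n s) sums g s"
      and g': "\<And>s. s \<in> S \<Longrightarrow> (g has_derivative (\<lambda>h. h *\<^sub>R B (x s))) (at s within S)" by blast
    have "g s = x s" if "s \<in> S" for s using sums_unique2[OF g[OF that] c_sums] .
    then have "(x has_derivative (\<lambda>h. h *\<^sub>R B (x t))) (at t within S)"
      by (intro has_derivative_transform[OF tS' _ g'[OF tS']]) auto
    then show ?thesis by (simp add: at_within_interior[OF tS])
  qed
  moreover have "x 0 = x0"
  proof -
    have "c n 0 = (if n = 0 then x0 else 0)" for n by (simp add: c_def)
    then show ?thesis using c_sums[of 0] sums_If_finite_set[of "{0}" "\<lambda>n. x0"]
      by (simp add: sums_unique2)
  qed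
  ultimately show thesis using that by (simp add: has_vector_derivative_def)
qed

text \<open>The range condition is required for all large \<open>l\<close>, not for a single one,
  because the Yosida approximations send \<open>l\<close> to infinity.\<close>

locale m_dissipative =
  fixes D :: "'a::{real_inner,banach} set" and L :: "'a \<Rightarrow> 'a" and l0 :: real
  assumes sub: "subspace D"
    and L_add: "\<And>x y. x \<in> D \<Longrightarrow> y \<in> D \<Longrightarrow> L (x + y) = L x + L y"
    and L_scaleR: "\<And>r x. x \<in> D \<Longrightarrow> L (r *\<^sub>R x) = r *\<^sub>R L x"
    and diss: "\<And>x. x \<in> D \<Longrightarrow> inner (L x) x \<le> 0"
    and l0: "l0 > 0"
    and surj: "\<And>l f. l \<ge> l0 \<Longrightarrow> \<exists>x\<in>D. l *\<^sub>R x - L x = f"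
begin

lemma L_diff: "x \<in> D \<Longrightarrow> y \<in> D \<Longrightarrow> L (x - y) = L x - L y"
  using L_add[of x "(-1) *\<^sub>R y"] L_scaleR[of y "-1"] subspace_neg[OF sub, of y] by simp

lemma resolvent_estimate:
  assumes "x \<in> D" "l > 0"
  shows "l * norm x \<le> norm (l *\<^sub>R x - L x)"
proof (cases "x = 0")
  case False
  have "l * norm x * norm x \<le> inner (l *\<^sub>R x - L x) x"
    using diss[OF assms(1)] by (simp add: inner_diff_left power2_norm_eq_inner[symmetric] power2_eq_square mult.assoc)
  also have "\<dots> \<le> norm (l *\<^sub>R x - L x) * norm x" by (rule norm_cauchy_schwarz)
  finally show ?thesis using False by simp
qed simp

definition Res :: "real \<Rightarrow> 'a \<Rightarrow> 'a"
  where "Res l f = (THE x. x \<in> D \<and> l *\<^sub>R x - L x = f)"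

lemma resolvent_unique:
  assumes "x \<in> D" "y \<in> D" "l > 0" "l *\<^sub>R x - L x = l *\<^sub>R y - L y" shows "x = y"
proof -
  have "l *\<^sub>R (x - y) - L (x - y) = 0" using assms by (simp add: L_diff algebra_simps)
  then have "l * norm (x - y) \<le> 0"
    using resolvent_estimate[of "x - y" l] assms subspace_diff[OF sub] by simp
  then show ?thesis using assms(3) by (simp add: mult_le_0_iff)
qed

lemma Res_eqI:
  assumes "l \<ge> l0" "x \<in> D" "l *\<^sub>R x - L x = f" shows "Res l f = x"
  unfolding Res_def
proof (rule the_equality)
  show "x \<in> D \<and> l *\<^sub>R x - L x = f" using assms by blast
  fix y assume y: "y \<in> D \<and> l *\<^sub>R y - L y = f"
  show "y = x" by (rule resolvent_unique[of _ _ l]) (use assms y l0 in simp_all)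
qed

lemma Res: assumes "l \<ge> l0" shows Res_in: "Res l f \<in> D" and Res_eq: "l *\<^sub>R Res l f - L (Res l f) = f"
proof -
  obtain x where x: "x \<in> D" "l *\<^sub>R x - L x = f" using surj[OF assms, of f] by blast
  with Res_eqI[OF assms x] show "Res l f \<in> D" "l *\<^sub>R Res l f - L (Res l f) = f" by simp_all
qed

lemma L_Res: assumes "l \<ge> l0" shows "L (Res l f) = l *\<^sub>R Res l f - f"
proof -
  have "L (Res l f) = l *\<^sub>R Res l f - (l *\<^sub>R Res l f - L (Res l f))" by simp
  then show ?thesis by (simp only: Res_eq[OF assms])
qed

lemma norm_Res: assumes "l \<ge> l0" shows "norm (Res l f) \<le> norm f / l"
proof -
  have "l * norm (Res l f) \<le> norm f"
    using resolvent_estimate[OF Res_in[OF assms, of f], of l] assms l0 by (simp only: Res_eq)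
  then show ?thesis using assms l0 by (simp add: field_simps)
qed

lemma bounded_linear_Res: assumes l: "l \<ge> l0" shows "bounded_linear (Res l)"
proof (rule bounded_linear_intro[where K = "1 / l"])
  show "Res l (x + y) = Res l x + Res l y" for x y
    by (rule Res_eqI[OF l])
      (auto simp: l L_add L_Res Res_in scaleR_add_right intro!: subspace_add[OF sub] Res_in)
  show "Res l (r *\<^sub>R x) = r *\<^sub>R Res l x" for r x
    by (rule Res_eqI[OF l])
      (auto simp: l L_scaleR L_Res Res_in scaleR_diff_right mult.commute intro!: subspace_scale[OF sub] Res_in)
  show "norm (Res l x) \<le> norm x * (1 / l)" for x using norm_Res[OF l, of x] by simp
qed

text \<open>If \<open>y\<close> is orthogonal to \<open>D\<close>, solve
  \<open>l0 *\<^sub>R x - L x = y\<close> and test with \<open>x\<close>: dissipativity forces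
  \<open>x\<close>, hence \<open>y\<close>, to vanish.\<close>

lemma domain_dense: "closure D = UNIV"
proof (rule dense_if_orthogonal_trivial[OF sub])
  fix y assume y: "\<And>x. x \<in> D \<Longrightarrow> inner y x = 0"
  obtain x where x: "x \<in> D" "l0 *\<^sub>R x - L x = y" using surj[of l0 y] by auto
  have "0 = l0 * inner x x - inner (L x) x" using y[OF x(1)] x(2)[symmetric] by (simp add: inner_diff_left)
  then have "l0 * inner x x \<le> 0" using diss[OF x(1)] by linarith
  then have "inner x x \<le> 0" using l0 by (auto simp: mult_le_0_iff)
  then have "inner x x = 0" using inner_ge_zero[of x] by linarith
  then have "x = 0" by simp
  then show "y = 0" using x(2) L_scaleR[of x 0] x(1) by simp
qed

text \<open>The resolvent maps \<open>D\<close> into the domain of the square of \<open>L\<close>.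
  Approximating \<open>l0 *\<^sub>R x - L x\<close> from \<open>D\<close> and applying the
  continuous resolvent approximates \<open>x\<close>.\<close>

lemma domain2_dense: "closure {x\<in>D. L x \<in> D} = UNIV"
proof -
  have "x \<in> closure {x\<in>D. L x \<in> D}" if x: "x \<in> D" for x
  proof -
    interpret R: bounded_linear "Res l0" by (rule bounded_linear_Res) simp
    obtain f where f: "\<And>n. f n \<in> D" "f \<longlonglongrightarrow> l0 *\<^sub>R x - L x"
      using domain_dense by (metis UNIV_I closure_sequential)
    have "(\<lambda>n. Res l0 (f n)) \<longlonglongrightarrow> Res l0 (l0 *\<^sub>R x - L x)" by (rule R.tendsto[OF f(2)])
    moreover have "Res l0 (l0 *\<^sub>R x - L x) = x" by (rule Res_eqI) (use x in auto)
    moreover have "Res l0 (f n) \<in> {x\<in>D. L x \<in> D}" for n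
      using f(1) Res_in[of l0] by (auto simp: L_Res intro!: subspace_diff[OF sub] subspace_scale[OF sub])
    ultimately show ?thesis
      unfolding closure_sequential by (intro exI[of _ "\<lambda>n. Res l0 (f n)"]) simp
  qed
  then have "closure D \<subseteq> closure {x\<in>D. L x \<in> D}"
    by (intro closure_minimal) auto
  then show ?thesis using domain_dense by auto
qed

text \<open>The Yosida approximation, that is \<open>L\<close> applied to
  \<open>l *\<^sub>R Res l x\<close>, rewritten without \<open>L\<close> so that boundedness is
  evident.\<close>

definition Yos :: "real \<Rightarrow> 'a \<Rightarrow> 'a"
  where "Yos l x = l *\<^sub>R (l *\<^sub>R Res l x - x)"

lemma bounded_linear_Yos: "l \<ge> l0 \<Longrightarrow> bounded_linear (Yos l)"
  unfolding Yos_def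
  by (intro bounded_linear_const_scaleR bounded_linear_sub bounded_linear_Res bounded_linear_ident)

lemma Yos_eq_L: "l \<ge> l0 \<Longrightarrow> Yos l x = L (l *\<^sub>R Res l x)"
  by (simp add: Yos_def L_scaleR Res_in L_Res)

lemma Yos_split: "l \<ge> l0 \<Longrightarrow> l *\<^sub>R Res l x = x + Yos l x /\<^sub>R l"
  using l0 by (simp add: Yos_def)

lemma JRes_in: "l \<ge> l0 \<Longrightarrow> l *\<^sub>R Res l x \<in> D"
  by (intro subspace_scale[OF sub] Res_in)

text \<open>Replacing \<open>x\<close> by \<open>l *\<^sub>R Res l x\<close> reduces the claim to
  dissipativity of \<open>L\<close>; the correction contributes minus the square of the norm of
  \<open>Yos l x\<close> divided by \<open>l\<close>.\<close>

lemma Yos_diss: assumes l: "l \<ge> l0" shows "inner (Yos l x) x \<le> 0"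
proof -
  have "inner (Yos l x) x = inner (Yos l x) (l *\<^sub>R Res l x - Yos l x /\<^sub>R l)"
    using Yos_split[OF l, of x] by simp
  also have "\<dots> = inner (L (l *\<^sub>R Res l x)) (l *\<^sub>R Res l x) - (norm (Yos l x))\<^sup>2 / l"
    by (simp add: inner_diff_right power2_norm_eq_inner Yos_eq_L[OF l] divide_inverse mult.commute)
  also have "\<dots> \<le> 0 - 0"
    using l l0 by (intro diff_mono diss JRes_in) auto
  finally show ?thesis by simp
qed

lemma Yos_domain: assumes "l \<ge> l0" "x \<in> D" shows "Yos l x = l *\<^sub>R Res l (L x)"
proof -
  have "Res l (L x) = l *\<^sub>R Res l x - x"
    by (rule Res_eqI) (use assms in \<open>auto simp: L_diff L_scaleR Res_in L_Res JRes_in algebra_simps intro!: subspace_diff[OF sub]\<close>)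
  then show ?thesis by (simp add: Yos_def)
qed

lemma norm_Yos: assumes "l \<ge> l0" "x \<in> D" shows "norm (Yos l x) \<le> norm (L x)"
  using norm_Res[OF assms(1), of "L x"] assms l0 by (simp add: Yos_domain field_simps)

section \<open>Orbits of the Yosida approximations and their limit\<close>

definition sol :: "real \<Rightarrow> 'a \<Rightarrow> real \<Rightarrow> 'a"
  where "sol l x0 = (SOME x. x 0 = x0 \<and> (\<forall>t. (x has_vector_derivative Yos l (x t)) (at t)))"

lemma sol:
  assumes "l \<ge> l0"
  shows sol_0: "sol l x0 0 = x0"
    and sol_deriv: "(sol l x0 has_vector_derivative Yos l (sol l x0 t)) (at t within S)"
proof -
  obtain x where "x 0 = x0" "\<And>t. (x has_vector_derivative Yos l (x t)) (at t)"
    using bounded_linear_ode[OF bounded_linear_Yos[OF assms]] by blast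
  then have "\<exists>x. x 0 = x0 \<and> (\<forall>t. (x has_vector_derivative Yos l (x t)) (at t))" by blast
  from someI_ex[OF this]
  have *: "sol l x0 0 = x0" "\<And>t. (sol l x0 has_vector_derivative Yos l (sol l x0 t)) (at t)"
    by (simp_all add: sol_def)
  show "sol l x0 0 = x0" by (rule *)
  show "(sol l x0 has_vector_derivative Yos l (sol l x0 t)) (at t within S)"
    using *(2) by (rule has_vector_derivative_at_within)
qed

lemma norm_Yos_solution:
  assumes "l \<ge> l0" "0 \<le> t" "\<And>s. (x has_vector_derivative Yos l (x s)) (at s)"
  shows "norm (x t) \<le> norm (x 0)"
proof -
  have "(norm (x t))\<^sup>2 \<le> (norm (x 0))\<^sup>2 + 0 * t"
    using assms Yos_diss[OF assms(1)]
    by (intro norm_square_growth) (auto intro: has_vector_derivative_at_within)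
  then show ?thesis by simp
qed

lemma Yos_sol_deriv:
  "l \<ge> l0 \<Longrightarrow> ((\<lambda>t. Yos l (sol l x0 t)) has_vector_derivative Yos l (Yos l (sol l x0 t))) (at t)"
  by (rule bounded_linear.has_vector_derivative[OF bounded_linear_Yos sol_deriv])

text \<open>The velocity solves the same contractive linear equation as the orbit, so its initial
  bound by \<open>L x0\<close> persists, uniformly in \<open>l\<close>.\<close>

lemma norm_Yos_sol: assumes "l \<ge> l0" "x0 \<in> D" "0 \<le> t" shows "norm (Yos l (sol l x0 t)) \<le> norm (L x0)"
  using norm_Yos_solution[OF assms(1,3) Yos_sol_deriv[OF assms(1), of x0]] norm_Yos[OF assms(1,2)]
  by (simp add: sol_0 assms(1))

text \<open>Differentiating the squared distance of two approximate orbits, everything except terms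
  of order \<open>1 / l\<close> and \<open>1 / m\<close> is dissipative.\<close>

lemma sol_cauchy:
  assumes l: "l \<ge> l0" and m: "m \<ge> l0" and x0: "x0 \<in> D" and t: "0 \<le> t"
  shows "(norm (sol l x0 t - sol m x0 t))\<^sup>2 \<le> 4 * (norm (L x0))\<^sup>2 * (1 / l + 1 / m) * t"
proof -
  define C where "C = norm (L x0)"
  have "(norm (sol l x0 t - sol m x0 t))\<^sup>2 \<le> (norm (sol l x0 0 - sol m x0 0))\<^sup>2 + 4 * C\<^sup>2 * (1 / l + 1 / m) * t"
  proof (rule norm_square_growth[OF t, where x = "\<lambda>t. sol l x0 t - sol m x0 t"])
    fix s assume s: "s \<in> {0..t}"
    let ?x = "sol l x0 s" and ?y = "sol m x0 s"
    define a b where "a = Yos l ?x" and "b = Yos m ?y"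
    define p q where "p = l *\<^sub>R Res l ?x" and "q = m *\<^sub>R Res m ?y"
    show "((\<lambda>t. sol l x0 t - sol m x0 t) has_vector_derivative a - b) (at s within {0..t})"
      unfolding a_def b_def by (intro has_vector_derivative_diff sol_deriv l m)
    have ab: "norm a \<le> C" "norm b \<le> C"
      using norm_Yos_sol l m x0 s by (auto simp: a_def b_def C_def)
    \<comment> \<open>Dissipativity applies to the smoothed points \<open>p\<close> and
      \<open>q\<close>, which lie in \<open>D\<close>. They differ from the orbits by velocities
      divided by \<open>l\<close> and \<open>m\<close>, and the velocities are bounded by
      \<open>C\<close>.\<close>
    have xy: "?x - ?y = (p - q) - (a /\<^sub>R l - b /\<^sub>R m)"
      using Yos_split[OF l, of ?x] Yos_split[OF m, of ?y] by (simp add: a_def b_def p_def q_def)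
    have "inner (a - b) (p - q) \<le> 0"
      using diss[of "p - q"] JRes_in[OF l] JRes_in[OF m] Yos_eq_L[OF l] Yos_eq_L[OF m]
      by (simp add: p_def q_def a_def b_def L_diff subspace_diff[OF sub])
    then have "inner (a - b) (?x - ?y) \<le> - inner (a - b) (a /\<^sub>R l - b /\<^sub>R m)"
      unfolding xy by (simp add: inner_diff_right)
    also have "\<dots> \<le> norm (a - b) * norm (a /\<^sub>R l - b /\<^sub>R m)"
      using Cauchy_Schwarz_ineq2[of "a - b" "a /\<^sub>R l - b /\<^sub>R m"] by linarith
    also have "\<dots> \<le> (C + C) * (C / l + C / m)"
    proof (rule mult_mono)
      show "norm (a - b) \<le> C + C" using ab norm_triangle_ineq4[of a b] by linarith
      have "norm (a /\<^sub>R l) \<le> C / l" "norm (b /\<^sub>R m) \<le> C / m"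
        using ab l m l0 by (simp_all add: field_simps)
      then show "norm (a /\<^sub>R l - b /\<^sub>R m) \<le> C / l + C / m"
        using norm_triangle_ineq4[of "a /\<^sub>R l" "b /\<^sub>R m"] by linarith
    qed (auto simp: C_def)
    also have "\<dots> = 2 * C\<^sup>2 * (1 / l + 1 / m)"
      by (simp add: power2_eq_square distrib_left divide_inverse)
    finally show "2 * inner (a - b) (?x - ?y) \<le> 4 * C\<^sup>2 * (1 / l + 1 / m)" by simp
  qed
  then show ?thesis by (simp add: sol_0 l m C_def)
qed

abbreviation "lam n \<equiv> l0 + real n"

lemma inverse_ln_tendsto: "(\<lambda>n. c * (1 / lam n)) \<longlonglongrightarrow> 0"
  by (intro tendsto_mult_right_zero tendsto_divide_0[OF tendsto_const] filterlim_at_top_imp_at_infinity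
      filterlim_tendsto_add_at_top[OF tendsto_const filterlim_real_sequentially])

text \<open>Letting \<open>m\<close> tend to infinity in the Cauchy estimate keeps an explicit rate
  in \<open>n\<close>, linear in \<open>t\<close>, from which uniform convergence on bounded
  intervals follows.\<close>

lemma sol_limit:
  assumes x0: "x0 \<in> D"
  obtains x where "\<And>n t. 0 \<le> t \<Longrightarrow> (norm (sol (lam n) x0 t - x t))\<^sup>2 \<le> 4 * (norm (L x0))\<^sup>2 * (1 / lam n) * t"
proof -
  have "\<exists>y. \<forall>n. (norm (sol (lam n) x0 t - y))\<^sup>2 \<le> 4 * (norm (L x0))\<^sup>2 * (1 / lam n) * t" if t: "0 \<le> t" for t
  proof -
    let ?s = "\<lambda>n. sol (lam n) x0 t"
    let ?c = "4 * (norm (L x0))\<^sup>2"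
    have est: "(norm (?s n - ?s m))\<^sup>2 \<le> ?c * (1 / lam n + 1 / lam m) * t" for n m
      by (rule sol_cauchy) (use x0 t in auto)
    have "Cauchy ?s"
    proof (rule metric_CauchyI)
      fix e :: real assume e: "e > 0"
      have "\<forall>\<^sub>F n in sequentially. (?c * t) * (1 / lam n) < e\<^sup>2 / 2"
        using e by (intro order_tendstoD(2)[OF inverse_ln_tendsto]) auto
      then obtain N where N: "\<And>n. n \<ge> N \<Longrightarrow> (?c * t) * (1 / lam n) < e\<^sup>2 / 2"
        by (auto simp: eventually_sequentially)
      have "dist (?s m) (?s n) < e" if "m \<ge> N" "n \<ge> N" for m n
      proof -
        have "?c * (1 / lam m + 1 / lam n) * t = (?c * t) * (1 / lam m) + (?c * t) * (1 / lam n)"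
          by (simp only: distrib_left distrib_right mult_ac)
        then have "(norm (?s m - ?s n))\<^sup>2 < e\<^sup>2"
          using est[of m n] N[OF that(1)] N[OF that(2)] by linarith
        then show ?thesis using e by (simp add: dist_norm power2_less_imp_less)
      qed
      then show "\<exists>M. \<forall>m\<ge>M. \<forall>n\<ge>M. dist (?s m) (?s n) < e" by blast
    qed
    then obtain y where y: "?s \<longlonglongrightarrow> y" using Cauchy_convergent_iff convergent_def by blast
    have "(norm (?s n - y))\<^sup>2 \<le> ?c * (1 / lam n) * t" for n
    proof (rule LIMSEQ_le)
      show "(\<lambda>m. (norm (?s n - ?s m))\<^sup>2) \<longlonglongrightarrow> (norm (?s n - y))\<^sup>2"
        by (intro tendsto_intros y)
      have "(\<lambda>m. ?c * (1 / lam n + 1 * (1 / lam m)) * t) \<longlonglongrightarrow> ?c * (1 / lam n + 0) * t"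
        by (intro tendsto_intros inverse_ln_tendsto)
      then show "(\<lambda>m. ?c * (1 / lam n + 1 / lam m) * t) \<longlonglongrightarrow> ?c * (1 / lam n) * t" by simp
      show "\<exists>N. \<forall>m\<ge>N. (norm (?s n - ?s m))\<^sup>2 \<le> ?c * (1 / lam n + 1 / lam m) * t"
        using est by blast
    qed
    then show ?thesis by blast
  qed
  then show thesis using that by metis
qed

lemma square_bound_uniform_limit:
  fixes f :: "nat \<Rightarrow> real \<Rightarrow> 'b::real_normed_vector"
  assumes "\<And>n t. 0 \<le> t \<Longrightarrow> (norm (f n t - g t))\<^sup>2 \<le> c * (1 / lam n) * t" and c: "0 \<le> c"
  shows "uniform_limit {0..\<tau>} f g sequentially"
proof (rule uniform_limitI)
  fix e :: real assume e: "e > 0"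
  have "\<forall>\<^sub>F n in sequentially. (c * \<bar>\<tau>\<bar>) * (1 / lam n) < e\<^sup>2"
    using e by (intro order_tendstoD(2)[OF inverse_ln_tendsto]) auto
  then show "\<forall>\<^sub>F n in sequentially. \<forall>t\<in>{0..\<tau>}. dist (f n t) (g t) < e"
  proof (eventually_elim, intro ballI)
    fix n t assume n: "(c * \<bar>\<tau>\<bar>) * (1 / lam n) < e\<^sup>2" and t: "t \<in> {0..\<tau>}"
    have "(norm (f n t - g t))\<^sup>2 \<le> c * (1 / lam n) * t" using assms t by auto
    also have "\<dots> \<le> c * (1 / lam n) * \<bar>\<tau>\<bar>" using t c l0 by (intro mult_left_mono) auto
    finally have "(norm (f n t - g t))\<^sup>2 < e\<^sup>2" using n by (simp add: mult_ac)
    then show "dist (f n t) (g t) < e" using e by (simp add: dist_norm power2_less_imp_less)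
  qed
qed

text \<open>\<open>L\<close> is closed because \<open>l0 - L\<close> has a bounded everywhere
  defined inverse.\<close>

lemma closed_graph:
  assumes "\<And>n. p n \<in> D" "p \<longlonglongrightarrow> x" "(\<lambda>n. L (p n)) \<longlonglongrightarrow> z"
  shows "x \<in> D" "L x = z"
proof -
  interpret R: bounded_linear "Res l0" by (rule bounded_linear_Res) simp
  have "(\<lambda>n. Res l0 (l0 *\<^sub>R p n - L (p n))) \<longlonglongrightarrow> Res l0 (l0 *\<^sub>R x - z)"
    by (intro R.tendsto tendsto_intros assms)
  moreover have "Res l0 (l0 *\<^sub>R p n - L (p n)) = p n" for n by (rule Res_eqI) (use assms in auto)
  ultimately have x: "Res l0 (l0 *\<^sub>R x - z) = x" using LIMSEQ_unique assms(2) by simp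
  then show "x \<in> D" using Res_in[of l0 "l0 *\<^sub>R x - z"] by simp
  have "L x = l0 *\<^sub>R x - (l0 *\<^sub>R x - z)" using L_Res[of l0 "l0 *\<^sub>R x - z"] by (simp only: x)
  then show "L x = z" by simp
qed

text \<open>The condition \<open>L x0 \<in> D\<close> makes the velocities converge uniformly as
  well, since they are asymptotic to the approximate orbits started at \<open>L x0\<close>. Uniform
  limits of orbits and velocities then give a continuously differentiable limit, and closedness of
  \<open>L\<close> identifies the derivative.\<close>

theorem classical_orbit:
  assumes x0: "x0 \<in> D" "L x0 \<in> D"
  obtains x where "x 0 = x0" "\<And>t. 0 \<le> t \<Longrightarrow> x t \<in> D"
    "\<And>t. 0 \<le> t \<Longrightarrow> (x has_vector_derivative L (x t)) (at t within {0..})"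
    "continuous_on {0..} (\<lambda>t. L (x t))"
proof -
  obtain x where x: "\<And>n t. 0 \<le> t \<Longrightarrow> (norm (sol (lam n) x0 t - x t))\<^sup>2 \<le> 4 * (norm (L x0))\<^sup>2 * (1 / lam n) * t"
    using sol_limit[OF x0(1)] by blast
  obtain w where w: "\<And>n t. 0 \<le> t \<Longrightarrow> (norm (sol (lam n) (L x0) t - w t))\<^sup>2 \<le> 4 * (norm (L (L x0)))\<^sup>2 * (1 / lam n) * t"
    using sol_limit[OF x0(2)] by blast
  let ?x = "\<lambda>n. sol (lam n) x0" and ?w = "\<lambda>n. sol (lam n) (L x0)"
  let ?z = "\<lambda>n t. Yos (lam n) (?x n t)"
  have xu: "uniform_limit {0..\<tau>} ?x x sequentially" for \<tau> using square_bound_uniform_limit[OF x] by simp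
  have wu: "uniform_limit {0..\<tau>} ?w w sequentially" for \<tau> using square_bound_uniform_limit[OF w] by simp
  \<comment> \<open>Both families solve the same contractive equation, and their initial values
    differ by \<open>Yos (lam n) (L x0)\<close> divided by \<open>lam n\<close>.\<close>
  have zw: "norm (?z n t - ?w n t) \<le> norm (L (L x0)) * (1 / lam n)" if t: "0 \<le> t" for n t
  proof -
    have lam: "lam n \<ge> l0" by simp
    interpret Y: bounded_linear "Yos (lam n)" by (rule bounded_linear_Yos[OF lam])
    have "norm (?z n t - ?w n t) \<le> norm (?z n 0 - ?w n 0)"
      by (rule norm_Yos_solution[OF lam t, where x = "\<lambda>t. ?z n t - ?w n t"])
        (simp only: Y.diff, intro has_vector_derivative_diff Yos_sol_deriv sol_deriv lam)
    also have "?z n 0 - ?w n 0 = Yos (lam n) (L x0) /\<^sub>R lam n"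
      using Yos_split[OF lam, of "L x0"] by (simp add: sol_0 Yos_domain[OF lam x0(1)])
    also have "norm \<dots> \<le> norm (L (L x0)) * (1 / lam n)"
      using norm_Yos[OF lam x0(2)] l0 by (simp add: divide_inverse mult.commute mult_right_mono)
    finally show ?thesis .
  qed
  have zu: "uniform_limit {0..\<tau>} ?z w sequentially" for \<tau>
  proof (rule uniform_limitI)
    fix e :: real assume e: "e > 0"
    have "\<forall>\<^sub>F n in sequentially. norm (L (L x0)) * (1 / lam n) < e / 2"
      using e by (intro order_tendstoD(2)[OF inverse_ln_tendsto]) auto
    moreover have "\<forall>\<^sub>F n in sequentially. \<forall>t\<in>{0..\<tau>}. dist (?w n t) (w t) < e / 2"
      by (rule uniform_limitD[OF wu]) (use e in simp)
    ultimately show "\<forall>\<^sub>F n in sequentially. \<forall>t\<in>{0..\<tau>}. dist (?z n t) (w t) < e"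
    proof (eventually_elim, intro ballI)
      fix n t assume 1: "norm (L (L x0)) * (1 / lam n) < e / 2" "\<forall>t\<in>{0..\<tau>}. dist (?w n t) (w t) < e / 2"
        and t: "t \<in> {0..\<tau>}"
      have "dist (?w n t) (w t) < e / 2" using 1 t by blast
      moreover have "0 \<le> t" using t by simp
      ultimately show "dist (?z n t) (w t) < e"
        using zw[of t n] 1(1) dist_triangle[of "?z n t" "w t" "?w n t"] unfolding dist_norm by linarith
    qed
  qed
  have pt: "(\<lambda>n. ?x n t) \<longlonglongrightarrow> x t" "(\<lambda>n. ?z n t) \<longlonglongrightarrow> w t" if "0 \<le> t" for t
    using tendsto_uniform_limitI[OF xu[of t]] tendsto_uniform_limitI[OF zu[of t]] that by auto
  have Lx: "x t \<in> D \<and> L (x t) = w t" if t: "0 \<le> t" for t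
  proof -
    have "(\<lambda>n. ?x n t + ?z n t /\<^sub>R lam n) \<longlonglongrightarrow> x t + 0 *\<^sub>R w t"
      using inverse_ln_tendsto[of 1] by (intro tendsto_intros pt t) (simp add: inverse_eq_divide)
    then have p: "(\<lambda>n. lam n *\<^sub>R Res (lam n) (?x n t)) \<longlonglongrightarrow> x t" by (simp add: Yos_split)
    have "(\<lambda>n. L (lam n *\<^sub>R Res (lam n) (?x n t))) \<longlonglongrightarrow> w t"
      using pt(2)[OF t] by (simp add: Yos_eq_L)
    from closed_graph[OF _ p this] show ?thesis by (simp add: JRes_in)
  qed
  have xd: "(x has_vector_derivative w t) (at t within {0..})" if t: "0 \<le> t" for t
  proof -
    have "\<exists>g. \<forall>s\<in>{0..t + 1}. (\<lambda>n. ?x n s) \<longlonglongrightarrow> g s \<and> (g has_derivative (\<lambda>h. h *\<^sub>R w s)) (at s within {0..t + 1})"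
    proof (rule has_derivative_sequence[where f' = "\<lambda>n s h. h *\<^sub>R ?z n s"])
      fix e :: real assume e: "e > 0"
      from uniform_limitD[OF zu this, of "t + 1"]
      show "\<forall>\<^sub>F n in sequentially. \<forall>s\<in>{0..t + 1}. \<forall>h. norm (h *\<^sub>R ?z n s - h *\<^sub>R w s) \<le> e * norm h"
      proof (eventually_elim, intro ballI allI)
        fix n s h assume "\<forall>s\<in>{0..t + 1}. dist (?z n s) (w s) < e" "s \<in> {0..t + 1}"
        then have "norm (?z n s - w s) \<le> e" by (auto simp: dist_norm less_imp_le)
        then show "norm (h *\<^sub>R ?z n s - h *\<^sub>R w s) \<le> e * norm h"
          by (simp add: scaleR_diff_right[symmetric] mult.commute[of e] mult_left_mono)
      qed
    next
      show "(?x n has_derivative (\<lambda>h. h *\<^sub>R ?z n s)) (at s within {0..t + 1})" for n s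
        using sol_deriv[of "lam n" x0 s] by (simp add: has_vector_derivative_def)
      show "t \<in> {0..t + 1}" "(\<lambda>n. ?x n t) \<longlonglongrightarrow> x t" using t pt by auto
    qed simp
    then obtain g where g: "\<And>s. s \<in> {0..t + 1} \<Longrightarrow> (\<lambda>n. ?x n s) \<longlonglongrightarrow> g s"
      "\<And>s. s \<in> {0..t + 1} \<Longrightarrow> (g has_derivative (\<lambda>h. h *\<^sub>R w s)) (at s within {0..t + 1})" by blast
    have "g s = x s" if "s \<in> {0..t + 1}" for s
      using LIMSEQ_unique[OF g(1) pt(1)] that by auto
    then have "(x has_vector_derivative w t) (at t within {0..t + 1})"
      unfolding has_vector_derivative_def using t by (intro has_derivative_transform[OF _ _ g(2)]) auto
    then show ?thesis using at_within_halfline[of t "t + 1"] t by simp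
  qed
  have wc: "continuous_on {0..} w"
  proof (rule continuous_on_halfline)
    fix \<tau> :: real assume "\<tau> > 0"
    show "continuous_on {0..\<tau>} w"
    proof (rule uniform_limit_theorem[OF _ wu])
      show "\<forall>\<^sub>F n in sequentially. continuous_on {0..\<tau>} (?w n)"
        by (intro always_eventually allI, rule continuous_on_vector_derivative, rule sol_deriv) simp
    qed simp
  qed
  show thesis
  proof (rule that)
    show "x 0 = x0" using LIMSEQ_unique[OF pt(1)[of 0]] by (simp add: sol_0)
    show "continuous_on {0..} (\<lambda>t. L (x t))"
      using wc by (rule continuous_on_eq) (use Lx in auto)
  qed (use Lx xd in auto)
qed

end

section \<open>Square integrable functions\<close>

definition energy :: "real set \<Rightarrow> (real \<Rightarrow> 'a::real_normed_vector) \<Rightarrow> ennreal"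
  where "energy A f = (\<integral>\<^sup>+t. ennreal ((norm (f t))\<^sup>2) \<partial>lebesgue_on A)"

lemma strongly_measurable_lincomb:
  assumes "strongly_measurable M f" "strongly_measurable M g"
  shows "strongly_measurable M (\<lambda>t. scaleC a (f t) + scaleC b (g t))"
proof -
  obtain p q where p: "\<And>k. simple_function M (p k)" "AE t in M. (\<lambda>k::nat. p k t) \<longlonglongrightarrow> f t"
    and q: "\<And>k. simple_function M (q k)" "AE t in M. (\<lambda>k::nat. q k t) \<longlonglongrightarrow> g t"
    using assms unfolding strongly_measurable_def by blast
  show ?thesis
    unfolding strongly_measurable_def
  proof (intro exI[of _ "\<lambda>k t. scaleC a (p k t) + scaleC b (q k t)"] conjI allI)
    show "simple_function M (\<lambda>t. scaleC a (p k t) + scaleC b (q k t))" for k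
      using p(1) q(1) by (rule simple_function_compose2)
    show "AE t in M. (\<lambda>k. scaleC a (p k t) + scaleC b (q k t)) \<longlonglongrightarrow> scaleC a (f t) + scaleC b (g t)"
      using p(2) q(2)
    proof eventually_elim
      case (elim t)
      then show ?case by (intro tendsto_add bounded_linear.tendsto[OF bounded_linear_scaleC])
    qed
  qed
qed

lemma strongly_measurable_add:
  "strongly_measurable M f \<Longrightarrow> strongly_measurable M g \<Longrightarrow> strongly_measurable M (\<lambda>t. f t + g t)"
  using strongly_measurable_lincomb[of M f g 1 1] by simp

lemma strongly_measurable_diff:
  "strongly_measurable M f \<Longrightarrow> strongly_measurable M g \<Longrightarrow> strongly_measurable M (\<lambda>t. f t - g t)"
  using strongly_measurable_lincomb[of M f g 1 "-1"] by (simp add: scaleC_minus1)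

lemma strongly_measurable_subset:
  assumes f: "strongly_measurable (lebesgue_on B) f" and A: "A \<in> sets lebesgue" "A \<subseteq> B" and B: "B \<in> sets lebesgue"
  shows "strongly_measurable (lebesgue_on A) f"
proof -
  obtain p where p: "\<And>k. simple_function (lebesgue_on B) (p k)" "AE t in lebesgue_on B. (\<lambda>k::nat. p k t) \<longlonglongrightarrow> f t"
    using f unfolding strongly_measurable_def by blast
  have "simple_function (lebesgue_on A) (p k)" for k
    unfolding simple_function_def
  proof (intro conjI ballI)
    have fin: "finite (p k ` B)" using p(1)[of k] by (simp add: simple_function_def)
    show "finite (p k ` space (lebesgue_on A))" using finite_subset[OF image_mono[OF A(2)] fin] by simp
    fix y assume "y \<in> p k ` space (lebesgue_on A)"
    then have "p k -` {y} \<inter> B \<in> sets (lebesgue_on B)"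
      using p(1)[of k] A(2) by (auto simp: simple_function_def)
    then have "p k -` {y} \<inter> B \<in> sets lebesgue" using B by (simp add: sets_restrict_space_iff)
    then have "p k -` {y} \<inter> B \<inter> A \<in> sets lebesgue" using A(1) by (rule sets.Int)
    moreover have "p k -` {y} \<inter> B \<inter> A = p k -` {y} \<inter> A" using A(2) by blast
    ultimately show "p k -` {y} \<inter> space (lebesgue_on A) \<in> sets (lebesgue_on A)"
      using A(1) by (simp add: sets_restrict_space_iff)
  qed
  moreover have "AE t in lebesgue. t \<in> B \<longrightarrow> (\<lambda>k. p k t) \<longlonglongrightarrow> f t"
    using p(2) B by (simp add: AE_restrict_space_iff)
  then have "AE t in lebesgue. t \<in> A \<longrightarrow> (\<lambda>k. p k t) \<longlonglongrightarrow> f t"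
    by eventually_elim (use A(2) in blast)
  then have "AE t in lebesgue_on A. (\<lambda>k. p k t) \<longlonglongrightarrow> f t"
    using A(1) by (simp add: AE_restrict_space_iff)
  ultimately show ?thesis unfolding strongly_measurable_def by blast
qed

text \<open>Norms of the simple approximants are real valued and measurable. Extension by zero moves
  the question to the whole line, where completeness of Lebesgue measure absorbs the null set
  without convergence.\<close>

lemma measurable_norm:
  assumes f: "strongly_measurable (lebesgue_on A) f" and A: "A \<in> sets lebesgue"
  shows "(\<lambda>t. norm (f t)) \<in> borel_measurable (lebesgue_on A)"
proof -
  obtain p where p: "\<And>k. simple_function (lebesgue_on A) (p k)" "AE t in lebesgue_on A. (\<lambda>k::nat. p k t) \<longlonglongrightarrow> f t"
    using f unfolding strongly_measurable_def by blast
  let ?h = "\<lambda>k t. if t \<in> A then norm (p k t) else 0"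
  have "(\<lambda>t. norm (p k t)) \<in> borel_measurable (lebesgue_on A)" for k
    by (rule borel_measurable_simple_function, rule simple_function_compose1, rule p(1))
  then have h: "?h k \<in> borel_measurable lebesgue" for k
    using A by (simp add: borel_measurable_if)
  have "(\<lambda>t. lim (\<lambda>k. ?h k t)) \<in> borel_measurable lebesgue"
    by (rule borel_measurable_lim_metric[OF h])
  moreover have "AE t in lebesgue. lim (\<lambda>k. ?h k t) = (if t \<in> A then norm (f t) else 0)"
  proof -
    have "AE t in lebesgue. t \<in> A \<longrightarrow> (\<lambda>k. p k t) \<longlonglongrightarrow> f t"
      using p(2) A by (simp add: AE_restrict_space_iff)
    then show ?thesis
    proof eventually_elim
      case (elim t)
      then show ?case by (cases "t \<in> A") (auto intro!: limI tendsto_norm)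
    qed
  qed
  ultimately have "(\<lambda>t. if t \<in> A then norm (f t) else 0) \<in> borel_measurable lebesgue"
    by (rule borel_measurable_AE)
  then show ?thesis using A by (simp add: borel_measurable_if)
qed

lemma measurable_norm_square:
  assumes "strongly_measurable (lebesgue_on A) f" "A \<in> sets lebesgue"
  shows "(\<lambda>t. ennreal ((norm (f t))\<^sup>2)) \<in> borel_measurable (lebesgue_on A)"
  by (intro measurable_compose[OF _ measurable_ennreal] borel_measurable_power measurable_norm[OF assms])

lemma measurable_norm_square_indicator:
  assumes "strongly_measurable (lebesgue_on A) f" "A \<in> sets lebesgue"
  shows "(\<lambda>t. ennreal ((norm (f t))\<^sup>2) * indicator A t) \<in> borel_measurable lebesgue"
  by (rule iffD1[OF borel_measurable_restrict_space_iff_ennreal measurable_norm_square])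
    (use assms in auto)

text \<open>Sampling \<open>f\<close> at rounded times takes finitely many values, so the result is
  simple whatever the target space; uniform continuity on \<open>{0..k}\<close> controls the
  error.\<close>

lemma grid_approximation:
  fixes f :: "real \<Rightarrow> 'a::chilbert_space"
  assumes f: "continuous_on {0..} f" and e: "e > 0"
  obtains s where "simple_function (lebesgue_on {0..}) s" "\<And>t. 0 \<le> t \<Longrightarrow> t < k \<Longrightarrow> dist (s t) (f t) < e"
proof -
  have "uniformly_continuous_on {0..k} f"
    by (intro compact_uniformly_continuous continuous_on_subset[OF f]) auto
  then obtain d where d: "d > 0"
    "\<And>x y. x \<in> {0..k} \<Longrightarrow> y \<in> {0..k} \<Longrightarrow> dist y x < d \<Longrightarrow> dist (f y) (f x) < e"
    using e unfolding uniformly_continuous_on_def by metis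
  obtain n :: nat where n: "inverse (real (Suc n)) < d" using reals_Archimedean[OF d(1)] by blast
  define N where "N = real (Suc n)"
  have N: "N > 0" "inverse N < d" using n by (simp_all add: N_def)
  define q where "q t = (if 0 \<le> t \<and> t < k then real_of_int \<lfloor>N * t\<rfloor> / N else 0)" for t
  have "q \<in> borel_measurable borel" unfolding q_def by measurable
  then have "q \<in> borel_measurable (lebesgue_on {0..})"
    by (intro measurable_restrict_space1 measurable_completion) simp
  moreover have "finite (q ` space (lebesgue_on {0..}))"
  proof (rule finite_subset)
    have "0 \<le> \<lfloor>N * t\<rfloor> \<and> \<lfloor>N * t\<rfloor> \<le> \<lceil>N * k\<rceil>" if "0 \<le> t" "t < k" for t
    proof -
      have "N * t \<le> N * k" using that N by simp
      then have "\<lfloor>N * t\<rfloor> \<le> \<lceil>N * k\<rceil>" by linarith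
      then show ?thesis using that N by simp
    qed
    then show "q ` space (lebesgue_on {0..}) \<subseteq> insert 0 ((\<lambda>i. real_of_int i / N) ` {0..\<lceil>N * k\<rceil>})"
      by (auto simp: q_def)
  qed auto
  ultimately have "simple_function (lebesgue_on {0..}) q" by (rule simple_function_borel_measurable)
  then have "simple_function (lebesgue_on {0..}) (\<lambda>t. f (q t))" by (rule simple_function_compose1)
  moreover have "dist (f (q t)) (f t) < e" if t: "0 \<le> t" "t < k" for t
  proof (rule d(2))
    have q: "q t = real_of_int \<lfloor>N * t\<rfloor> / N" using t by (simp add: q_def)
    have "0 \<le> real_of_int \<lfloor>N * t\<rfloor>" using t N by simp
    then have q0: "0 \<le> q t" using N unfolding q by simp
    have "real_of_int \<lfloor>N * t\<rfloor> \<le> N * t" "N * t < real_of_int \<lfloor>N * t\<rfloor> + 1" by linarith+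
    then have "q t \<le> t" "t < q t + inverse N" using N unfolding q by (simp_all add: field_simps)
    with q0 t N show "t \<in> {0..k}" "q t \<in> {0..k}" "dist (q t) t < d" by (auto simp: dist_real_def)
  qed
  ultimately show thesis by (rule that)
qed

text \<open>A diagonal choice: the \<open>k\<close>-th simple function follows \<open>f k\<close>
  only on \<open>[0, k)\<close> and up to the error \<open>1 / (k + 1)\<close>, which eventually
  covers every \<open>t\<close>.\<close>

lemma strongly_measurable_limit_continuous:
  fixes f :: "nat \<Rightarrow> real \<Rightarrow> 'a::chilbert_space"
  assumes f: "\<And>k. continuous_on {0..} (f k)" and lim: "AE t in lebesgue_on {0..}. (\<lambda>k. f k t) \<longlonglongrightarrow> g t"
  shows "strongly_measurable (lebesgue_on {0..}) g"
proof -
  have "\<exists>s. simple_function (lebesgue_on {0..}) s \<and> (\<forall>t. 0 \<le> t \<and> t < real k \<longrightarrow> dist (s t) (f k t) < inverse (real (Suc k)))" for k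
    using grid_approximation[OF f[of k], of "inverse (real (Suc k))" "real k"] by (metis inverse_positive_iff_positive of_nat_0_less_iff zero_less_Suc)
  then obtain s where s: "\<And>k. simple_function (lebesgue_on {0..}) (s k)"
    "\<And>k t. 0 \<le> t \<Longrightarrow> t < real k \<Longrightarrow> dist (s k t) (f k t) < inverse (real (Suc k))"
    by metis
  have "AE t in lebesgue_on {0..}. (\<lambda>k. s k t) \<longlonglongrightarrow> g t"
  proof (rule lebesgue_on_mono[OF lim])
    fix t :: real assume t: "(\<lambda>k. f k t) \<longlonglongrightarrow> g t" "t \<in> {0..}"
    have "\<forall>\<^sub>F k in sequentially. t < real k"
      using filterlim_real_sequentially by (simp add: filterlim_at_top_dense)
    then have "\<forall>\<^sub>F k in sequentially. norm (s k t - f k t) \<le> inverse (real (Suc k))"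
      by eventually_elim (use s(2) t(2) in \<open>auto simp: dist_norm less_imp_le simp del: of_nat_Suc\<close>)
    then have "(\<lambda>k. s k t - f k t) \<longlonglongrightarrow> 0"
      by (rule Lim_null_comparison[OF _ LIMSEQ_inverse_real_of_nat])
    from tendsto_add[OF this t(1)] show "(\<lambda>k. s k t) \<longlonglongrightarrow> g t" by simp
  qed
  with s(1) show ?thesis unfolding strongly_measurable_def by blast
qed

lemma strongly_measurable_continuous:
  fixes f :: "real \<Rightarrow> 'a::chilbert_space"
  shows "continuous_on {0..} f \<Longrightarrow> strongly_measurable (lebesgue_on {0..}) f"
  by (rule strongly_measurable_limit_continuous[of "\<lambda>k. f"]) auto

lemma energy_cong_AE: "AE t in lebesgue_on A. norm (f t) = norm (g t) \<Longrightarrow> energy A f = energy A g"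
  unfolding energy_def by (rule nn_integral_cong_AE) auto

lemma energy_uminus [simp]: "energy A (\<lambda>t. - f t) = energy A f"
  by (simp add: energy_def)

lemma energy_minus_commute: "energy A (\<lambda>t. f t - g t) = energy A (\<lambda>t. g t - f t)"
  by (simp add: energy_def norm_minus_commute)

lemma energy_scaleC:
  assumes "strongly_measurable (lebesgue_on A) f" "A \<in> sets lebesgue"
  shows "energy A (\<lambda>t. scaleC c (f t)) = ennreal ((cmod c)\<^sup>2) * energy A f"
  unfolding energy_def
  by (simp add: nn_integral_cmult[OF measurable_norm_square[OF assms], symmetric] norm_scaleC power_mult_distrib ennreal_mult)

lemma energy_mono:
  assumes "A \<subseteq> B" "A \<in> sets lebesgue" "B \<in> sets lebesgue"
  shows "energy A f \<le> energy B f"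
  unfolding energy_def using assms
  by (auto simp: nn_integral_restrict_space indicator_def intro!: nn_integral_mono)

lemma energy_split:
  assumes f: "strongly_measurable (lebesgue_on (A \<union> B)) f"
    and AB: "A \<in> sets lebesgue" "B \<in> sets lebesgue" "A \<inter> B \<subseteq> {c}"
  shows "energy (A \<union> B) f = energy A f + energy B f"
proof -
  have m: "(\<lambda>t. ennreal ((norm (f t))\<^sup>2) * indicator S t) \<in> borel_measurable lebesgue"
    if "S \<in> sets lebesgue" "S \<subseteq> A \<union> B" for S
    using AB that by (intro measurable_norm_square_indicator strongly_measurable_subset[OF f]) auto
  have "{c} \<in> null_sets lebesgue" by (rule null_sets_completionI) (simp add: countable_imp_null_set_lborel)
  then have "AE t in lebesgue. t \<notin> {c}" by (rule AE_not_in)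
  then have "AE t in lebesgue. ennreal ((norm (f t))\<^sup>2) * indicator (A \<union> B) t
      = ennreal ((norm (f t))\<^sup>2) * indicator A t + ennreal ((norm (f t))\<^sup>2) * indicator B t"
    by eventually_elim (use AB(3) in \<open>auto simp: indicator_def\<close>)
  then have "(\<integral>\<^sup>+t. ennreal ((norm (f t))\<^sup>2) * indicator (A \<union> B) t \<partial>lebesgue)
      = (\<integral>\<^sup>+t. ennreal ((norm (f t))\<^sup>2) * indicator A t + ennreal ((norm (f t))\<^sup>2) * indicator B t \<partial>lebesgue)"
    by (rule nn_integral_cong_AE)
  also have "\<dots> = (\<integral>\<^sup>+t. ennreal ((norm (f t))\<^sup>2) * indicator A t \<partial>lebesgue) + (\<integral>\<^sup>+t. ennreal ((norm (f t))\<^sup>2) * indicator B t \<partial>lebesgue)"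
    by (intro nn_integral_add m AB) auto
  finally show ?thesis
    using AB by (simp add: energy_def nn_integral_restrict_space)
qed

lemma energy_halfline_tendsto:
  assumes f: "strongly_measurable (lebesgue_on {0..}) f"
  shows "(\<lambda>n. energy {0..real n} f) \<longlonglongrightarrow> energy {0..} f"
proof -
  let ?g = "\<lambda>t. ennreal ((norm (f t))\<^sup>2)"
  have m: "(\<lambda>t. ?g t * indicator {0..real n} t) \<in> borel_measurable lebesgue" for n
    by (intro measurable_norm_square_indicator strongly_measurable_subset[OF f]) auto
  have inc: "incseq (\<lambda>n t. ?g t * indicator {0..real n} t)"
    by (auto simp: incseq_def le_fun_def indicator_def)
  have "(SUP n. ?g t * indicator {0..real n} t) = ?g t * indicator {0..} t" for t
  proof (rule antisym)
    show "(SUP n. ?g t * indicator {0..real n} t) \<le> ?g t * indicator {0..} t"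
      by (rule SUP_least) (auto simp: indicator_def)
    obtain n :: nat where "t \<le> real n" using real_arch_simple by blast
    then show "?g t * indicator {0..} t \<le> (SUP n. ?g t * indicator {0..real n} t)"
      by (intro SUP_upper2[of n]) (auto simp: indicator_def)
  qed
  then have "energy {0..} f = (\<integral>\<^sup>+t. (SUP n. ?g t * indicator {0..real n} t) \<partial>lebesgue)"
    by (simp add: energy_def nn_integral_restrict_space)
  also have "\<dots> = (SUP n. energy {0..real n} f)"
    by (simp add: nn_integral_monotone_convergence_SUP[OF inc m] energy_def nn_integral_restrict_space)
  finally have "energy {0..} f = (SUP n. energy {0..real n} f)" .
  moreover have "incseq (\<lambda>n. energy {0..real n} f)"
    by (auto simp: incseq_def intro!: energy_mono)
  ultimately show ?thesis using LIMSEQ_SUP by simp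
qed

lemma energy_tail:
  assumes f: "strongly_measurable (lebesgue_on {0..}) f" and fin: "energy {0..} f < \<infinity>" and e: "(e::ennreal) > 0"
  obtains s where "s \<ge> 0" "energy {s..} f < e"
proof (cases "energy {0..} f = 0")
  case True
  then show thesis using that[of 0] e by simp
next
  case False
  \<comment> \<open>Subtraction in \<open>ennreal\<close> is truncated at 0, so \<open>d\<close>
    lies strictly below the total energy only when that energy is nonzero; hence the case
    distinction.\<close>
  define d where "d = energy {0..} f - e"
  have "d < energy {0..} f"
    using fin e False unfolding d_def by (intro ennreal_between) (auto simp: zero_less_iff_neq_zero)
  then have "\<forall>\<^sub>F n in sequentially. d < energy {0..real n} f"
    by (rule order_tendstoD(1)[OF energy_halfline_tendsto[OF f]])
  then obtain n where n: "d < energy {0..real n} f" by (auto simp: eventually_sequentially)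
  have split: "energy {0..} f = energy {0..real n} f + energy {real n..} f"
  proof -
    have "{0..real n} \<union> {real n..} = {0..}" by auto
    then show ?thesis using energy_split[of "{0..real n}" "{real n..}" f "real n"] f by auto
  qed
  have "energy {real n..} f < e"
  proof (rule ccontr)
    assume "\<not> ?thesis"
    then have "energy {0..} f \<ge> energy {0..real n} f + e" by (simp add: split add_left_mono not_less)
    then have "energy {0..real n} f \<le> d" unfolding d_def
      using fin by (metis ennreal_minus_mono ennreal_add_diff_cancel_right top.not_eq_extremum order_refl infinity_ennreal_def add_right_mono ennreal_le_minus_iff le_iff_add order_trans leD ennreal_top_neq_zero top_unique)
    then show False using n by simp
  qed
  then show thesis by (intro that[of "real n"]) auto
qed

text \<open>Young's inequality: with \<open>e = s\<^sup>2\<close>, expand the nonnegative square of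
  the norm of \<open>s *\<^sub>R x - (1 / s) *\<^sub>R y\<close>.\<close>

lemma norm_add_square_le:
  fixes x y :: "'a::real_inner"
  assumes "e > 0"
  shows "(norm (x + y))\<^sup>2 \<le> (1 + e) * (norm x)\<^sup>2 + (1 + 1 / e) * (norm y)\<^sup>2"
proof -
  obtain s where s: "s > 0" "e = s\<^sup>2" using assms by (metis real_sqrt_gt_zero real_sqrt_pow2 less_imp_le)
  have "0 \<le> (norm (s *\<^sub>R x - (1 / s) *\<^sub>R y))\<^sup>2" by simp
  also have "\<dots> = e * (norm x)\<^sup>2 + (norm y)\<^sup>2 / e - 2 * inner x y"
    using s(1) unfolding power2_norm_eq_inner s(2)
    by (simp add: inner_diff_left inner_diff_right inner_commute[of y x] power2_eq_square field_simps)
  finally show ?thesis unfolding power2_norm_eq_inner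
    by (simp add: inner_add_left inner_add_right inner_commute algebra_simps)
qed

lemma energy_add_le:
  assumes "strongly_measurable (lebesgue_on A) f" "strongly_measurable (lebesgue_on A) g" "A \<in> sets lebesgue" "e > 0"
  shows "energy A (\<lambda>t. f t + g t) \<le> ennreal (1 + e) * energy A f + ennreal (1 + 1 / e) * energy A g"
proof -
  have "energy A (\<lambda>t. f t + g t) \<le> (\<integral>\<^sup>+t. ennreal (1 + e) * ennreal ((norm (f t))\<^sup>2) + ennreal (1 + 1 / e) * ennreal ((norm (g t))\<^sup>2) \<partial>lebesgue_on A)"
    unfolding energy_def using norm_add_square_le[OF assms(4)] assms(4)
    by (intro nn_integral_mono) (simp add: ennreal_mult[symmetric] ennreal_plus[symmetric] del: ennreal_plus)
  also have "\<dots> = ennreal (1 + e) * energy A f + ennreal (1 + 1 / e) * energy A g"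
    using measurable_norm_square[OF assms(1,3)] measurable_norm_square[OF assms(2,3)]
    by (simp add: nn_integral_add nn_integral_cmult energy_def)
  finally show ?thesis .
qed

lemma energy_parallelogram:
  assumes "strongly_measurable (lebesgue_on A) f" "strongly_measurable (lebesgue_on A) g" "A \<in> sets lebesgue"
  shows "energy A (\<lambda>t. f t + g t) + energy A (\<lambda>t. f t - g t) = 2 * energy A f + 2 * energy A g"
proof -
  note m = measurable_norm_square[OF _ assms(3)]
  note fg = m[OF strongly_measurable_add[OF assms(1,2)]] m[OF strongly_measurable_diff[OF assms(1,2)]]
  have "energy A (\<lambda>t. f t + g t) + energy A (\<lambda>t. f t - g t)
    = (\<integral>\<^sup>+t. ennreal ((norm (f t + g t))\<^sup>2) + ennreal ((norm (f t - g t))\<^sup>2) \<partial>lebesgue_on A)"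
    using fg by (simp add: energy_def nn_integral_add)
  also have "\<dots> = (\<integral>\<^sup>+t. 2 * ennreal ((norm (f t))\<^sup>2) + 2 * ennreal ((norm (g t))\<^sup>2) \<partial>lebesgue_on A)"
  proof (rule nn_integral_cong)
    fix t
    show "ennreal ((norm (f t + g t))\<^sup>2) + ennreal ((norm (f t - g t))\<^sup>2) = 2 * ennreal ((norm (f t))\<^sup>2) + 2 * ennreal ((norm (g t))\<^sup>2)"
      by (simp add: ennreal_plus[symmetric] parallelogram_law ennreal_mult del: ennreal_plus)
        (simp add: ennreal_mult)
  qed
  also have "\<dots> = 2 * energy A f + 2 * energy A g"
    using m[OF assms(1)] m[OF assms(2)] by (simp add: nn_integral_add nn_integral_cmult energy_def)
  finally show ?thesis .
qed

text \<open>Recovers Minkowski's inequality from the weighted ones. The best weight is the ratio of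
  the square roots; padding both by \<open>e / 2\<close> keeps that ratio defined and positive when
  \<open>b\<close> or \<open>d\<close> vanishes.\<close>

lemma sqrt_triangle:
  fixes a b d :: real
  assumes nn: "0 \<le> b" "0 \<le> d" and le: "\<And>e. e > 0 \<Longrightarrow> a \<le> (1 + e) * b + (1 + 1 / e) * d"
  shows "sqrt a \<le> sqrt b + sqrt d"
proof (rule field_le_epsilon)
  fix e :: real assume e: "0 < e"
  define p q where "p = sqrt b + e / 2" and "q = sqrt d + e / 2"
  have pq: "p > 0" "q > 0" using nn e by (simp_all add: p_def q_def add_nonneg_pos)
  have b: "b \<le> p\<^sup>2" using nn e by (simp add: real_le_lsqrt p_def real_sqrt_le_iff sqrt_le_D)
  have d: "d \<le> q\<^sup>2" using nn e by (simp add: q_def sqrt_le_D)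
  have "a \<le> (1 + q / p) * b + (1 + 1 / (q / p)) * d" by (rule le) (use pq in simp)
  also have "\<dots> \<le> (1 + q / p) * p\<^sup>2 + (1 + 1 / (q / p)) * q\<^sup>2"
    using b d pq by (intro add_mono mult_left_mono) auto
  also have "\<dots> = (p + q)\<^sup>2" using pq by (simp add: field_simps power2_eq_square)
  finally have "sqrt a \<le> p + q" using pq by (simp add: real_le_lsqrt)
  then show "sqrt a \<le> sqrt b + sqrt d + e" by (simp add: p_def q_def)
qed

lemma energy_triangle:
  assumes f: "strongly_measurable (lebesgue_on A) f" and g: "strongly_measurable (lebesgue_on A) g" and A: "A \<in> sets lebesgue"
    and fin: "energy A f < \<infinity>" "energy A g < \<infinity>"
  shows "energy A (\<lambda>t. f t + g t) < \<infinity>"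
    "sqrt (enn2real (energy A (\<lambda>t. f t + g t))) \<le> sqrt (enn2real (energy A f)) + sqrt (enn2real (energy A g))"
proof -
  define a b where "a = enn2real (energy A f)" and "b = enn2real (energy A g)"
  have ab: "energy A f = ennreal a" "energy A g = ennreal b" "0 \<le> a" "0 \<le> b"
    using fin by (simp_all add: a_def b_def less_top)
  have le: "energy A (\<lambda>t. f t + g t) \<le> ennreal ((1 + e) * a + (1 + 1 / e) * b)" if "e > 0" for e
  proof -
    have "ennreal (1 + e) * energy A f + ennreal (1 + 1 / e) * energy A g = ennreal ((1 + e) * a + (1 + 1 / e) * b)"
      using that ab by (simp add: ennreal_mult[symmetric] ennreal_plus[symmetric] del: ennreal_plus)
    then show ?thesis using energy_add_le[OF f g A that] by simp
  qed
  show "energy A (\<lambda>t. f t + g t) < \<infinity>" using le[of 1] by (simp add: le_less_trans)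
  show "sqrt (enn2real (energy A (\<lambda>t. f t + g t))) \<le> sqrt (enn2real (energy A f)) + sqrt (enn2real (energy A g))"
    unfolding a_def[symmetric] b_def[symmetric]
  proof (rule sqrt_triangle[OF ab(3,4)])
    fix e :: real assume e: "e > 0"
    show "enn2real (energy A (\<lambda>t. f t + g t)) \<le> (1 + e) * a + (1 + 1 / e) * b"
      using le[OF e] e ab by (intro enn2real_leI) auto
  qed
qed

text \<open>The reverse triangle inequality for the square root of the energy, available once the
  distance to the limit has become finite.\<close>

lemma energy_tendsto:
  assumes fk: "\<And>k. strongly_measurable (lebesgue_on A) (f k)" and f: "strongly_measurable (lebesgue_on A) g"
    and A: "A \<in> sets lebesgue" and fin: "energy A g < \<infinity>"
    and lim: "(\<lambda>k. energy A (\<lambda>t. f k t - g t)) \<longlonglongrightarrow> 0"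
  shows "(\<lambda>k. energy A (f k)) \<longlonglongrightarrow> energy A g"
proof -
  define r where "r h = sqrt (enn2real (energy A h))" for h :: "real \<Rightarrow> 'a"
  note diff = strongly_measurable_diff[OF fk f]
  have d: "\<forall>\<^sub>F k in sequentially. energy A (\<lambda>t. f k t - g t) < \<infinity>"
    by (rule order_tendstoD(2)[OF lim]) simp
  have "(\<lambda>k. enn2real (energy A (\<lambda>t. f k t - g t))) \<longlonglongrightarrow> 0"
    using lim by (intro tendsto_enn2real) simp_all
  then have rd: "(\<lambda>k. r (\<lambda>t. f k t - g t)) \<longlonglongrightarrow> 0"
    unfolding r_def using tendsto_real_sqrt by fastforce
  have ev: "\<forall>\<^sub>F k in sequentially. energy A (f k) < \<infinity> \<and> norm (r (f k) - r g) \<le> r (\<lambda>t. f k t - g t)"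
    using d
  proof eventually_elim
    case (elim k)
    have fink: "energy A (f k) < \<infinity>" using energy_triangle(1)[OF diff f A elim fin] by simp
    have "r (f k) \<le> r (\<lambda>t. f k t - g t) + r g"
      using energy_triangle(2)[OF diff f A elim fin] by (simp add: r_def)
    moreover have "r g \<le> r (\<lambda>t. g t - f k t) + r (f k)"
      using energy_triangle(2)[OF strongly_measurable_diff[OF f fk] fk A _ fink, of k] elim
      by (simp add: r_def energy_minus_commute[of A g])
    ultimately show ?case using fink by (simp add: r_def energy_minus_commute[of A g] abs_le_iff)
  qed
  have "(\<lambda>k. r (f k) - r g) \<longlonglongrightarrow> 0"
    by (rule Lim_null_comparison[OF _ rd]) (use ev in \<open>auto elim: eventually_mono\<close>)
  then have "(\<lambda>k. r (f k)) \<longlonglongrightarrow> r g" by (simp add: LIM_zero_iff)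
  then have "(\<lambda>k. ennreal ((r (f k))\<^sup>2)) \<longlonglongrightarrow> ennreal ((r g)\<^sup>2)"
    by (intro tendsto_intros)
  moreover have r2: "ennreal ((r h)\<^sup>2) = energy A h" if "energy A h < \<infinity>" for h
    using that by (simp add: r_def less_top)
  moreover have "\<forall>\<^sub>F k in sequentially. ennreal ((r (f k))\<^sup>2) = energy A (f k)"
    using ev by eventually_elim (simp add: r2)
  ultimately show ?thesis using fin by (simp add: filterlim_cong[OF refl refl])
qed

lemma energy_continuous:
  assumes "continuous_on {a..b} f"
  shows "energy {a..b} f = ennreal (integral {a..b} (\<lambda>t. (norm (f t))\<^sup>2))"
proof -
  have "(\<lambda>t. (norm (f t))\<^sup>2) integrable_on {a..b}"
    by (intro integrable_continuous_real continuous_intros assms)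
  then have "((\<lambda>t. (norm (f t))\<^sup>2) has_integral integral {a..b} (\<lambda>t. (norm (f t))\<^sup>2)) {a..b}"
    by (rule integrable_integral)
  from nn_integral_has_integral_lebesgue[OF _ this]
  have "(\<integral>\<^sup>+t. ennreal (indicator {a..b} t * (norm (f t))\<^sup>2) \<partial>lborel) = ennreal (integral {a..b} (\<lambda>t. (norm (f t))\<^sup>2))"
    by simp
  moreover have "ennreal (indicator {a..b} t * (norm (f t))\<^sup>2) = ennreal ((norm (f t))\<^sup>2) * indicator {a..b} t" for t
    by (auto simp: indicator_def)
  ultimately show ?thesis
    by (simp add: energy_def nn_integral_restrict_space nn_integral_completion)
qed

section \<open>The closed loop operator\<close>

lemma closed_loop_m_dissipative:
  fixes D :: "'x::chilbert_space set" and G K :: "'x \<Rightarrow> 'u::chilbert_space"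
  assumes node: "boundary_node D G L K" and pass: "impedance_passive D G L K"
  obtains l0 where "m_dissipative {x\<in>D. G x + K x = 0} L l0"
proof -
  from node obtain T Gr where D: "csubspace D" and L: "clinear_on D L"
    and Gb: "graph_bounded D L G" and Kb: "graph_bounded D L K"
    and gen: "generates {x\<in>D. G x = 0} L T"
    and Gr: "\<And>v. Gr v \<in> D" "\<And>v. G (Gr v) = v"
    unfolding boundary_node_def by blast
  have G: "clinear_on D G" and K: "clinear_on D K" using Gb Kb by (simp_all add: graph_bounded_def)
  obtain c where c: "\<And>x. x \<in> D \<Longrightarrow> norm (K x) \<le> c * graph_norm L x"
    using Kb by (auto simp: graph_bounded_def)
  have sub: "subspace D" using D by (rule csubspace_imp_subspace)
  have add: "L (x + y) = L x + L y" "G (x + y) = G x + G y" "K (x + y) = K x + K y"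
    if "x \<in> D" "y \<in> D" for x y using that L G K by (simp_all add: clinear_on_def)
  have diff: "L (x - y) = L x - L y" "G (x - y) = G x - G y" "K (x - y) = K x - K y"
    if "x \<in> D" "y \<in> D" for x y using that D L G K by (simp_all add: clinear_on_diff)
  have scale: "L (r *\<^sub>R x) = r *\<^sub>R L x" "G (r *\<^sub>R x) = r *\<^sub>R G x" "K (r *\<^sub>R x) = r *\<^sub>R K x"
    if "x \<in> D" for r x using that L G K by (simp_all add: clinear_on_scaleR)
  have pas: "inner (L x) x \<le> inner (G x) (K x)" if "x \<in> D" for x
    using that pass by (simp add: impedance_passive_def inner_eq_Re_cinner)
  obtain l0 where l0: "l0 > 0" "\<And>l f. l \<ge> l0 \<Longrightarrow> \<exists>x\<in>{x\<in>D. G x = 0}. l *\<^sub>R x - L x = f"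
    using generates_surj[OF gen] by blast
  \<comment> \<open>The right inverse of \<open>G\<close> lifts the boundary value \<open>v\<close>;
    a correction in the kernel of \<open>G\<close> repairs the interior equation.\<close>
  have inhom: "\<exists>x\<in>D. G x = v \<and> l *\<^sub>R x - L x = f" if l: "l \<ge> l0" for l v f
  proof -
    obtain w where w: "w \<in> D" "G w = 0" "l *\<^sub>R w - L w = f - (l *\<^sub>R Gr v - L (Gr v))"
      using l0(2)[OF l] by blast
    have "l *\<^sub>R (Gr v + w) - L (Gr v + w) = (l *\<^sub>R Gr v - L (Gr v)) + (l *\<^sub>R w - L w)"
      by (simp only: add[OF Gr(1) w(1)] scaleR_add_right add_diff_add)
    then show ?thesis
      using w Gr by (intro bexI[of _ "Gr v + w"]) (auto simp: add(2) subspace_add[OF sub])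
  qed
  text \<open>With \<open>S v\<close> the solution of \<open>(l - L) x = f\<close>, \<open>G x = v\<close>, the closed loop equation is
    \<open>v + K (S v) = 0\<close>. Passivity makes \<open>K \<circ> S\<close> monotone, so a damped fixed point iteration contracts.\<close>
  have surj: "\<exists>x\<in>{x\<in>D. G x + K x = 0}. l *\<^sub>R x - L x = f" if l: "l \<ge> l0" for l f
  proof -
    have lpos: "l > 0" using l l0(1) by simp
    have "\<forall>v. \<exists>x. x \<in> D \<and> G x = v \<and> l *\<^sub>R x - L x = f" using inhom[OF l] by blast
    from choice[OF this] obtain S where S: "\<And>v. S v \<in> D" "\<And>v. G (S v) = v" "\<And>v. l *\<^sub>R S v - L (S v) = f"
      by blast
    define b where "b = \<bar>c\<bar> * sqrt (1 + l\<^sup>2)"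
    define M where "M = b * (b / l)"
    have b0: "b \<ge> 0" by (simp add: b_def)
    \<comment> \<open>Chosen so that \<open>eps\<^sup>2 * (1 + M\<^sup>2) = eps\<close>. Dropping
      the nonnegative cross term, the squared contraction factor
      \<open>1 - 2 * eps + eps\<^sup>2 * (1 + M\<^sup>2)\<close> becomes
      \<open>1 - eps\<close>.\<close>
    define eps where "eps = 1 / (1 + M\<^sup>2)"
    have Q: "0 < 1 + M\<^sup>2" by (simp add: add_pos_nonneg)
    then have "eps * (1 + M\<^sup>2) = 1" by (simp add: eps_def)
    then have "eps\<^sup>2 * (1 + M\<^sup>2) = eps" by (simp add: power2_eq_square mult.assoc)
    with Q have eps: "0 < eps" "eps \<le> 1" "eps\<^sup>2 * (1 + M\<^sup>2) = eps" by (simp_all add: eps_def)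
    define Phi where "Phi v = v - eps *\<^sub>R (v + K (S v))" for v
    have "dist (Phi v) (Phi w) \<le> sqrt (1 - eps) * dist v w" for v w
    proof -
      define d e where "d = S v - S w" and "e = v - w"
      have d: "d \<in> D" "G d = e" "K d = K (S v) - K (S w)"
        using S by (simp_all add: d_def e_def diff subspace_diff[OF sub])
      \<comment> \<open>The difference of two solutions with the same \<open>f\<close> solves the
        homogeneous equation, so its graph norm is a fixed multiple of its norm and \<open>K\<close>
        acts on it as a bounded operator.\<close>
      have Ld: "L d = l *\<^sub>R d"
      proof -
        have "l *\<^sub>R d - L d = (l *\<^sub>R S v - L (S v)) - (l *\<^sub>R S w - L (S w))"
          using S(1) by (simp add: d_def diff scaleR_diff_right)
        then show ?thesis by (simp add: S(3))
      qed
      have "norm (K d) \<le> c * graph_norm L d" by (rule c[OF d(1)])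
      also have "graph_norm L d = sqrt ((1 + l\<^sup>2) * (norm d)\<^sup>2)"
        unfolding graph_norm_def Ld by (simp add: algebra_simps power_mult_distrib)
      also have "\<dots> = sqrt (1 + l\<^sup>2) * norm d" by (simp add: real_sqrt_mult)
      also have "c * (sqrt (1 + l\<^sup>2) * norm d) \<le> b * norm d"
        unfolding b_def mult.assoc by (intro mult_right_mono) auto
      finally have Kd: "norm (K d) \<le> b * norm d" .
      \<comment> \<open>Passivity at \<open>d\<close> does double duty: it shows that the cross term
        is nonnegative, and together with \<open>Kd\<close> it bounds \<open>d\<close> by
        \<open>e\<close>.\<close>
      have ld: "l * (norm d)\<^sup>2 \<le> inner e (K d)"
        using pas[OF d(1)] by (simp add: Ld d(2) power2_norm_eq_inner)
      have "norm d \<le> (b / l) * norm e"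
      proof (cases "d = 0")
        case False
        have "l * norm d * norm d \<le> norm e * norm (K d)"
          using ld norm_cauchy_schwarz[of e "K d"] by (simp add: power2_eq_square mult.assoc)
        also have "\<dots> \<le> norm e * (b * norm d)" by (intro mult_left_mono Kd) simp
        finally have "(l * norm d) * norm d \<le> (norm e * b) * norm d" by (simp add: mult.assoc)
        then have "l * norm d \<le> norm e * b" using False by (simp add: mult_le_cancel_right)
        then show ?thesis using lpos by (simp add: field_simps)
      qed (use b0 lpos in simp)
      then have "norm (K d) \<le> M * norm e"
        using order_trans[OF Kd mult_left_mono[OF _ b0]] by (fastforce simp: M_def mult.assoc)
      then have KM: "(norm (K d))\<^sup>2 \<le> M\<^sup>2 * (norm e)\<^sup>2"
        by (metis norm_ge_zero power_mono power_mult_distrib)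
      have mono: "0 \<le> inner e (K d)"
        using ld lpos by (meson order_trans mult_nonneg_nonneg less_imp_le zero_le_power2)
      have "Phi v - Phi w = (1 - eps) *\<^sub>R e - eps *\<^sub>R K d"
        unfolding d(3) by (simp add: Phi_def e_def algebra_simps)
      then have "(norm (Phi v - Phi w))\<^sup>2 = (norm ((1 - eps) *\<^sub>R e - eps *\<^sub>R K d))\<^sup>2" by simp
      also have "\<dots> = (1 - eps)\<^sup>2 * (norm e)\<^sup>2 - 2 * eps * (1 - eps) * inner e (K d) + eps\<^sup>2 * (norm (K d))\<^sup>2"
        unfolding power2_norm_eq_inner
        by (simp add: inner_diff_left inner_diff_right inner_commute[of "K d" e] power2_eq_square algebra_simps)
      also have "\<dots> \<le> (1 - eps)\<^sup>2 * (norm e)\<^sup>2 - 0 + eps\<^sup>2 * (M\<^sup>2 * (norm e)\<^sup>2)"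
        using eps mono KM by (intro add_mono diff_mono mult_left_mono mult_nonneg_nonneg) auto
      also have "\<dots> = (1 - 2 * eps + eps\<^sup>2 * (1 + M\<^sup>2)) * (norm e)\<^sup>2"
        by (simp add: power2_eq_square algebra_simps)
      also have "\<dots> = (1 - eps) * (norm e)\<^sup>2" unfolding eps(3) by simp
      finally have "sqrt ((norm (Phi v - Phi w))\<^sup>2) \<le> sqrt ((1 - eps) * (norm e)\<^sup>2)"
        by (rule real_sqrt_le_mono)
      then show ?thesis by (simp add: real_sqrt_mult dist_norm e_def)
    qed
    then obtain v where "Phi v = v"
      using banach_fix_type[of "sqrt (1 - eps)" Phi] eps by auto
    then have "v + K (S v) = 0" using eps(1) by (simp add: Phi_def)
    then show ?thesis using S by (intro bexI[of _ "S v"]) auto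
  qed
  have "m_dissipative {x\<in>D. G x + K x = 0} L l0"
  proof
    show "subspace {x\<in>D. G x + K x = 0}"
    proof (rule subspaceI)
      show "0 \<in> {x\<in>D. G x + K x = 0}"
        using subspace_0[OF sub] scale[of 0 0] by simp
      show "x + y \<in> {x\<in>D. G x + K x = 0}" if "x \<in> {x\<in>D. G x + K x = 0}" "y \<in> {x\<in>D. G x + K x = 0}" for x y
        using that subspace_add[OF sub, of x y]
        by (simp add: add) (metis (no_types, opaque_lifting) add.assoc add.commute add.right_neutral)
      show "r *\<^sub>R x \<in> {x\<in>D. G x + K x = 0}" if "x \<in> {x\<in>D. G x + K x = 0}" for r x
        using that subspace_scale[OF sub, of x r] by (simp add: scale scaleR_add_right[symmetric])
    qed
    show "inner (L x) x \<le> 0" if "x \<in> {x\<in>D. G x + K x = 0}" for x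
    proof -
      \<comment> \<open>Under the feedback the supplied power is minus the square of the norm of
        \<open>K x\<close>.\<close>
      have "G x = - K x" using that by (simp add: eq_neg_iff_add_eq_0)
      then show ?thesis using pas[of x] that inner_ge_zero[of "K x"] by (auto intro: order_trans)
    qed
  qed (use add scale l0 surj in auto)
  then show thesis by (rule that)
qed

section \<open>Solutions and their energy balance\<close>

lemma L2_iff: "f \<in> L2 \<longleftrightarrow> strongly_measurable (lebesgue_on {0..}) f \<and> energy {0..} f < \<infinity>"
  by (simp add: L2_def energy_def)

lemma L2_loc_iff:
  "f \<in> L2_loc \<longleftrightarrow> strongly_measurable (lebesgue_on {0..}) f \<and> (\<forall>\<tau>>0. energy {0..\<tau>} f < \<infinity>)"
  by (simp add: L2_loc_def energy_def)

lemma L2_loc_lim_iff: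
  "L2_loc_lim fs f \<longleftrightarrow> (\<forall>\<tau>>0. (\<lambda>k. energy {0..\<tau>} (\<lambda>t. fs k t - f t)) \<longlonglongrightarrow> 0)"
  by (simp add: L2_loc_lim_def energy_def)

lemma sm_interval:
  "strongly_measurable (lebesgue_on {0..}) f \<Longrightarrow> 0 \<le> a \<Longrightarrow> strongly_measurable (lebesgue_on {a..b}) f" for a b :: real
  by (rule strongly_measurable_subset) auto

lemma strongly_measurable_scaleC:
  "strongly_measurable M f \<Longrightarrow> strongly_measurable M (\<lambda>t. scaleC a (f t))"
  using strongly_measurable_lincomb[of M f f a 0] by simp

lemma energy_lincomb_le:
  assumes "strongly_measurable (lebesgue_on A) f" "strongly_measurable (lebesgue_on A) g" "A \<in> sets lebesgue"
  shows "energy A (\<lambda>t. scaleC a (f t) + scaleC b (g t))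
    \<le> ennreal (2 * (cmod a)\<^sup>2) * energy A f + ennreal (2 * (cmod b)\<^sup>2) * energy A g"
  using energy_add_le[OF strongly_measurable_scaleC[OF assms(1), of a] strongly_measurable_scaleC[OF assms(2), of b] assms(3), of 1]
  by (simp add: energy_scaleC[OF assms(1,3)] energy_scaleC[OF assms(2,3)] ennreal_mult mult.assoc)

lemma energy_lincomb_finite:
  assumes "strongly_measurable (lebesgue_on A) f" "strongly_measurable (lebesgue_on A) g" "A \<in> sets lebesgue"
    and "energy A f < \<infinity>" "energy A g < \<infinity>"
  shows "energy A (\<lambda>t. scaleC a (f t) + scaleC b (g t)) < \<infinity>"
  by (rule le_less_trans[OF energy_lincomb_le[OF assms(1-3)]])
    (use assms(4,5) in \<open>auto simp: ennreal_mult_less_top\<close>)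

lemma L2_loc_lincomb:
  "f \<in> L2_loc \<Longrightarrow> g \<in> L2_loc \<Longrightarrow> (\<lambda>t. scaleC a (f t) + scaleC b (g t)) \<in> L2_loc"
  unfolding L2_loc_iff
  by (intro conjI strongly_measurable_lincomb allI impI energy_lincomb_finite sm_interval) auto

lemma L2_loc_lim_lincomb:
  assumes fs: "\<And>k. strongly_measurable (lebesgue_on {0..}) (fs k)" and f: "f \<in> L2_loc" and fl: "L2_loc_lim fs f"
    and gs: "\<And>k. strongly_measurable (lebesgue_on {0..}) (gs k)" and g: "g \<in> L2_loc" and gl: "L2_loc_lim gs g"
  shows "L2_loc_lim (\<lambda>k t. scaleC a (fs k t) + scaleC b (gs k t)) (\<lambda>t. scaleC a (f t) + scaleC b (g t))"
  unfolding L2_loc_lim_iff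
proof (intro allI impI)
  fix \<tau> :: real assume \<tau>: "\<tau> > 0"
  let ?F = "\<lambda>k t. fs k t - f t" and ?G = "\<lambda>k t. gs k t - g t"
  let ?H = "\<lambda>k t. (scaleC a (fs k t) + scaleC b (gs k t)) - (scaleC a (f t) + scaleC b (g t))"
  let ?R = "\<lambda>k. ennreal (2 * (cmod a)\<^sup>2) * energy {0..\<tau>} (?F k) + ennreal (2 * (cmod b)\<^sup>2) * energy {0..\<tau>} (?G k)"
  have m: "strongly_measurable (lebesgue_on {0..}) f" "strongly_measurable (lebesgue_on {0..}) g"
    using f g by (auto simp: L2_loc_iff)
  have le: "energy {0..\<tau>} (?H k)
      \<le> ?R k" for k
  proof -
    have "?H k
      = (\<lambda>t. scaleC a (?F k t) + scaleC b (?G k t))"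
      by (simp add: scaleC_diff_right algebra_simps)
    then show ?thesis
      using energy_lincomb_le[of "{0..\<tau>}" "?F k" "?G k" a b] fs gs m
      by (simp add: sm_interval strongly_measurable_diff)
  qed
  have "(\<lambda>k. ?R k)
      \<longlonglongrightarrow> ennreal (2 * (cmod a)\<^sup>2) * 0 + ennreal (2 * (cmod b)\<^sup>2) * 0"
    using fl gl \<tau> by (intro tendsto_add ennreal_tendsto_cmult) (auto simp: L2_loc_lim_iff)
  then have lim: "(\<lambda>k. ?R k) \<longlonglongrightarrow> 0"
    by (simp only: mult_zero_right add_0_right)
  show "(\<lambda>k. energy {0..\<tau>} (?H k)) \<longlonglongrightarrow> 0"
    by (rule tendsto_sandwich[OF always_eventually always_eventually tendsto_const lim])
      (intro allI zero_le le)+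
qed

lemma geometric_tendsto:
  fixes z :: "nat \<Rightarrow> 'a::real_normed_vector"
  assumes "\<And>k. norm (z k - z0) \<le> (1 / 4) ^ k"
  shows "z \<longlonglongrightarrow> z0"
proof -
  have "(\<lambda>j. (1 / 4 :: real) ^ j) \<longlonglongrightarrow> 0" by (rule LIMSEQ_realpow_zero) auto
  then have "(\<lambda>j. z j - z0) \<longlonglongrightarrow> 0"
    by (rule Lim_null_comparison[rotated]) (use assms in auto)
  then show ?thesis by (simp add: LIM_zero_iff)
qed

text \<open>A Riesz--Fischer argument; strong measurability of the limit is inherited from the
  continuous approximants, so separability plays no role.\<close>

lemma L2_fast_cauchy_limit:
  fixes y :: "nat \<Rightarrow> real \<Rightarrow> 'a::chilbert_space" and z :: "nat \<Rightarrow> 'b::real_normed_vector"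
  assumes yc: "\<And>k. continuous_on {0..} (y k)"
    and ye: "\<And>k j. energy {0..} (\<lambda>t. y k t - y j t) \<le> ennreal ((norm (z k - z j))\<^sup>2)"
    and z: "\<And>k. norm (z k - z0) \<le> (1 / 4) ^ k"
  obtains w where "strongly_measurable (lebesgue_on {0..}) w"
    "\<And>k. energy {0..} (\<lambda>t. y k t - w t) \<le> ennreal ((norm (z k - z0))\<^sup>2)"
proof -
  define M where "M = lebesgue_on {0::real..}"
  define d where "d k t = y (Suc k) t - y k t" for k t
  have dk: "d k = (\<lambda>t. y (Suc k) t - y k t)" for k by (simp add: fun_eq_iff d_def)
  have ysm: "strongly_measurable M (y k)" for k
    unfolding M_def by (rule strongly_measurable_continuous[OF yc])
  have m: "(\<lambda>t. ennreal ((norm (y k t - y j t))\<^sup>2)) \<in> borel_measurable M" for k j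
    unfolding M_def using ysm by (intro measurable_norm_square strongly_measurable_diff) (auto simp: M_def)
  \<comment> \<open>Consecutive functions differ in energy by at most
    \<open>4 * (1 / 16) ^ k\<close>, so the weight \<open>4 ^ k\<close> leaves a summable series.
    Conversely, a finite weighted sum at a point makes the increments there decay like
    \<open>(1 / 2) ^ k\<close>.\<close>
  have dE: "(\<integral>\<^sup>+t. ennreal (4 ^ k) * ennreal ((norm (d k t))\<^sup>2) \<partial>M) \<le> ennreal (4 * (1 / 4) ^ k)" for k
  proof -
    have "norm (z (Suc k) - z k) \<le> norm (z (Suc k) - z0) + norm (z k - z0)"
      using norm_triangle_ineq4[of "z (Suc k) - z0" "z k - z0"] by simp
    also have "\<dots> \<le> 2 * (1 / 4) ^ k"
    proof -
      have "(1 / 4 :: real) ^ Suc k \<le> (1 / 4) ^ k" by simp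
      then show ?thesis using z[of "Suc k"] z[of k] by linarith
    qed
    finally have "(norm (z (Suc k) - z k))\<^sup>2 \<le> (2 * (1 / 4) ^ k)\<^sup>2" by (rule power_mono) simp
    also have "\<dots> = 4 * (1 / 16) ^ k"
      by (simp add: power_mult_distrib power2_eq_square power_mult_distrib[symmetric])
    finally have zz: "(norm (z (Suc k) - z k))\<^sup>2 \<le> 4 * (1 / 16) ^ k" .
    have "(\<integral>\<^sup>+t. ennreal (4 ^ k) * ennreal ((norm (d k t))\<^sup>2) \<partial>M) = ennreal (4 ^ k) * energy {0..} (d k)"
      unfolding d_def energy_def M_def[symmetric] by (rule nn_integral_cmult[OF m])
    also have "\<dots> \<le> ennreal (4 ^ k) * ennreal (4 * (1 / 16) ^ k)"
      unfolding dk by (intro mult_left_mono order_trans[OF ye ennreal_leI[OF zz]]) simp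
    also have "\<dots> = ennreal (4 ^ k * (4 * (1 / 16) ^ k))" by (rule ennreal_mult[symmetric]) auto
    also have "(4::real) ^ k * (4 * (1 / 16) ^ k) = 4 * (1 / 4) ^ k"
      by (simp add: power_mult_distrib[symmetric] power_divide field_simps)
    finally show ?thesis .
  qed
  have md: "(\<lambda>t. ennreal (4 ^ k) * ennreal ((norm (d k t))\<^sup>2)) \<in> borel_measurable M" for k
    unfolding d_def by (intro borel_measurable_times_ennreal m) auto
  have "(\<integral>\<^sup>+t. (\<Sum>k. ennreal (4 ^ k) * ennreal ((norm (d k t))\<^sup>2)) \<partial>M)
      = (\<Sum>k. \<integral>\<^sup>+t. ennreal (4 ^ k) * ennreal ((norm (d k t))\<^sup>2) \<partial>M)"
    by (rule nn_integral_suminf[OF md])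
  also have "\<dots> \<le> (\<Sum>k. ennreal (4 * (1 / 4) ^ k))" by (rule suminf_le[OF dE]) auto
  also have "\<dots> = ennreal (\<Sum>k. 4 * (1 / 4) ^ k)"
    by (rule suminf_ennreal2) (auto intro!: summable_mult summable_geometric)
  also have "\<dots> < \<infinity>" by simp
  finally have "AE t in M. (\<Sum>k. ennreal (4 ^ k) * ennreal ((norm (d k t))\<^sup>2)) \<noteq> \<infinity>"
    by (intro nn_integral_PInf_AE) (auto intro!: borel_measurable_suminf_order md)
  then have conv: "AE t in M. convergent (\<lambda>k. y k t)"
  proof eventually_elim
    fix t assume fin: "(\<Sum>k. ennreal (4 ^ k) * ennreal ((norm (d k t))\<^sup>2)) \<noteq> \<infinity>"
    then obtain C where C: "0 \<le> C" "(\<Sum>k. ennreal (4 ^ k) * ennreal ((norm (d k t))\<^sup>2)) = ennreal C"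
      by (cases "\<Sum>k. ennreal (4 ^ k) * ennreal ((norm (d k t))\<^sup>2)") auto
    have db: "norm (d k t) \<le> sqrt C * (1 / 2) ^ k" for k
    proof -
      have "ennreal (4 ^ k) * ennreal ((norm (d k t))\<^sup>2) \<le> ennreal C"
        unfolding C(2)[symmetric] using sum_le_suminf[of "\<lambda>k. ennreal (4 ^ k) * ennreal ((norm (d k t))\<^sup>2)" "{k}"] by simp
      then have "4 ^ k * (norm (d k t))\<^sup>2 \<le> C" using C(1) by (simp add: ennreal_mult[symmetric])
      then have "(2 ^ k * norm (d k t))\<^sup>2 \<le> C"
        by (simp add: power_mult_distrib power_mult[symmetric] mult.commute[of k]) (simp add: power_mult)
      then have "2 ^ k * norm (d k t) \<le> sqrt C" by (rule real_le_rsqrt)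
      then show ?thesis by (simp add: power_divide field_simps)
    qed
    have "summable (\<lambda>k. d k t)"
      by (rule summable_comparison_test'[OF summable_mult[OF summable_geometric] db]) auto
    then have "convergent (\<lambda>n. \<Sum>k<n. d k t)" by (simp add: summable_iff_convergent)
    moreover have "(\<Sum>k<n. d k t) = y n t - y 0 t" for n
      unfolding d_def by (rule sum_lessThan_telescope)
    ultimately have "convergent (\<lambda>n. y n t - y 0 t + y 0 t)" by (intro convergent_add convergent_const) simp
    then show "convergent (\<lambda>k. y k t)" by simp
  qed
  \<comment> \<open>On the null set where the sequence diverges the value of \<open>lim\<close> is
    arbitrary, which affects neither measurability nor energy.\<close>
  define w where "w t = lim (\<lambda>k. y k t)" for t
  have yw: "AE t in M. (\<lambda>k. y k t) \<longlonglongrightarrow> w t"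
    using conv by eventually_elim (simp add: w_def convergent_LIMSEQ_iff)
  have wsm: "strongly_measurable (lebesgue_on {0..}) w"
    by (rule strongly_measurable_limit_continuous[of y, OF yc]) (rule yw[unfolded M_def])
  have "energy {0..} (\<lambda>t. y k t - w t) \<le> ennreal ((norm (z k - z0))\<^sup>2)" for k
  proof -
    \<comment> \<open>Fatou's lemma in the second index carries the mutual estimate over to the
      limit.\<close>
    have "energy {0..} (\<lambda>t. y k t - w t) = (\<integral>\<^sup>+t. liminf (\<lambda>j. ennreal ((norm (y k t - y j t))\<^sup>2)) \<partial>M)"
      unfolding energy_def M_def[symmetric]
    proof (rule nn_integral_cong_AE, use yw in eventually_elim)
      fix t assume "(\<lambda>k. y k t) \<longlonglongrightarrow> w t"
      then have "(\<lambda>j. ennreal ((norm (y k t - y j t))\<^sup>2)) \<longlonglongrightarrow> ennreal ((norm (y k t - w t))\<^sup>2)"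
        by (intro tendsto_intros)
      then show "ennreal ((norm (y k t - w t))\<^sup>2) = liminf (\<lambda>j. ennreal ((norm (y k t - y j t))\<^sup>2))"
        by (rule lim_imp_Liminf[OF trivial_limit_sequentially, symmetric])
    qed
    also have "\<dots> \<le> liminf (\<lambda>j. \<integral>\<^sup>+t. ennreal ((norm (y k t - y j t))\<^sup>2) \<partial>M)"
      by (rule nn_integral_liminf[OF m])
    also have "\<dots> \<le> liminf (\<lambda>j. ennreal ((norm (z k - z j))\<^sup>2))"
      using ye by (intro Liminf_mono always_eventually) (simp add: energy_def M_def)
    also have "\<dots> = ennreal ((norm (z k - z0))\<^sup>2)"
    proof (rule lim_imp_Liminf)
      have "z \<longlonglongrightarrow> z0" by (rule geometric_tendsto[OF z])
      then show "(\<lambda>j. ennreal ((norm (z k - z j))\<^sup>2)) \<longlonglongrightarrow> ennreal ((norm (z k - z0))\<^sup>2)"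
        by (intro tendsto_intros)
    qed simp
    finally show ?thesis .
  qed
  with wsm show thesis by (rule that)
qed

locale passive_node =
  fixes D :: "'x::chilbert_space set" and G :: "'x \<Rightarrow> 'u::chilbert_space" and L :: "'x \<Rightarrow> 'x" and K :: "'x \<Rightarrow> 'u"
  assumes node: "boundary_node D G L K" and pass: "impedance_passive D G L K"
begin

abbreviation "classical \<equiv> classical_solution D G L K"
abbreviation "generalized \<equiv> generalized_solution D G L K"
abbreviation "D0 \<equiv> {x\<in>D. G x + K x = 0}"

lemma D: "csubspace D" and L: "clinear_on D L" and G: "clinear_on D G" and K: "clinear_on D K"
  and Gb: "graph_bounded D L G" and Kb: "graph_bounded D L K"
  using node by (auto simp: boundary_node_def graph_bounded_def)

lemma D_lincomb: "x \<in> D \<Longrightarrow> z \<in> D \<Longrightarrow> scaleC a x + scaleC b z \<in> D"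
  using D by (simp add: csubspace_def)

lemma lincomb:
  assumes "x \<in> D" "z \<in> D"
  shows "L (scaleC a x + scaleC b z) = scaleC a (L x) + scaleC b (L z)"
    "G (scaleC a x + scaleC b z) = scaleC a (G x) + scaleC b (G z)"
    "K (scaleC a x + scaleC b z) = scaleC a (K x) + scaleC b (K z)"
  using assms L G K D by (simp_all add: clinear_on_def csubspace_def)

text \<open>\<open>F\<close> is controlled by the graph norm, so continuity is needed for both
  components of that norm, \<open>x\<close> and \<open>L\<close> along \<open>x\<close>.\<close>

lemma graph_bounded_continuous:
  assumes F: "graph_bounded D L F" and x: "continuous_on S x" "continuous_on S (\<lambda>t. L (x t))"
    and xD: "\<And>t. t \<in> S \<Longrightarrow> x t \<in> D"
  shows "continuous_on S (\<lambda>t. F (x t))"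
  unfolding continuous_on
proof
  fix t assume t: "t \<in> S"
  obtain c where c: "\<And>x. x \<in> D \<Longrightarrow> norm (F x) \<le> c * graph_norm L x"
    using F by (auto simp: graph_bounded_def)
  have Fl: "clinear_on D F" using F by (simp add: graph_bounded_def)
  have "((\<lambda>s. x s) \<longlongrightarrow> x t) (at t within S)" "((\<lambda>s. L (x s)) \<longlongrightarrow> L (x t)) (at t within S)"
    using x t by (auto simp: continuous_on)
  then have "((\<lambda>s. c * sqrt ((norm (x s - x t))\<^sup>2 + (norm (L (x s) - L (x t)))\<^sup>2))
      \<longlongrightarrow> c * sqrt ((norm (x t - x t))\<^sup>2 + (norm (L (x t) - L (x t)))\<^sup>2)) (at t within S)"
    by (intro tendsto_intros)
  then have lim: "((\<lambda>s. c * sqrt ((norm (x s - x t))\<^sup>2 + (norm (L (x s) - L (x t)))\<^sup>2)) \<longlongrightarrow> 0) (at t within S)"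
    by simp
  have "norm (F (x s) - F (x t)) \<le> c * sqrt ((norm (x s - x t))\<^sup>2 + (norm (L (x s) - L (x t)))\<^sup>2)" if "s \<in> S" for s
    using c[of "x s - x t"] xD[OF that] xD[OF t] subspace_diff[OF csubspace_imp_subspace[OF D]]
    by (simp add: graph_norm_def clinear_on_diff[OF D L] clinear_on_diff[OF D Fl])
  then have "((\<lambda>s. F (x s) - F (x t)) \<longlongrightarrow> 0) (at t within S)"
    by (intro Lim_null_comparison[OF _ lim]) (auto simp: eventually_at_filter)
  then show "((\<lambda>s. F (x s)) \<longlongrightarrow> F (x t)) (at t within S)" by (simp add: LIM_zero_iff)
qed

lemma classicalI:
  assumes d: "\<And>t. 0 \<le> t \<Longrightarrow> (x has_vector_derivative L (x t)) (at t within {0..})"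
    and xD: "\<And>t. 0 \<le> t \<Longrightarrow> x t \<in> D" and c: "continuous_on {0..} (\<lambda>t. L (x t))"
  shows "classical x (\<lambda>t. G (x t)) (\<lambda>t. K (x t))"
proof -
  have "continuous_on {0..} x" by (rule continuous_on_vector_derivative) (use d in auto)
  then show ?thesis
    unfolding classical_solution_def
    using d xD c by (intro conjI exI[of _ "\<lambda>t. L (x t)"] graph_bounded_continuous[OF Gb] graph_bounded_continuous[OF Kb]) auto
qed

lemma classicalD:
  assumes "classical x u y"
  shows "\<And>t. 0 \<le> t \<Longrightarrow> (x has_vector_derivative L (x t)) (at t within {0..})"
    "\<And>t. 0 \<le> t \<Longrightarrow> x t \<in> D" "continuous_on {0..} (\<lambda>t. L (x t))"
    "\<And>t. 0 \<le> t \<Longrightarrow> G (x t) = u t" "\<And>t. 0 \<le> t \<Longrightarrow> K (x t) = y t"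
    "continuous_on {0..} u" "continuous_on {0..} y"
proof -
  obtain x' where c: "continuous_on {0..} x'"
    and x': "\<And>t. t \<ge> 0 \<Longrightarrow> (x has_vector_derivative x' t) (at t within {0..}) \<and>
              x t \<in> D \<and> x' t = L (x t) \<and> G (x t) = u t \<and> K (x t) = y t"
    and uy: "continuous_on {0..} u" "continuous_on {0..} y"
    using assms unfolding classical_solution_def by blast
  show "continuous_on {0..} (\<lambda>t. L (x t))" using c by (rule continuous_on_eq) (use x' in simp)
  show "\<And>t. 0 \<le> t \<Longrightarrow> (x has_vector_derivative L (x t)) (at t within {0..})" using x' by metis
qed (use assms in \<open>auto simp: classical_solution_def\<close>)

lemma classical_lincomb:
  assumes 1: "classical x u y" and 2: "classical x' u' y'"
  shows "classical (\<lambda>t. scaleC a (x t) + scaleC b (x' t)) (\<lambda>t. scaleC a (u t) + scaleC b (u' t))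
    (\<lambda>t. scaleC a (y t) + scaleC b (y' t))"
  unfolding classical_solution_def
proof (intro conjI exI[of _ "\<lambda>t. scaleC a (L (x t)) + scaleC b (L (x' t))"] allI impI)
  note bl = bounded_linear_scaleC
  show "continuous_on {0..} (\<lambda>t. scaleC a (L (x t)) + scaleC b (L (x' t)))"
    "continuous_on {0..} (\<lambda>t. scaleC a (u t) + scaleC b (u' t))"
    "continuous_on {0..} (\<lambda>t. scaleC a (y t) + scaleC b (y' t))"
    by (intro continuous_on_add bounded_linear.continuous_on[OF bl] classicalD[OF 1] classicalD[OF 2])+
  fix t :: real assume t: "0 \<le> t"
  note d1 = classicalD[OF 1] and d2 = classicalD[OF 2]
  show "((\<lambda>t. scaleC a (x t) + scaleC b (x' t)) has_vector_derivative
      scaleC a (L (x t)) + scaleC b (L (x' t))) (at t within {0..})"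
    by (intro has_vector_derivative_add bounded_linear.has_vector_derivative[OF bl] d1(1) d2(1) t)
  show "scaleC a (x t) + scaleC b (x' t) \<in> D" by (intro D_lincomb d1(2) d2(2) t)
  show "scaleC a (L (x t)) + scaleC b (L (x' t)) = L (scaleC a (x t) + scaleC b (x' t))"
    "G (scaleC a (x t) + scaleC b (x' t)) = scaleC a (u t) + scaleC b (u' t)"
    "K (scaleC a (x t) + scaleC b (x' t)) = scaleC a (y t) + scaleC b (y' t)"
    using t by (simp_all add: lincomb d1(2,4,5) d2(2,4,5))
qed

lemma classical_shift:
  assumes 1: "classical x u y" and s: "0 \<le> s"
  shows "classical (\<lambda>t. x (s + t)) (\<lambda>t. u (s + t)) (\<lambda>t. y (s + t))"
  unfolding classical_solution_def
proof (intro conjI exI[of _ "\<lambda>t. L (x (s + t))"] allI impI)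
  note d1 = classicalD[OF 1]
  have im: "(\<lambda>t. s + t) ` {0..} \<subseteq> {0..}" using s by auto
  show "continuous_on {0..} (\<lambda>t. L (x (s + t)))" "continuous_on {0..} (\<lambda>t. u (s + t))" "continuous_on {0..} (\<lambda>t. y (s + t))"
    by (rule continuous_on_compose2[OF d1(3)] continuous_on_compose2[OF d1(6)] continuous_on_compose2[OF d1(7)];
      intro continuous_intros im)+
  fix t :: real assume t: "0 \<le> t"
  have "(x \<circ> (\<lambda>t. s + t) has_vector_derivative (1 *\<^sub>R L (x (s + t)))) (at t within {0..})"
    by (rule vector_diff_chain_within)
      (use s t in \<open>auto intro!: derivative_eq_intros has_vector_derivative_within_subset[OF d1(1)]\<close>)
  then show "((\<lambda>t. x (s + t)) has_vector_derivative L (x (s + t))) (at t within {0..})" by (simp add: o_def)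
qed (use s classicalD[OF 1] in auto)

text \<open>The derivative of the squared norm of the state is twice the left side of the passivity
  inequality, and polarization expresses the supplied power by \<open>u\<close>, \<open>y\<close>
  and \<open>u + y\<close>. Writing sums on both sides avoids subtraction in \<open>ennreal\<close>
  and makes the relation stable under limits.\<close>

lemma classical_energy:
  assumes 1: "classical x u y" and t: "0 \<le> t"
  shows "ennreal ((norm (x t))\<^sup>2) + energy {0..t} u + energy {0..t} y
      \<le> ennreal ((norm (x 0))\<^sup>2) + energy {0..t} (\<lambda>s. u s + y s)" (is "?l \<le> ?r")
    and "impedance_energy_preserving D G L K \<Longrightarrow>
      ennreal ((norm (x t))\<^sup>2) + energy {0..t} u + energy {0..t} y
      = ennreal ((norm (x 0))\<^sup>2) + energy {0..t} (\<lambda>s. u s + y s)"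
proof -
  note d1 = classicalD[OF 1]
  have cu: "continuous_on {0..t} u" and cy: "continuous_on {0..t} y"
    using d1(6,7) by (auto intro: continuous_on_subset)
  have int: "(\<lambda>s. (norm (f s))\<^sup>2) integrable_on {0..t}" if "continuous_on {0..t} f" for f :: "real \<Rightarrow> 'u"
    by (intro integrable_continuous_real continuous_intros that)
  define I where "I f = integral {0..t} (\<lambda>s. (norm (f s))\<^sup>2)" for f :: "real \<Rightarrow> 'u"
  have I0: "0 \<le> I f" for f 
    by (cases "(\<lambda>s. (norm (f s))\<^sup>2) integrable_on {0..t}")
      (auto simp: I_def not_integrable_integral intro: Henstock_Kurzweil_Integration.integral_nonneg)
  have E: "energy {0..t} u = ennreal (I u)" "energy {0..t} y = ennreal (I y)"
    "energy {0..t} (\<lambda>s. u s + y s) = ennreal (I (\<lambda>s. u s + y s))"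
    unfolding I_def by (intro energy_continuous continuous_intros cu cy)+
  have x: "((\<lambda>s. 2 * inner (L (x s)) (x s)) has_integral (norm (x t))\<^sup>2 - (norm (x 0))\<^sup>2) {0..t}"
    using t by (intro fundamental_theorem_of_calculus has_real_derivative_norm_square)
      (auto intro: has_vector_derivative_within_subset[OF d1(1)])
  have uy: "((\<lambda>s. (norm (u s + y s))\<^sup>2 - (norm (u s))\<^sup>2 - (norm (y s))\<^sup>2) has_integral I (\<lambda>s. u s + y s) - I u - I y) {0..t}"
    unfolding I_def by (intro has_integral_diff integrable_integral int continuous_intros cu cy)
  have e: "(norm (u s + y s))\<^sup>2 - (norm (u s))\<^sup>2 - (norm (y s))\<^sup>2 = 2 * inner (u s) (y s)" for s
    unfolding power2_norm_eq_inner by (simp add: inner_add_left inner_add_right inner_commute)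
  have sum: "ennreal ((norm (x t))\<^sup>2) + ennreal (I u) + ennreal (I y) = ennreal ((norm (x t))\<^sup>2 + I u + I y)"
    "ennreal ((norm (x 0))\<^sup>2) + ennreal (I (\<lambda>s. u s + y s)) = ennreal ((norm (x 0))\<^sup>2 + I (\<lambda>s. u s + y s))"
    using I0 by simp_all
  have "(norm (x t))\<^sup>2 - (norm (x 0))\<^sup>2 \<le> I (\<lambda>s. u s + y s) - I u - I y"
  proof (rule has_integral_le[OF x uy])
    fix s assume "s \<in> {0..t}"
    then show "2 * inner (L (x s)) (x s) \<le> (norm (u s + y s))\<^sup>2 - (norm (u s))\<^sup>2 - (norm (y s))\<^sup>2"
      using pass d1(2,4,5)[of s] unfolding e by (auto simp: impedance_passive_def inner_eq_Re_cinner)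
  qed
  then show "?l \<le> ?r"
    unfolding E sum by (intro ennreal_leI) simp
  show "?l = ?r" if ep: "impedance_energy_preserving D G L K"
  proof -
    have "((\<lambda>s. 2 * inner (L (x s)) (x s)) has_integral I (\<lambda>s. u s + y s) - I u - I y) {0..t}"
    proof (rule has_integral_eq[OF _ uy])
      fix s assume "s \<in> {0..t}"
      then show "(norm (u s + y s))\<^sup>2 - (norm (u s))\<^sup>2 - (norm (y s))\<^sup>2 = 2 * inner (L (x s)) (x s)"
        using ep d1(2,4,5)[of s] unfolding e by (auto simp: impedance_energy_preserving_def inner_eq_Re_cinner)
    qed
    from has_integral_unique[OF this x] show ?thesis unfolding E sum by (simp add: algebra_simps)
  qed
qed

lemma generalizedE:
  assumes "generalized x u y"
  obtains xs us ys where "\<And>k. classical (xs k) (us k) (ys k)"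
    "\<And>t. 0 \<le> t \<Longrightarrow> (\<lambda>k. xs k t) \<longlonglongrightarrow> x t"
    "\<And>\<tau>. \<tau> > 0 \<Longrightarrow> uniform_limit {0..\<tau>} xs x sequentially" "L2_loc_lim us u" "L2_loc_lim ys y"
proof -
  from assms obtain xs us ys where *: "\<And>k. classical (xs k) (us k) (ys k)"
    "\<And>\<tau>. \<tau> > 0 \<Longrightarrow> uniform_limit {0..\<tau>} xs x sequentially" "L2_loc_lim us u" "L2_loc_lim ys y"
    unfolding generalized_solution_def by blast
  have "(\<lambda>k. xs k t) \<longlonglongrightarrow> x t" if "0 \<le> t" for t
    using tendsto_uniform_limitI[OF *(2)[of "t + 1"], of t] that by auto
  with * show thesis by (intro that) auto
qed

lemma generalizedD:
  assumes "generalized x u y"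
  shows "u \<in> L2_loc" "y \<in> L2_loc" "strongly_measurable (lebesgue_on {0..}) u" "strongly_measurable (lebesgue_on {0..}) y"
  using assms by (auto simp: generalized_solution_def L2_loc_iff)

lemma classical_measurable:
  assumes "classical x u y"
  shows "strongly_measurable (lebesgue_on {0..}) u" "strongly_measurable (lebesgue_on {0..}) y"
  using classicalD(6,7)[OF assms] by (auto intro: strongly_measurable_continuous)

lemma generalized_lincomb:
  assumes 1: "generalized x u y" and 2: "generalized x' u' y'"
  shows "generalized (\<lambda>t. scaleC a (x t) + scaleC b (x' t)) (\<lambda>t. scaleC a (u t) + scaleC b (u' t))
    (\<lambda>t. scaleC a (y t) + scaleC b (y' t))"
proof -
  obtain xs us ys where s: "\<And>k. classical (xs k) (us k) (ys k)"
    "\<And>\<tau>. \<tau> > 0 \<Longrightarrow> uniform_limit {0..\<tau>} xs x sequentially" "L2_loc_lim us u" "L2_loc_lim ys y"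
    using generalizedE[OF 1] by metis
  obtain xs' us' ys' where s': "\<And>k. classical (xs' k) (us' k) (ys' k)"
    "\<And>\<tau>. \<tau> > 0 \<Longrightarrow> uniform_limit {0..\<tau>} xs' x' sequentially" "L2_loc_lim us' u'" "L2_loc_lim ys' y'"
    using generalizedE[OF 2] by metis
  have c: "continuous_on {0..} x" "continuous_on {0..} x'" using 1 2 by (auto simp: generalized_solution_def)
  show ?thesis
    unfolding generalized_solution_def
  proof (intro conjI exI allI impI)
    show "continuous_on {0..} (\<lambda>t. scaleC a (x t) + scaleC b (x' t))"
      by (intro continuous_on_add bounded_linear.continuous_on[OF bounded_linear_scaleC] c)
    show "(\<lambda>t. scaleC a (u t) + scaleC b (u' t)) \<in> L2_loc" "(\<lambda>t. scaleC a (y t) + scaleC b (y' t)) \<in> L2_loc"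
      by (intro L2_loc_lincomb generalizedD[OF 1] generalizedD[OF 2])+
    show "classical (\<lambda>t. scaleC a (xs k t) + scaleC b (xs' k t)) (\<lambda>t. scaleC a (us k t) + scaleC b (us' k t))
        (\<lambda>t. scaleC a (ys k t) + scaleC b (ys' k t))" for k
      by (rule classical_lincomb[OF s(1) s'(1)])
    show "uniform_limit {0..\<tau>} (\<lambda>k t. scaleC a (xs k t) + scaleC b (xs' k t)) (\<lambda>t. scaleC a (x t) + scaleC b (x' t)) sequentially"
      if "\<tau> > 0" for \<tau>
      by (intro uniform_limit_add bounded_linear.uniform_limit[OF bounded_linear_scaleC] s(2) s'(2) that)
    show "L2_loc_lim (\<lambda>k t. scaleC a (us k t) + scaleC b (us' k t)) (\<lambda>t. scaleC a (u t) + scaleC b (u' t))"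
      by (intro L2_loc_lim_lincomb s s' classical_measurable[OF s(1)] classical_measurable[OF s'(1)] generalizedD[OF 1] generalizedD[OF 2])
    show "L2_loc_lim (\<lambda>k t. scaleC a (ys k t) + scaleC b (ys' k t)) (\<lambda>t. scaleC a (y t) + scaleC b (y' t))"
      by (intro L2_loc_lim_lincomb s s' classical_measurable[OF s(1)] classical_measurable[OF s'(1)] generalizedD[OF 1] generalizedD[OF 2])
  qed
qed

lemma generalized_add:
  "generalized x u y \<Longrightarrow> generalized x' u' y' \<Longrightarrow>
    generalized (\<lambda>t. x t + x' t) (\<lambda>t. u t + u' t) (\<lambda>t. y t + y' t)"
  using generalized_lincomb[of x u y x' u' y' 1 1] by simp

lemma generalized_diff:
  "generalized x u y \<Longrightarrow> generalized x' u' y' \<Longrightarrow>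
    generalized (\<lambda>t. x t - x' t) (\<lambda>t. u t - u' t) (\<lambda>t. y t - y' t)"
  using generalized_lincomb[of x u y x' u' y' 1 "-1"] by (simp add: scaleC_minus1)

lemma generalized_scaleC:
  "generalized x u y \<Longrightarrow> generalized (\<lambda>t. scaleC c (x t)) (\<lambda>t. scaleC c (u t)) (\<lambda>t. scaleC c (y t))"
  using generalized_lincomb[of x u y x u y c 0] by simp

lemma energy_limit_interval:
  fixes fs :: "nat \<Rightarrow> real \<Rightarrow> 'b::chilbert_space"
  assumes fs: "\<And>k. strongly_measurable (lebesgue_on {0..}) (fs k)" and f: "f \<in> L2_loc" and fl: "L2_loc_lim fs f"
    and s: "0 \<le> s" and t: "0 < t"
  shows "(\<lambda>k. energy {s..t} (fs k)) \<longlonglongrightarrow> energy {s..t} f"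
proof (rule energy_tendsto)
  have mono: "energy {s..t} h \<le> energy {0..t} h" for h :: "real \<Rightarrow> 'b"
    using s by (intro energy_mono) auto
  have fm: "strongly_measurable (lebesgue_on {0..}) f" "energy {0..t} f < \<infinity>"
    using f t by (auto simp: L2_loc_iff)
  show "strongly_measurable (lebesgue_on {s..t}) (fs k)" "strongly_measurable (lebesgue_on {s..t}) f" for k
    using fs fm s by (auto intro: sm_interval)
  show "energy {s..t} f < \<infinity>" using mono fm(2) by (rule le_less_trans)
  have lim: "(\<lambda>k. energy {0..t} (\<lambda>r. fs k r - f r)) \<longlonglongrightarrow> 0" using fl t by (simp add: L2_loc_lim_iff)
  show "(\<lambda>k. energy {s..t} (\<lambda>r. fs k r - f r)) \<longlonglongrightarrow> 0"
    by (rule tendsto_sandwich[OF _ _ tendsto_const lim]) (use mono in auto)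
qed simp

lemma L2_loc_lim_add:
  assumes "\<And>k. classical (xs k) (us k) (ys k)" "u \<in> L2_loc" "y \<in> L2_loc" "L2_loc_lim us u" "L2_loc_lim ys y"
  shows "L2_loc_lim (\<lambda>k t. us k t + ys k t) (\<lambda>t. u t + y t)"
  using L2_loc_lim_lincomb[of us u ys y 1 1] assms classical_measurable[OF assms(1)] by simp

lemma L2_loc_add: "f \<in> L2_loc \<Longrightarrow> g \<in> L2_loc \<Longrightarrow> (\<lambda>t. f t + g t) \<in> L2_loc"
  using L2_loc_lincomb[of f g 1 1] by simp

lemma generalized_energy:
  assumes 1: "generalized x u y" and t: "0 < t"
  shows "ennreal ((norm (x t))\<^sup>2) + energy {0..t} u + energy {0..t} y
      \<le> ennreal ((norm (x 0))\<^sup>2) + energy {0..t} (\<lambda>s. u s + y s)" (is "?l \<le> ?r")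
    and "impedance_energy_preserving D G L K \<Longrightarrow>
      ennreal ((norm (x t))\<^sup>2) + energy {0..t} u + energy {0..t} y
      = ennreal ((norm (x 0))\<^sup>2) + energy {0..t} (\<lambda>s. u s + y s)"
proof -
  obtain xs us ys where s: "\<And>k. classical (xs k) (us k) (ys k)"
    "\<And>t. 0 \<le> t \<Longrightarrow> (\<lambda>k. xs k t) \<longlonglongrightarrow> x t" "L2_loc_lim us u" "L2_loc_lim ys y"
    using generalizedE[OF 1] by metis
  note g = generalizedD[OF 1] and m = classical_measurable[OF s(1)]
  have E: "(\<lambda>k. energy {0..t} (us k)) \<longlonglongrightarrow> energy {0..t} u"
    "(\<lambda>k. energy {0..t} (ys k)) \<longlonglongrightarrow> energy {0..t} y"
    "(\<lambda>k. energy {0..t} (\<lambda>r. us k r + ys k r)) \<longlonglongrightarrow> energy {0..t} (\<lambda>r. u r + y r)"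
    by (rule energy_limit_interval; (intro m g s(3,4) L2_loc_add strongly_measurable_add L2_loc_lim_add[OF s(1)] order_refl t)+)+
  have l: "(\<lambda>k. ennreal ((norm (xs k t))\<^sup>2) + energy {0..t} (us k) + energy {0..t} (ys k))
      \<longlonglongrightarrow> ennreal ((norm (x t))\<^sup>2) + energy {0..t} u + energy {0..t} y"
    using t by (intro tendsto_intros E s(2)) auto
  have r: "(\<lambda>k. ennreal ((norm (xs k 0))\<^sup>2) + energy {0..t} (\<lambda>r. us k r + ys k r))
      \<longlonglongrightarrow> ennreal ((norm (x 0))\<^sup>2) + energy {0..t} (\<lambda>r. u r + y r)"
    by (intro tendsto_intros E s(2)) auto
  have t0: "0 \<le> t" using t by simp
  show "?l \<le> ?r"
    by (rule LIMSEQ_le[OF l r]) (use classical_energy(1)[OF s(1) t0] in blast)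
  show "?l = ?r" if "impedance_energy_preserving D G L K"
    using LIMSEQ_unique[OF l] r classical_energy(2)[OF s(1) t0 that] by simp
qed

lemma generalized_energy_halfline:
  assumes 1: "generalized x u y"
  shows "energy {0..} u + energy {0..} y \<le> ennreal ((norm (x 0))\<^sup>2) + energy {0..} (\<lambda>s. u s + y s)"
proof (rule LIMSEQ_le)
  let ?l = "\<lambda>n. energy {0..real n} u + energy {0..real n} y" and ?r = "\<lambda>n. ennreal ((norm (x 0))\<^sup>2) + energy {0..real n} (\<lambda>s. u s + y s)"
  note g = generalizedD[OF 1]
  show "(\<lambda>n. ?l n) \<longlonglongrightarrow> energy {0..} u + energy {0..} y"
    by (intro tendsto_add energy_halfline_tendsto g)
  show "(\<lambda>n. ?r n)
      \<longlonglongrightarrow> ennreal ((norm (x 0))\<^sup>2) + energy {0..} (\<lambda>s. u s + y s)"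
    by (intro tendsto_add tendsto_const energy_halfline_tendsto strongly_measurable_add g)
  have "?l n \<le> ?r n"
    if "n \<ge> 1" for n
  proof -
    have "?l n \<le> ennreal ((norm (x n))\<^sup>2) + energy {0..real n} u + energy {0..real n} y"
      by (simp add: add.assoc)
    also have "\<dots> \<le> ?r n"
      by (rule generalized_energy(1)[OF 1]) (use that in simp)
    finally show ?thesis .
  qed
  then show "\<exists>N. \<forall>n\<ge>N. ?l n \<le> ?r n" by blast
qed

section \<open>Closed loop solutions\<close>

lemma classical_cong:
  assumes "classical x u y" "\<And>t. 0 \<le> t \<Longrightarrow> u t = u' t"
  shows "classical x u' y"
proof -
  have "continuous_on {0..} u'"
    using classicalD(6)[OF assms(1)] by (rule continuous_on_eq) (use assms(2) in simp)
  then show ?thesis using assms unfolding classical_solution_def by auto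
qed

lemma closed_loop_dense: "closure D0 = UNIV"
  and closed_loop_orbit_dense: "closure {x\<in>D0. L x \<in> D0} = UNIV"
  and closed_loop_classical:
    "x0 \<in> D0 \<Longrightarrow> L x0 \<in> D0 \<Longrightarrow> \<exists>x y. classical x (\<lambda>t. - y t) y \<and> x 0 = x0"
proof -
  obtain l0 where "m_dissipative D0 L l0" by (rule closed_loop_m_dissipative[OF node pass])
  then interpret M: m_dissipative D0 L l0 .
  show "closure D0 = UNIV" by (rule M.domain_dense)
  show "closure {x\<in>D0. L x \<in> D0} = UNIV" by (rule M.domain2_dense)
  assume x0: "x0 \<in> D0" "L x0 \<in> D0"
  show "\<exists>x y. classical x (\<lambda>t. - y t) y \<and> x 0 = x0"
  proof (rule M.classical_orbit[OF x0])
    fix x assume x: "x 0 = x0" "\<And>t. 0 \<le> t \<Longrightarrow> x t \<in> D0"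
      "\<And>t. 0 \<le> t \<Longrightarrow> (x has_vector_derivative L (x t)) (at t within {0..})"
      "continuous_on {0..} (\<lambda>t. L (x t))"
    have "classical x (\<lambda>t. G (x t)) (\<lambda>t. K (x t))" by (rule classicalI) (use x in auto)
    then have "classical x (\<lambda>t. - K (x t)) (\<lambda>t. K (x t))"
      by (rule classical_cong) (use x(2) in \<open>auto simp: eq_neg_iff_add_eq_0\<close>)
    then show ?thesis
      using x(1) by (intro exI[of _ x] exI[of _ "\<lambda>t. K (x t)"] conjI)
  qed
qed

lemma energy_zero [simp]: "energy A (\<lambda>t. 0) = 0"
  by (simp add: energy_def)

text \<open>Smooth closed loop solutions start from a dense set. For the difference of two of them
  input plus output vanishes, so the energy inequality bounds state and output simultaneously by the
  distance of the initial states.\<close>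

lemma closed_loop_generalized: "\<exists>x y. generalized x (\<lambda>t. - y t) y \<and> x 0 = x0"
proof -
  \<comment> \<open>The geometric rate is what the almost everywhere convergence of the outputs in
    \<open>L2_fast_cauchy_limit\<close> requires.\<close>
  have "\<exists>z. z \<in> {x\<in>D0. L x \<in> D0} \<and> norm (z - x0) \<le> (1 / 4) ^ k" for k :: nat
  proof -
    have "x0 \<in> closure {x\<in>D0. L x \<in> D0}" unfolding closed_loop_orbit_dense by (rule UNIV_I)
    moreover have "(0::real) < (1 / 4) ^ k" by simp
    ultimately obtain z where "z \<in> {x\<in>D0. L x \<in> D0}" "dist z x0 < (1 / 4) ^ k"
      unfolding closure_approachable by blast
    then show ?thesis by (intro exI[of _ z]) (simp add: dist_norm less_imp_le)
  qed
  then obtain z where z: "\<And>k. z k \<in> D0" "\<And>k. L (z k) \<in> D0" "\<And>k. norm (z k - x0) \<le> (1 / 4) ^ k"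
    by (metis (no_types, lifting) mem_Collect_eq)
  have "\<forall>k. \<exists>p. classical (fst p) (\<lambda>t. - snd p t) (snd p) \<and> fst p 0 = z k"
    using closed_loop_classical[OF z(1,2)] by (metis fst_conv snd_conv)
  from choice[OF this] obtain p where "\<forall>k. classical (fst (p k)) (\<lambda>t. - snd (p k) t) (snd (p k)) \<and> fst (p k) 0 = z k"
    by blast
  then obtain xs ys where c: "\<And>k. classical (xs k) (\<lambda>t. - ys k t) (ys k)" and c0: "\<And>k. xs k 0 = z k"
    using that[of "\<lambda>k. fst (p k)" "\<lambda>k. snd (p k)"] by blast
  note yc = classicalD(7)[OF c] and ysm = classical_measurable(2)[OF c]
  have key: "ennreal ((norm (xs k t - xs j t))\<^sup>2) + energy {0..t} (\<lambda>s. ys k s - ys j s) \<le> ennreal ((norm (z k - z j))\<^sup>2)"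
    if t: "0 \<le> t" for k j t
  proof -
    have cd: "classical (\<lambda>t. xs k t - xs j t) (\<lambda>t. ys j t - ys k t) (\<lambda>t. ys k t - ys j t)"
      using classical_lincomb[OF c[of k] c[of j], of 1 "-1"] by (simp add: scaleC_minus1)
    have "ennreal ((norm (xs k t - xs j t))\<^sup>2) + energy {0..t} (\<lambda>s. ys k s - ys j s)
      \<le> ennreal ((norm (xs k t - xs j t))\<^sup>2) + energy {0..t} (\<lambda>s. ys j s - ys k s) + energy {0..t} (\<lambda>s. ys k s - ys j s)"
      by (intro add_right_mono) simp
    also have "\<dots> \<le> ennreal ((norm (xs k 0 - xs j 0))\<^sup>2)"
      using classical_energy(1)[OF cd t] by simp
    finally show ?thesis by (simp add: c0)
  qed
  have xd: "norm (xs k t - xs j t) \<le> norm (z k - z j)" if t: "0 \<le> t" for k j t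
  proof -
    have "ennreal ((norm (xs k t - xs j t))\<^sup>2) \<le> ennreal ((norm (z k - z j))\<^sup>2)"
      by (rule order_trans[OF _ key[OF t]]) simp
    then have "(norm (xs k t - xs j t))\<^sup>2 \<le> (norm (z k - z j))\<^sup>2" by simp
    then show ?thesis by (rule power2_le_imp_le) simp
  qed
  have yd: "energy {0..} (\<lambda>s. ys k s - ys j s) \<le> ennreal ((norm (z k - z j))\<^sup>2)" for k j
  proof (rule LIMSEQ_le_const2[OF energy_halfline_tendsto])
    show "strongly_measurable (lebesgue_on {0..}) (\<lambda>s. ys k s - ys j s)"
      by (intro strongly_measurable_diff ysm)
    have "energy {0..real n} (\<lambda>s. ys k s - ys j s) \<le> ennreal ((norm (z k - z j))\<^sup>2)" for n
      by (rule order_trans[OF _ key[of "real n"]]) simp_all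
    then show "\<exists>N. \<forall>n\<ge>N. energy {0..real n} (\<lambda>s. ys k s - ys j s) \<le> ennreal ((norm (z k - z j))\<^sup>2)" by blast
  qed
  have z0: "z \<longlonglongrightarrow> x0" by (rule geometric_tendsto[OF z(3)])
  have "uniformly_Cauchy_on {0..} xs"
    unfolding uniformly_Cauchy_on_def
  proof (intro allI impI)
    fix e :: real assume e: "e > 0"
    obtain N where N: "\<And>m n. m \<ge> N \<Longrightarrow> n \<ge> N \<Longrightarrow> dist (z m) (z n) < e"
      using metric_CauchyD[OF LIMSEQ_imp_Cauchy[OF z0] e] by blast
    show "\<exists>M. \<forall>x\<in>{0..}. \<forall>m\<ge>M. \<forall>n\<ge>M. dist (xs m x) (xs n x) < e"
      using le_less_trans[OF xd N[unfolded dist_norm]] by (intro exI[of _ N]) (auto simp: dist_norm)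
  qed
  then obtain x where x: "uniform_limit {0..} xs x sequentially"
    using Cauchy_uniformly_convergent uniformly_convergent_on_def by blast
  have xc: "continuous_on {0..} x"
  proof (rule uniform_limit_theorem[OF _ x])
    show "\<forall>\<^sub>F n in sequentially. continuous_on {0..} (xs n)"
      by (intro always_eventually allI, rule continuous_on_vector_derivative) (use classicalD(1)[OF c] in auto)
  qed simp
  obtain w where w: "strongly_measurable (lebesgue_on {0..}) w"
    "\<And>k. energy {0..} (\<lambda>t. ys k t - w t) \<le> ennreal ((norm (z k - x0))\<^sup>2)"
    using L2_fast_cauchy_limit[OF yc yd z(3)] by blast
  have lim: "(\<lambda>k. energy {0..\<tau>} (\<lambda>t. ys k t - w t)) \<longlonglongrightarrow> 0" for \<tau>
  proof (rule tendsto_sandwich[OF always_eventually always_eventually tendsto_const])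
    have "(\<lambda>k. ennreal ((norm (z k - x0))\<^sup>2)) \<longlonglongrightarrow> ennreal ((norm (x0 - x0))\<^sup>2)" by (intro tendsto_intros z0)
    then show "(\<lambda>k. ennreal ((norm (z k - x0))\<^sup>2)) \<longlonglongrightarrow> 0" by simp
    show "\<forall>k. energy {0..\<tau>} (\<lambda>t. ys k t - w t) \<le> ennreal ((norm (z k - x0))\<^sup>2)"
      by (intro allI order_trans[OF energy_mono w(2)]) auto
  qed simp
  have fin: "energy {0..\<tau>} w < \<infinity>" if "\<tau> > 0" for \<tau>
  proof -
    have 0: "energy {0..\<tau>} (ys 0) < \<infinity>"
      using continuous_on_subset[OF yc] by (subst energy_continuous) auto
    have "energy {0..\<tau>} (\<lambda>t. ys 0 t - w t) \<le> ennreal ((norm (z 0 - x0))\<^sup>2)"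
      by (intro order_trans[OF energy_mono w(2)]) auto
    then have 1: "energy {0..\<tau>} (\<lambda>t. ys 0 t - w t) < \<infinity>" by (simp add: le_less_trans)
    have "energy {0..\<tau>} (\<lambda>t. scaleC 1 (ys 0 t) + scaleC (-1) (ys 0 t - w t)) < \<infinity>"
      by (rule energy_lincomb_finite[OF _ _ _ 0 1]) (auto intro!: sm_interval strongly_measurable_diff w ysm)
    then show ?thesis by (simp add: scaleC_minus1)
  qed
  have wL: "w \<in> L2_loc" using w(1) fin by (simp add: L2_loc_iff)
  then have wL': "(\<lambda>t. - w t) \<in> L2_loc" using L2_loc_lincomb[of w w "-1" 0] by (simp add: scaleC_minus1)
  have "generalized x (\<lambda>t. - w t) w"
    unfolding generalized_solution_def
  proof (intro conjI xc wL wL', rule exI[of _ xs], rule exI[of _ "\<lambda>k t. - ys k t"], rule exI[of _ ys],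
      intro conjI allI impI c)
    show "uniform_limit {0..\<tau>} xs x sequentially" for \<tau>
      by (rule uniform_limit_on_subset[OF x]) auto
    show "L2_loc_lim ys w" using lim by (simp add: L2_loc_lim_iff)
    have "energy {0..\<tau>} (\<lambda>t. - ys k t - - w t) = energy {0..\<tau>} (\<lambda>t. ys k t - w t)" for k \<tau>
      by (simp add: energy_minus_commute)
    then show "L2_loc_lim (\<lambda>k t. - ys k t) (\<lambda>t. - w t)" using lim by (simp add: L2_loc_lim_iff)
  qed
  moreover have "x 0 = x0"
  proof (rule LIMSEQ_unique)
    show "(\<lambda>k. xs k 0) \<longlonglongrightarrow> x 0" by (rule tendsto_uniform_limitI[OF x]) simp
    show "(\<lambda>k. xs k 0) \<longlonglongrightarrow> x0" using z0 by (simp add: c0)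
  qed
  ultimately show ?thesis by blast
qed

section \<open>The optimal cost\<close>

lemma cost_integral:
  assumes "generalized x u y"
  shows "(\<integral>\<^sup>+t. ennreal ((norm (u t))\<^sup>2 + (norm (y t))\<^sup>2) \<partial>lebesgue_on {0..}) = energy {0..} u + energy {0..} y"
proof -
  have "(\<integral>\<^sup>+t. ennreal ((norm (u t))\<^sup>2 + (norm (y t))\<^sup>2) \<partial>lebesgue_on {0..})
    = (\<integral>\<^sup>+t. ennreal ((norm (u t))\<^sup>2) + ennreal ((norm (y t))\<^sup>2) \<partial>lebesgue_on {0..})"
    by (simp add: ennreal_plus)
  also have "\<dots> = energy {0..} u + energy {0..} y"
    unfolding energy_def
    by (intro nn_integral_add measurable_norm_square generalizedD[OF assms]) simp_all
  finally show ?thesis .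
qed

lemma cost_le:
  assumes "generalized x u y"
  shows "cost D G L K (x 0) u \<le> energy {0..} u + energy {0..} y"
  unfolding cost_def cost_integral[OF assms, symmetric] using assms by (intro Inf_lower) blast

lemma cost_cases:
  assumes "cost D G L K x0 u < c"
  obtains x y where "generalized x u y" "x 0 = x0" "energy {0..} u + energy {0..} y < c"
proof -
  obtain x y where 1: "generalized x u y" "x 0 = x0"
    and lt: "(\<integral>\<^sup>+t. ennreal ((norm (u t))\<^sup>2 + (norm (y t))\<^sup>2) \<partial>lebesgue_on {0..}) < c"
    using assms unfolding cost_def by (auto simp: Inf_less_iff)
  with cost_integral[OF 1(1)] show thesis by (intro that[OF 1]) simp
qed

lemma optimal_cost_le:
  assumes g: "generalized x u y" and fin: "energy {0..} u < \<infinity>"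
  shows "optimal_cost D G L K (x 0) \<le> energy {0..} u + energy {0..} y"
proof -
  have "u \<in> L2" using fin generalizedD(3)[OF g] by (simp add: L2_iff)
  then have "optimal_cost D G L K (x 0) \<le> cost D G L K (x 0) u"
    unfolding optimal_cost_def by (rule INF_lower)
  also note cost_le[OF g]
  finally show ?thesis .
qed

lemma closed_loop_cost:
  assumes "generalized x (\<lambda>t. - y t) y"
  shows "energy {0..} (\<lambda>t. - y t) + energy {0..} y \<le> ennreal ((norm (x 0))\<^sup>2)"
  using generalized_energy_halfline[OF assms] by simp

lemma closed_loop_L2:
  assumes "generalized x (\<lambda>t. - y t) y"
  shows "(\<lambda>t. - y t) \<in> L2"
proof -
  have "energy {0..} y \<le> ennreal ((norm (x 0))\<^sup>2)"
    by (rule order_trans[OF _ closed_loop_cost[OF assms]]) simp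
  then have "energy {0..} y < \<infinity>" by (simp add: le_less_trans)
  then show ?thesis using generalizedD[OF assms] by (simp add: L2_iff)
qed

lemma finite_cost: "finite_cost_condition D G L K"
  unfolding finite_cost_condition_def
proof
  fix x0
  obtain x y where 1: "generalized x (\<lambda>t. - y t) y" "x 0 = x0" using closed_loop_generalized by blast
  have "cost D G L K (x 0) (\<lambda>t. - y t) \<le> ennreal ((norm (x 0))\<^sup>2)"
    by (rule order_trans[OF cost_le[OF 1(1)] closed_loop_cost[OF 1(1)]])
  then have "cost D G L K x0 (\<lambda>t. - y t) < \<infinity>" using 1(2) by (simp add: le_less_trans)
  then show "\<exists>u\<in>L2. cost D G L K x0 u < \<infinity>" using closed_loop_L2[OF 1(1)] by blast
qed

lemma optimal_cost_le_norm: "optimal_cost D G L K x0 \<le> ennreal ((norm x0)\<^sup>2)"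
proof -
  obtain x y where 1: "generalized x (\<lambda>t. - y t) y" "x 0 = x0" using closed_loop_generalized by blast
  have "optimal_cost D G L K (x 0) \<le> energy {0..} (\<lambda>t. - y t) + energy {0..} y"
    by (rule optimal_cost_le[OF 1(1)]) (use closed_loop_L2[OF 1(1)] in \<open>simp only: L2_iff\<close>)
  also have "\<dots> \<le> ennreal ((norm (x 0))\<^sup>2)" by (rule closed_loop_cost[OF 1(1)])
  finally show ?thesis by (simp add: 1(2))
qed

lemma optimal_cost_finite: "optimal_cost D G L K x0 < \<infinity>"
  using optimal_cost_le_norm[of x0] by (simp add: le_less_trans)

section \<open>The value function as a quadratic form\<close>

definition opt_val :: "'x \<Rightarrow> real"
  where "opt_val x0 = enn2real (optimal_cost D G L K x0)"

lemma optimal_cost_eq: "optimal_cost D G L K x0 = ennreal (opt_val x0)"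
  using optimal_cost_finite[of x0] by (simp add: opt_val_def less_top)

lemma opt_val_nonneg: "0 \<le> opt_val x" and opt_val_le: "opt_val x \<le> (norm x)\<^sup>2"
proof -
  show "0 \<le> opt_val x" by (simp add: opt_val_def)
  show "opt_val x \<le> (norm x)\<^sup>2" using optimal_cost_le_norm[of x] by (simp add: optimal_cost_eq)
qed

lemma opt_val_upper:
  assumes "generalized x u y" "x 0 = x0" "energy {0..} u + energy {0..} y \<le> ennreal r" "0 \<le> r"
  shows "opt_val x0 \<le> r"
proof -
  have "energy {0..} u \<le> ennreal r" by (rule order_trans[OF _ assms(3)]) simp
  then have "energy {0..} u < \<infinity>" by (simp add: le_less_trans)
  from optimal_cost_le[OF assms(1) this] assms(2,3) have "optimal_cost D G L K x0 \<le> ennreal r" by simp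
  then show ?thesis using assms(4) by (simp add: optimal_cost_eq)
qed

lemma opt_val_near:
  assumes "e > 0"
  obtains x u y where "generalized x u y" "x 0 = x0" "energy {0..} u + energy {0..} y \<le> ennreal (opt_val x0 + e)"
proof -
  have "optimal_cost D G L K x0 < ennreal (opt_val x0 + e)"
    using assms opt_val_nonneg[of x0] by (simp add: optimal_cost_eq ennreal_less_iff)
  then obtain u where "cost D G L K x0 u < ennreal (opt_val x0 + e)"
    unfolding optimal_cost_def by (auto simp: INF_less_iff)
  then show thesis by (rule cost_cases) (use that in \<open>auto intro: less_imp_le\<close>)
qed

text \<open>Scaling a near-optimal solution gives a competitor. Equality follows in the next lemma
  by applying this to \<open>inverse c\<close>.\<close>

lemma opt_val_scaleC_le: "opt_val (scaleC c x0) \<le> (cmod c)\<^sup>2 * opt_val x0"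
proof (rule field_le_epsilon)
  fix e :: real assume e: "e > 0"
  \<comment> \<open>The summand 1 in the denominator keeps the division meaningful for
    \<open>c = 0\<close>.\<close>
  define d where "d = e / (1 + (cmod c)\<^sup>2)"
  have p: "1 + (cmod c)\<^sup>2 > 0" by (simp add: add_pos_nonneg)
  have d: "d > 0" using e p by (simp add: d_def)
  obtain x u y where 1: "generalized x u y" "x 0 = x0" "energy {0..} u + energy {0..} y \<le> ennreal (opt_val x0 + d)"
    by (rule opt_val_near[OF d])
  note m = generalizedD(3,4)[OF 1(1)]
  have "opt_val (scaleC c x0) \<le> (cmod c)\<^sup>2 * (opt_val x0 + d)"
  proof (rule opt_val_upper[OF generalized_scaleC[OF 1(1)]])
    have "energy {0..} (\<lambda>t. scaleC c (u t)) + energy {0..} (\<lambda>t. scaleC c (y t))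
      = ennreal ((cmod c)\<^sup>2) * (energy {0..} u + energy {0..} y)"
      using m by (simp add: energy_scaleC distrib_left)
    also have "\<dots> \<le> ennreal ((cmod c)\<^sup>2) * ennreal (opt_val x0 + d)" by (intro mult_left_mono 1) simp
    also have "\<dots> = ennreal ((cmod c)\<^sup>2 * (opt_val x0 + d))"
      using d opt_val_nonneg[of x0] by (intro ennreal_mult[symmetric]) auto
    finally show "energy {0..} (\<lambda>t. scaleC c (u t)) + energy {0..} (\<lambda>t. scaleC c (y t)) \<le> ennreal ((cmod c)\<^sup>2 * (opt_val x0 + d))" .
  qed (use 1(2) d opt_val_nonneg[of x0] in auto)
  also have "\<dots> \<le> (cmod c)\<^sup>2 * opt_val x0 + e"
  proof -
    have "(cmod c)\<^sup>2 * d \<le> (1 + (cmod c)\<^sup>2) * d" using d by (intro mult_right_mono) auto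
    also have "\<dots> = e" using p by (simp add: d_def)
    finally show ?thesis by (simp add: distrib_left)
  qed
  finally show "opt_val (scaleC c x0) \<le> (cmod c)\<^sup>2 * opt_val x0 + e" .
qed

lemma opt_val_scaleC: "opt_val (scaleC c x0) = (cmod c)\<^sup>2 * opt_val x0"
proof (cases "c = 0")
  case True
  then show ?thesis using opt_val_le[of 0] opt_val_nonneg[of 0] by simp
next
  case False
  have "opt_val x0 \<le> (cmod (inverse c))\<^sup>2 * opt_val (scaleC c x0)"
    using opt_val_scaleC_le[of "inverse c" "scaleC c x0"] False by (simp add: scaleC_scaleC)
  then have "(cmod c)\<^sup>2 * opt_val x0 \<le> (cmod c)\<^sup>2 * ((cmod (inverse c))\<^sup>2 * opt_val (scaleC c x0))"
    by (rule mult_left_mono) simp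
  also have "\<dots> = (cmod (c * inverse c))\<^sup>2 * opt_val (scaleC c x0)"
    by (simp only: norm_mult power_mult_distrib mult.assoc)
  also have "\<dots> = opt_val (scaleC c x0)" using False by simp
  finally have "(cmod c)\<^sup>2 * opt_val x0 \<le> opt_val (scaleC c x0)" .
  with opt_val_scaleC_le[of c x0] show ?thesis by simp
qed

text \<open>Sum and difference of near-optimal solutions from \<open>x0\<close> and
  \<open>z0\<close> compete for \<open>x0 + z0\<close> and \<open>x0 - z0\<close>, and their
  energies obey the parallelogram law. Each tolerance \<open>e / 4\<close> enters with factor
  2.\<close>

lemma opt_val_parallelogram_le: "opt_val (x0 + z0) + opt_val (x0 - z0) \<le> 2 * opt_val x0 + 2 * opt_val z0"
proof (rule field_le_epsilon)
  fix e :: real assume "e > 0"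
  then have e: "e / 4 > 0" by simp
  obtain x u y where 1: "generalized x u y" "x 0 = x0" "energy {0..} u + energy {0..} y \<le> ennreal (opt_val x0 + e / 4)"
    by (rule opt_val_near[OF e])
  obtain x' u' y' where 2: "generalized x' u' y'" "x' 0 = z0" "energy {0..} u' + energy {0..} y' \<le> ennreal (opt_val z0 + e / 4)"
    by (rule opt_val_near[OF e])
  note m1 = generalizedD(3,4)[OF 1(1)] and m2 = generalizedD(3,4)[OF 2(1)]
  define a where "a = energy {0..} (\<lambda>t. u t + u' t) + energy {0..} (\<lambda>t. y t + y' t)"
  define b where "b = energy {0..} (\<lambda>t. u t - u' t) + energy {0..} (\<lambda>t. y t - y' t)"
  define R where "R = 2 * (opt_val x0 + e / 4) + 2 * (opt_val z0 + e / 4)"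
  have two: "2 * ennreal r = ennreal (2 * r)" if "0 \<le> r" for r
    using that by (simp add: ennreal_mult)
  have halfline: "{0::real..} \<in> sets lebesgue" by simp
  have nn: "0 \<le> opt_val x0 + e / 4" "0 \<le> opt_val z0 + e / 4" using e opt_val_nonneg[of x0] opt_val_nonneg[of z0] by simp_all
  have "a + b = (energy {0..} (\<lambda>t. u t + u' t) + energy {0..} (\<lambda>t. u t - u' t))
      + (energy {0..} (\<lambda>t. y t + y' t) + energy {0..} (\<lambda>t. y t - y' t))"
    by (simp add: a_def b_def ac_simps)
  also have "\<dots> = 2 * (energy {0..} u + energy {0..} y) + 2 * (energy {0..} u' + energy {0..} y')"
    unfolding energy_parallelogram[OF m1(1) m2(1) halfline] energy_parallelogram[OF m1(2) m2(2) halfline]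
    by (simp only: distrib_left ac_simps)
  also have "\<dots> \<le> 2 * ennreal (opt_val x0 + e / 4) + 2 * ennreal (opt_val z0 + e / 4)"
    by (intro add_mono mult_left_mono 1(3) 2(3)) auto
  also have "\<dots> = ennreal R"
    unfolding R_def two[OF nn(1)] two[OF nn(2)] using nn by (intro ennreal_plus[symmetric]) auto
  finally have ab: "a + b \<le> ennreal R" .
  then have fin: "a < \<infinity>" "b < \<infinity>"
    using le_less_trans[OF _ ennreal_less_top[of R]] by (auto intro: le_less_trans[OF order_trans[OF _ ab]])
  then have r: "a = ennreal (enn2real a)" "b = ennreal (enn2real b)" by (simp_all add: less_top)
  have "opt_val (x0 + z0) \<le> enn2real a"
    by (rule opt_val_upper[OF generalized_add[OF 1(1) 2(1)]]) (use 1(2) 2(2) r in \<open>auto simp: a_def\<close>)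
  moreover have "opt_val (x0 - z0) \<le> enn2real b"
    by (rule opt_val_upper[OF generalized_diff[OF 1(1) 2(1)]]) (use 1(2) 2(2) r in \<open>auto simp: b_def\<close>)
  moreover have "enn2real a + enn2real b \<le> R"
  proof -
    have "ennreal (enn2real a + enn2real b) \<le> ennreal R" using ab r by (simp add: ennreal_plus)
    moreover have "0 \<le> R" using nn by (simp add: R_def)
    ultimately show ?thesis by (simp only: ennreal_le_iff)
  qed
  ultimately show "opt_val (x0 + z0) + opt_val (x0 - z0) \<le> 2 * opt_val x0 + 2 * opt_val z0 + e" by (simp add: R_def)
qed

text \<open>The reverse inequality is the proved one at \<open>x + z\<close> and
  \<open>x - z\<close>, combined with homogeneity for the factor 2.\<close>

lemma opt_val_parallelogram: "opt_val (x + z) + opt_val (x - z) = 2 * opt_val x + 2 * opt_val z"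
proof (rule antisym[OF opt_val_parallelogram_le])
  have d: "opt_val (2 *\<^sub>R w) = 4 * opt_val w" for w
    using opt_val_scaleC[of 2 w] by (simp add: scaleR_eq_scaleC)
  have "opt_val (2 *\<^sub>R x) + opt_val (2 *\<^sub>R z) \<le> 2 * opt_val (x + z) + 2 * opt_val (x - z)"
    using opt_val_parallelogram_le[of "x + z" "x - z"] by (simp add: scaleR_2)
  then show "2 * opt_val x + 2 * opt_val z \<le> opt_val (x + z) + opt_val (x - z)" by (simp add: d)
qed

lemma optimal_cost_operator_exists: "\<exists>!P. is_optimal_cost_operator D G L K P"
proof -
  obtain P where P: "bounded_clinear P" "\<And>x z. cinner (P x) z = cinner x (P z)"
    "\<And>x. cinner x (P x) = complex_of_real (opt_val x)"
    using quadratic_form_operator[of opt_val, OF opt_val_parallelogram opt_val_scaleC opt_val_nonneg opt_val_le] by blast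
  show ?thesis
  proof (rule ex1I[of _ P])
    show "is_optimal_cost_operator D G L K P"
      using P optimal_cost_finite by (simp add: is_optimal_cost_operator_def opt_val_def)
    fix Q assume Q: "is_optimal_cost_operator D G L K Q"
    show "Q = P"
      by (rule selfadjoint_eqI) (use Q P in \<open>auto simp: is_optimal_cost_operator_def opt_val_def\<close>)
  qed
qed

lemma optimal_cost_operator_le:
  "is_optimal_cost_operator D G L K P \<Longrightarrow> Re (cinner x0 (P x0)) \<le> (norm x0)\<^sup>2"
  using opt_val_le[of x0] by (simp add: is_optimal_cost_operator_def opt_val_def)

end

lemma energy_zero_AE:
  assumes "strongly_measurable (lebesgue_on A) f" "A \<in> sets lebesgue" "energy A f = 0"
  shows "AE t in lebesgue_on A. f t = 0"
proof -
  have "AE t in lebesgue_on A. ennreal ((norm (f t))\<^sup>2) = 0"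
    using assms(3) unfolding energy_def
    by (simp only: nn_integral_0_iff_AE[OF measurable_norm_square[OF assms(1,2)]])
  then show ?thesis by eventually_elim simp
qed

lemma generalized_solutionI:
  assumes "continuous_on {0..} x" "u \<in> L2_loc" "y \<in> L2_loc"
    and "\<And>k. classical_solution D G L K (xs k) (us k) (ys k)"
    and "\<And>\<tau>. \<tau> > 0 \<Longrightarrow> uniform_limit {0..\<tau>} xs x sequentially"
    and "L2_loc_lim us u" "L2_loc_lim ys y"
  shows "generalized_solution D G L K x u y"
  unfolding generalized_solution_def using assms by blast

context passive_node
begin

section \<open>Strong stability of the closed loop\<close>

text \<open>Subtracting the semigroup orbit started at \<open>x s\<close> from the shifted solution
  leaves a solution with zero initial state. Closed loop orbits satisfy \<open>G + K = 0\<close>, so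
  its input plus output is still \<open>u + y\<close>, and the energy inequality bounds its
  state.\<close>

lemma state_deviation:
  assumes gen: "generates D0 L T" and 1: "generalized x u y" and s: "0 \<le> s" and t: "0 < t"
  shows "ennreal ((norm (x (s + t) - T t (x s)))\<^sup>2) \<le> energy {s..s + t} (\<lambda>r. u r + y r)"
proof -
  interpret T: C0 T by (rule generates_C0[OF gen])
  have t0: "0 \<le> t" using t by simp
  \<comment> \<open>An orbit is a classical solution only when it starts in the generator domain.
    The extra term for a mismatch between \<open>z\<close> and \<open>x s\<close> is removed by
    density in \<open>step2\<close>.\<close>
  have step1: "ennreal ((norm (x (s + t) - T t z))\<^sup>2) \<le> ennreal ((norm (x s - z))\<^sup>2) + energy {s..s + t} (\<lambda>r. u r + y r)"
    if c: "classical x u y" and z: "z \<in> D0" for x u y z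
  proof -
    define z' where "z' r = T r z" for r
    have zD: "z' r \<in> D0" "L (z' r) = T r (L z)" if "0 \<le> r" for r
      using generates_orbit[OF gen z that] by (auto simp: z'_def)
    have zc: "classical z' (\<lambda>r. G (z' r)) (\<lambda>r. K (z' r))"
    proof (rule classicalI)
      show "(z' has_vector_derivative L (z' r)) (at r within {0..})" if "0 \<le> r" for r
        using generates_orbit(3)[OF gen z that] by (simp add: z'_def[abs_def])
      show "continuous_on {0..} (\<lambda>r. L (z' r))"
        by (rule continuous_on_eq[OF T.orbit_continuous[of "L z"]]) (simp add: zD(2))
    qed (use zD in auto)
    note d = classical_lincomb[OF classical_shift[OF c s] zc, of 1 "-1"]
    have "ennreal ((norm (x (s + t) - T t z))\<^sup>2)
      \<le> ennreal ((norm (x (s + 0) - z' 0))\<^sup>2) + energy {0..t} (\<lambda>r. (u (s + r) - G (z' r)) + (y (s + r) - K (z' r)))"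
    proof -
      have "ennreal ((norm (x (s + t) - T t z))\<^sup>2) \<le> ennreal ((norm (x (s + t) - z' t))\<^sup>2)
        + energy {0..t} (\<lambda>r. u (s + r) - G (z' r)) + energy {0..t} (\<lambda>r. y (s + r) - K (z' r))"
        by (simp add: z'_def add.assoc)
      also have "\<dots> \<le> ennreal ((norm (x (s + 0) - z' 0))\<^sup>2)
        + energy {0..t} (\<lambda>r. (u (s + r) - G (z' r)) + (y (s + r) - K (z' r)))"
        using classical_energy(1)[OF d t0] by (simp add: scaleC_minus1)
      finally show ?thesis .
    qed
    also have "energy {0..t} (\<lambda>r. (u (s + r) - G (z' r)) + (y (s + r) - K (z' r))) = energy {0..t} (\<lambda>r. u (s + r) + y (s + r))"
    proof (rule energy_cong_AE, rule AE_I2)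
      fix r assume "r \<in> space (lebesgue_on {0..t})"
      then have "G (z' r) + K (z' r) = 0" using zD(1)[of r] by simp
      moreover have "(u (s + r) - G (z' r)) + (y (s + r) - K (z' r)) = u (s + r) + y (s + r) - (G (z' r) + K (z' r))"
        by (simp add: algebra_simps)
      ultimately show "norm ((u (s + r) - G (z' r)) + (y (s + r) - K (z' r))) = norm (u (s + r) + y (s + r))"
        by (simp only: diff_zero)
    qed
    also have "\<dots> = energy {s..s + t} (\<lambda>r. u r + y r)"
    proof -
      have cuy: "continuous_on {0..} (\<lambda>r. u r + y r)" by (intro continuous_intros classicalD[OF c])
      have "continuous_on {0..t} (\<lambda>r. u (s + r) + y (s + r))"
        by (rule continuous_on_compose2[OF cuy, of _ "\<lambda>r. s + r"]) (use s in \<open>auto intro!: continuous_intros\<close>)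
      then have "energy {0..t} (\<lambda>r. u (s + r) + y (s + r)) = ennreal (integral {0..t} (\<lambda>r. (norm (u (s + r) + y (s + r)))\<^sup>2))"
        by (rule energy_continuous)
      also have "integral {0..t} (\<lambda>r. (norm (u (s + r) + y (s + r)))\<^sup>2) = integral {s..s + t} (\<lambda>r. (norm (u r + y r))\<^sup>2)"
        using integral_shift_Icc_real[of 0 t "\<lambda>r. (norm (u r + y r))\<^sup>2" s] by (simp add: o_def add.commute)
      also have "ennreal \<dots> = energy {s..s + t} (\<lambda>r. u r + y r)"
        by (rule energy_continuous[symmetric]) (use s in \<open>auto intro: continuous_on_subset[OF cuy]\<close>)
      finally show ?thesis .
    qed
    finally show ?thesis by (simp add: z'_def)
  qed
  have step2: "ennreal ((norm (x (s + t) - T t (x s)))\<^sup>2) \<le> energy {s..s + t} (\<lambda>r. u r + y r)"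
    if c: "classical x u y" for x u y
  proof -
    obtain z where z: "\<And>n. z n \<in> D0" "z \<longlonglongrightarrow> x s"
      using closed_loop_dense unfolding set_eq_iff closure_sequential by blast
    have "(\<lambda>n. ennreal ((norm (x (s + t) - T t (z n)))\<^sup>2)) \<longlonglongrightarrow> ennreal ((norm (x (s + t) - T t (x s)))\<^sup>2)"
      by (intro tendsto_intros bounded_linear.tendsto[OF T.T_bl[OF t0]] z)
    moreover have "(\<lambda>n. ennreal ((norm (x s - z n))\<^sup>2) + energy {s..s + t} (\<lambda>r. u r + y r))
        \<longlonglongrightarrow> ennreal ((norm (x s - x s))\<^sup>2) + energy {s..s + t} (\<lambda>r. u r + y r)"
      by (intro tendsto_intros z)
    ultimately show ?thesis
      using LIMSEQ_le[of "\<lambda>n. ennreal ((norm (x (s + t) - T t (z n)))\<^sup>2)" _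
        "\<lambda>n. ennreal ((norm (x s - z n))\<^sup>2) + energy {s..s + t} (\<lambda>r. u r + y r)"] step1[OF c z(1)]
      by simp
  qed
  obtain xs us ys where c: "\<And>k. classical (xs k) (us k) (ys k)"
    "\<And>t. 0 \<le> t \<Longrightarrow> (\<lambda>k. xs k t) \<longlonglongrightarrow> x t" "L2_loc_lim us u" "L2_loc_lim ys y"
    using generalizedE[OF 1] by metis
  note g = generalizedD[OF 1] and m = classical_measurable[OF c(1)]
  show ?thesis
  proof (rule LIMSEQ_le)
    show "(\<lambda>k. ennreal ((norm (xs k (s + t) - T t (xs k s)))\<^sup>2)) \<longlonglongrightarrow> ennreal ((norm (x (s + t) - T t (x s)))\<^sup>2)"
      using s t by (intro tendsto_intros bounded_linear.tendsto[OF T.T_bl[OF t0]] c(2)) auto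
    show "(\<lambda>k. energy {s..s + t} (\<lambda>r. us k r + ys k r)) \<longlonglongrightarrow> energy {s..s + t} (\<lambda>r. u r + y r)"
      using s t by (intro energy_limit_interval strongly_measurable_add m L2_loc_add g L2_loc_lim_add[OF c(1)] c(3,4)) auto
    show "\<exists>N. \<forall>k\<ge>N. ennreal ((norm (xs k (s + t) - T t (xs k s)))\<^sup>2) \<le> energy {s..s + t} (\<lambda>r. us k r + ys k r)"
      using step2[OF c(1)] by blast
  qed
qed

text \<open>Choose \<open>s\<close> with little energy of \<open>u + y\<close> left after it. From
  then on the state stays close to the semigroup orbit of \<open>x s\<close>, which decays by
  stability.\<close>

lemma state_tendsto_zero:
  assumes gen: "generates D0 L T" and stable: "strongly_stable T" and 1: "generalized x u y"
    and fin: "energy {0..} (\<lambda>t. u t + y t) < \<infinity>"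
  shows "(x \<longlongrightarrow> 0) at_top"
proof (rule tendstoI)
  fix e :: real assume e: "e > 0"
  note g = generalizedD(3,4)[OF 1]
  have uy: "strongly_measurable (lebesgue_on {0..}) (\<lambda>t. u t + y t)" by (rule strongly_measurable_add[OF g])
  have "0 < ennreal ((e / 2)\<^sup>2)" using e by simp
  then obtain s where s: "0 \<le> s" "energy {s..} (\<lambda>t. u t + y t) < ennreal ((e / 2)\<^sup>2)"
    by (rule energy_tail[OF uy fin])
  have "((\<lambda>t. norm (T t (x s))) \<longlongrightarrow> 0) at_top" using stable by (simp add: strongly_stable_def)
  then have "\<forall>\<^sub>F t in at_top. norm (T t (x s)) < e / 2" using e by (intro order_tendstoD(2)) auto
  then obtain t0 where t0: "\<And>t. t \<ge> t0 \<Longrightarrow> norm (T t (x s)) < e / 2" by (auto simp: eventually_at_top_linorder)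
  have "dist (x r) 0 < e" if r: "r \<ge> s + max t0 1" for r
  proof -
    define t where "t = r - s"
    have t: "t > 0" "t \<ge> t0" "r = s + t" using r by (auto simp: t_def)
    have "ennreal ((norm (x (s + t) - T t (x s)))\<^sup>2) \<le> energy {s..s + t} (\<lambda>r. u r + y r)"
      by (rule state_deviation[OF gen 1 s(1) t(1)])
    also have "\<dots> \<le> energy {s..} (\<lambda>r. u r + y r)" by (rule energy_mono) auto
    also note s(2)
    finally have "(norm (x (s + t) - T t (x s)))\<^sup>2 < (e / 2)\<^sup>2" by (simp add: ennreal_less_iff)
    then have "norm (x (s + t) - T t (x s)) < e / 2" by (rule power2_less_imp_less) (use e in simp)
    then show ?thesis
      using t0[OF t(2)] norm_triangle_sub[of "x (s + t)" "T t (x s)"] by (simp add: t(3))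
  qed
  then show "\<forall>\<^sub>F r in at_top. dist (x r) 0 < e" unfolding eventually_at_top_linorder by blast
qed

lemma energy_sum_finite:
  assumes "generalized x u y" "energy {0..} u + energy {0..} y < \<infinity>"
  shows "energy {0..} (\<lambda>t. u t + y t) < \<infinity>"
  by (rule energy_triangle(1)) (use generalizedD(3,4)[OF assms(1)] assms(2) in \<open>auto simp: less_top\<close>)

text \<open>Changes the boundary operator from \<open>G + K\<close> with zero input back to
  \<open>G\<close>: each approximant with input \<open>us k\<close> becomes one with input
  \<open>us k - ys k\<close>. This gives the generalized sense of
  \<open>(G + K) x = 0\<close>.\<close>

lemma closed_loop_equation:
  assumes "generalized_solution D (\<lambda>x. G x + K x) L K x (\<lambda>t. 0) y"
  shows "generalized x (\<lambda>t. - y t) y"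
proof -
  obtain xs us ys where cx: "continuous_on {0..} x" and y: "y \<in> L2_loc"
    and c: "\<And>k. classical_solution D (\<lambda>x. G x + K x) L K (xs k) (us k) (ys k)"
    and l: "\<And>\<tau>. \<tau> > 0 \<Longrightarrow> uniform_limit {0..\<tau>} xs x sequentially" "L2_loc_lim us (\<lambda>t. 0)" "L2_loc_lim ys y"
    using assms unfolding generalized_solution_def by blast
  have c': "classical (xs k) (\<lambda>t. us k t - ys k t) (ys k)" for k
  proof -
    obtain x' where "continuous_on {0..} x'" "\<forall>t\<ge>0. (xs k has_vector_derivative x' t) (at t within {0..}) \<and>
        xs k t \<in> D \<and> x' t = L (xs k t) \<and> G (xs k t) + K (xs k t) = us k t \<and> K (xs k t) = ys k t"
      using c[of k] unfolding classical_solution_def by blast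
    then show ?thesis
      using c[of k] unfolding classical_solution_def
      by (intro conjI exI[of _ x']) (auto intro!: continuous_on_diff simp: eq_diff_eq)
  qed
  have m: "strongly_measurable (lebesgue_on {0..}) (us k)" "strongly_measurable (lebesgue_on {0..}) (ys k)" for k
    using c[of k] by (auto simp: classical_solution_def intro!: strongly_measurable_continuous)
  have z: "(\<lambda>t. 0 :: 'u) \<in> L2_loc" using L2_loc_lincomb[OF y y, of 0 0] by simp
  have "(\<lambda>t. - y t) \<in> L2_loc" using L2_loc_lincomb[OF y y, of "-1" 0] by (simp add: scaleC_minus1)
  moreover have "L2_loc_lim (\<lambda>k t. us k t - ys k t) (\<lambda>t. - y t)"
    using L2_loc_lim_lincomb[OF m(1) z l(2) m(2) y l(3), of 1 "-1"] by (simp add: scaleC_minus1)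
  ultimately show ?thesis
    using generalized_solutionI[OF cx _ y c' l(1) _ l(3)] by blast
qed

lemma closed_loop_equation_exists:
  "\<exists>x y. generalized_solution D (\<lambda>x. G x + K x) L K x (\<lambda>t. 0) y \<and> x 0 = x0"
proof -
  obtain x y where 1: "generalized x (\<lambda>t. - y t) y" "x 0 = x0" using closed_loop_generalized by blast
  obtain xs us ys where c: "\<And>k. classical (xs k) (us k) (ys k)"
    "\<And>\<tau>. \<tau> > 0 \<Longrightarrow> uniform_limit {0..\<tau>} xs x sequentially" "L2_loc_lim us (\<lambda>t. - y t)" "L2_loc_lim ys y"
    using generalizedE[OF 1(1)] by metis
  have c': "classical_solution D (\<lambda>x. G x + K x) L K (xs k) (\<lambda>t. us k t + ys k t) (ys k)" for k
    using c(1)[of k] unfolding classical_solution_def by (auto intro!: continuous_on_add)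
  note g = generalizedD[OF 1(1)]
  have l: "L2_loc_lim (\<lambda>k t. us k t + ys k t) (\<lambda>t. 0)"
    using L2_loc_lim_add[OF c(1) g(1,2) c(3,4)] by simp
  have z: "(\<lambda>t. 0 :: 'u) \<in> L2_loc" using L2_loc_lincomb[OF g(1) g(1), of 0 0] by simp
  have "continuous_on {0..} x" using 1(1) by (simp add: generalized_solution_def)
  then have "generalized_solution D (\<lambda>x. G x + K x) L K x (\<lambda>t. 0) y"
    using generalized_solutionI[OF _ z g(2) c' c(2) l c(4)] by blast
  then show ?thesis using 1(2) by blast
qed

text \<open>For the identity operator the equation is the power balance, with the supplied power
  expanded by polarization.\<close>

lemma riccati_id:
  assumes ep: "impedance_energy_preserving D G L K"
  shows "boundary_riccati D G L K (\<lambda>x. x) (\<lambda>x. G x + K x)"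
  unfolding boundary_riccati_def
proof
  fix x assume x: "x \<in> D"
  have e: "Re (cinner (L x) x) = Re (cinner (G x) (K x))"
    using ep x by (simp add: impedance_energy_preserving_def)
  have "cinner (L x) x + cinner x (L x) = complex_of_real (2 * Re (cinner (L x) x))"
    using cinner_commute[of x "L x"] by (simp add: complex_add_cnj)
  moreover have "(norm (G x + K x))\<^sup>2 = (norm (G x))\<^sup>2 + (norm (K x))\<^sup>2 + 2 * Re (cinner (G x) (K x))"
    by (simp add: power2_norm_eq_inner inner_add_left inner_add_right inner_commute inner_eq_Re_cinner[symmetric])
  ultimately show "cinner (L x) x + cinner x (L x) + complex_of_real ((norm (G x))\<^sup>2) + complex_of_real ((norm (K x))\<^sup>2)
      = complex_of_real ((norm (G x + K x))\<^sup>2)"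
    by (simp add: e)
qed

end

section \<open>Optimality under energy preservation and strong stability\<close>

locale stable_preserving_node = passive_node D G L K
  for D :: "'x::chilbert_space set" and G :: "'x \<Rightarrow> 'u::chilbert_space" and L and K +
  fixes T
  assumes gen: "generates {x\<in>D. G x + K x = 0} L T" and stable: "strongly_stable T"
    and ep: "impedance_energy_preserving D G L K"
begin

text \<open>The limit of the balance on \<open>[0, n]\<close>. Finite cost makes
  \<open>u + y\<close> square integrable, which lets the terminal state vanish in the limit.\<close>

lemma energy_balance_halfline:
  assumes 1: "generalized x u y" and fin: "energy {0..} u + energy {0..} y < \<infinity>"
  shows "energy {0..} u + energy {0..} y = ennreal ((norm (x 0))\<^sup>2) + energy {0..} (\<lambda>t. u t + y t)"
proof (rule LIMSEQ_unique)
  let ?f = "(\<lambda>n. ennreal ((norm (x (real n)))\<^sup>2) + energy {0..real n} u + energy {0..real n} y)"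
  note g = generalizedD(3,4)[OF 1]
  have "(\<lambda>n. x (real n)) \<longlonglongrightarrow> 0"
    by (rule filterlim_compose[OF state_tendsto_zero[OF gen stable 1 energy_sum_finite[OF 1 fin]] filterlim_real_sequentially])
  then have "?f
      \<longlonglongrightarrow> ennreal ((norm (0::'x))\<^sup>2) + energy {0..} u + energy {0..} y"
    by (intro tendsto_intros energy_halfline_tendsto g)
  then show "?f \<longlonglongrightarrow> energy {0..} u + energy {0..} y"
    by simp
  have "(\<lambda>n. ennreal ((norm (x 0))\<^sup>2) + energy {0..real n} (\<lambda>t. u t + y t)) \<longlonglongrightarrow> ennreal ((norm (x 0))\<^sup>2) + energy {0..} (\<lambda>t. u t + y t)"
    by (intro tendsto_add tendsto_const energy_halfline_tendsto strongly_measurable_add g)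
  moreover have "\<forall>\<^sub>F n in sequentially. ennreal ((norm (x 0))\<^sup>2) + energy {0..real n} (\<lambda>t. u t + y t)
      = ennreal ((norm (x (real n)))\<^sup>2) + energy {0..real n} u + energy {0..real n} y"
    using eventually_gt_at_top[of 0] by eventually_elim (rule generalized_energy(2)[OF 1 _ ep, symmetric], simp)
  ultimately show "?f
      \<longlonglongrightarrow> ennreal ((norm (x 0))\<^sup>2) + energy {0..} (\<lambda>t. u t + y t)"
    by (rule Lim_transform_eventually)
qed

lemma cost_ge_norm:
  shows "ennreal ((norm x0)\<^sup>2) \<le> cost D G L K x0 u"
proof (rule ccontr)
  assume "\<not> ?thesis"
  then have "cost D G L K x0 u < ennreal ((norm x0)\<^sup>2)" by simp
  then obtain x y where 1: "generalized x u y" "x 0 = x0" "energy {0..} u + energy {0..} y < ennreal ((norm x0)\<^sup>2)"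
    by (rule cost_cases)
  have "energy {0..} u + energy {0..} y < \<infinity>" using 1(3) by (rule less_trans) simp
  from energy_balance_halfline[OF 1(1) this] 1(2,3) show False
    by (simp add: not_less[symmetric])
qed

lemma closed_loop_optimal:
  assumes 1: "generalized x (\<lambda>t. - y t) y"
  shows "is_optimal_control D G L K (x 0) (\<lambda>t. - y t)"
  unfolding is_optimal_control_def
  using closed_loop_L2[OF 1] order_trans[OF order_trans[OF cost_le[OF 1] closed_loop_cost[OF 1]] cost_ge_norm]
  by blast

text \<open>An optimal \<open>v\<close> has trajectories whose cost exceeds the minimum by less than
  \<open>e\<close>, so by the balance \<open>v + y'\<close> has energy at most \<open>e\<close>.
  Subtracting the feedback solution leaves zero initial state, input \<open>v + y\<close> and input
  plus output \<open>v + y'\<close>; the energy inequality bounds the former by the latter.\<close>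

lemma optimal_control_unique:
  assumes 1: "generalized x (\<lambda>t. - y t) y" and v: "is_optimal_control D G L K (x 0) v"
  shows "AE t in lebesgue_on {0..}. v t = - y t"
proof -
  have v2: "v \<in> L2" and "cost D G L K (x 0) v \<le> cost D G L K (x 0) (\<lambda>t. - y t)"
    using v closed_loop_L2[OF 1] by (auto simp: is_optimal_control_def)
  note this(2)
  also note cost_le[OF 1]
  also note closed_loop_cost[OF 1]
  finally have cv: "cost D G L K (x 0) v \<le> ennreal ((norm (x 0))\<^sup>2)" .
  have m: "strongly_measurable (lebesgue_on {0..}) (\<lambda>t. v t + y t)"
    using v2 generalizedD[OF 1] by (intro strongly_measurable_add) (auto simp: L2_iff)
  have "energy {0..} (\<lambda>t. v t + y t) \<le> 0"
  proof (rule ennreal_le_epsilon)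
    fix e :: real assume e: "0 < e"
    have "cost D G L K (x 0) v < ennreal ((norm (x 0))\<^sup>2 + e)"
      using cv by (rule le_less_trans) (use e in \<open>simp add: ennreal_less_iff\<close>)
    then obtain x' y' where 2: "generalized x' v y'" "x' 0 = x 0"
      "energy {0..} v + energy {0..} y' < ennreal ((norm (x 0))\<^sup>2 + e)"
      by (rule cost_cases)
    have "energy {0..} v + energy {0..} y' < \<infinity>" using 2(3) by (rule less_trans) simp
    from energy_balance_halfline[OF 2(1) this]
    have "ennreal ((norm (x 0))\<^sup>2) + energy {0..} (\<lambda>t. v t + y' t) \<le> ennreal ((norm (x 0))\<^sup>2) + ennreal e"
      using 2(2,3) e by (simp add: ennreal_plus[symmetric] less_imp_le del: ennreal_plus)
    then have le: "energy {0..} (\<lambda>t. v t + y' t) \<le> ennreal e" by (simp add: ennreal_add_left_cancel_le)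
    have "energy {0..} (\<lambda>t. v t - - y t) + energy {0..} (\<lambda>t. y' t - y t)
      \<le> ennreal ((norm (x' 0 - x 0))\<^sup>2) + energy {0..} (\<lambda>t. (v t - - y t) + (y' t - y t))"
      by (rule generalized_energy_halfline[OF generalized_diff[OF 2(1) 1]])
    then have "energy {0..} (\<lambda>t. v t + y t) + energy {0..} (\<lambda>t. y' t - y t) \<le> energy {0..} (\<lambda>t. v t + y' t)"
      by (simp add: 2(2) algebra_simps)
    then have "energy {0..} (\<lambda>t. v t + y t) \<le> energy {0..} (\<lambda>t. v t + y' t)"
      by (rule order_trans[rotated]) simp
    then show "energy {0..} (\<lambda>t. v t + y t) \<le> 0 + ennreal e" using le by simp
  qed
  then have "energy {0..} (\<lambda>t. v t + y t) = 0" by simp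
  from energy_zero_AE[OF m _ this] have "AE t in lebesgue_on {0..}. v t + y t = 0" by simp
  then show ?thesis by eventually_elim (simp add: eq_neg_iff_add_eq_0)
qed

lemma optimal_cost_operator_id:
  shows "is_optimal_cost_operator D G L K (\<lambda>x. x)"
proof -
  have "optimal_cost D G L K x0 = ennreal ((norm x0)\<^sup>2)" for x0
    using optimal_cost_le_norm[of x0] cost_ge_norm[of x0]
    by (intro antisym) (auto simp: optimal_cost_def intro: INF_greatest)
  moreover have "bounded_clinear (\<lambda>x::'x. x)"
    by (auto simp: bounded_clinear_def clinear_on_def intro: exI[of _ 1])
  ultimately show ?thesis by (simp add: is_optimal_cost_operator_def cinner_same)
qed

end

text \<open>The feedback system is expressed as a generalized solution with boundary operator
  \<open>G + K\<close> and zero input. Functions are not identified up to null sets, so uniqueness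
  of the control holds almost everywhere.\<close>

theorem theorem5:
  fixes D :: "'x::chilbert_space set"
    and G :: "'x \<Rightarrow> 'u::chilbert_space"
    and L :: "'x \<Rightarrow> 'x"
    and K :: "'x \<Rightarrow> 'u"
  assumes node: "boundary_node D G L K"
    and imp_passive: "impedance_passive D G L K"
  shows "finite_cost_condition D G L K \<and>
    (\<exists>!P. is_optimal_cost_operator D G L K P) \<and>
    (\<forall>P. is_optimal_cost_operator D G L K P \<longrightarrow> (\<forall>x0. Re (cinner x0 (P x0)) \<le> (norm x0)\<^sup>2)) \<and>
    (impedance_energy_preserving D G L K \<and>
     (\<exists>T. generates {x\<in>D. G x + K x = 0} L T \<and> strongly_stable T) \<longrightarrow>
       is_optimal_cost_operator D G L K (\<lambda>x. x) \<and>
       (\<forall>x0.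
         (\<exists>x y. generalized_solution D (\<lambda>x. G x + K x) L K x (\<lambda>t. 0) y \<and> x 0 = x0) \<and>
         (\<forall>x y. generalized_solution D (\<lambda>x. G x + K x) L K x (\<lambda>t. 0) y \<and> x 0 = x0 \<longrightarrow>
            generalized_solution D G L K x (\<lambda>t. - y t) y \<and>
            is_optimal_control D G L K x0 (\<lambda>t. - y t) \<and>
            (\<forall>v. is_optimal_control D G L K x0 v \<longrightarrow>
              (AE t in lebesgue_on {0..}. v t = - y t)))) \<and>
       boundary_riccati D G L K (\<lambda>x. x) (\<lambda>x. G x + K x))"
proof -
  interpret passive_node D G L K using node imp_passive by unfold_locales
  show ?thesis
  proof (intro conjI impI allI; (elim conjE exE)?)
    show "finite_cost_condition D G L K" by (rule finite_cost)
    show "\<exists>!P. is_optimal_cost_operator D G L K P" by (rule optimal_cost_operator_exists)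
    show "Re (cinner x0 (P x0)) \<le> (norm x0)\<^sup>2" if "is_optimal_cost_operator D G L K P" for P x0
      using that by (rule optimal_cost_operator_le)
    fix T assume ep: "impedance_energy_preserving D G L K" and T: "generates D0 L T" "strongly_stable T"
    then interpret stable_preserving_node D G L K T by unfold_locales
    show "is_optimal_cost_operator D G L K (\<lambda>x. x)" by (rule optimal_cost_operator_id)
    show "boundary_riccati D G L K (\<lambda>x. x) (\<lambda>x. G x + K x)" by (rule riccati_id[OF ep])
    fix x0
    show "\<exists>x y. generalized_solution D (\<lambda>x. G x + K x) L K x (\<lambda>t. 0) y \<and> x 0 = x0"
      by (rule closed_loop_equation_exists)
    fix x y assume s: "generalized_solution D (\<lambda>x. G x + K x) L K x (\<lambda>t. 0) y" and x0: "x 0 = x0"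
    note g = closed_loop_equation[OF s]
    show "generalized x (\<lambda>t. - y t) y" by (rule g)
    show "is_optimal_control D G L K x0 (\<lambda>t. - y t)" using closed_loop_optimal[OF g] x0 by simp
    fix v assume "is_optimal_control D G L K x0 v"
    then show "AE t in lebesgue_on {0..}. v t = - y t" using optimal_control_unique[OF g] x0 by simp
  qed
qed

end
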